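(* The congruence $B_{MA}$ of lines in $\mathbb{P}^5$ corresponding to a completely exceptional Monge-Ampère system (of the fourth order) coincides with a congruence $B$ which is the residual of $\mathbb{G}(1,L)\cup B''$ in $\Gamma\cap Q$, for some quadric $Q\subset\mathbb{P}^{14}$ containing $\mathbb{G}(1,L)\cup B''$. In particular $B_{MA}$ has multidegree $(1,3,3)$.
   Context: Everything is over $\mathbb{C}$. Monge-Ampère systems. Let $h(u_1,\dots,u_5)=d\det\begin{pmatrix} u_1 & u_2 & u_3 \\ u_2 & u_3 & u_4 \\ u_3 & u_4 & u_5 \end{pmatrix}+a_1(u_1u_3-u_2^2)+\cdots+b_1u_1+\cdots+c$ be a linear combination with constant coefficients of the minors of all orders of this matrix (coefficient $d$ of the $3\times3$ minor, $a_1,\dots,a_6$ of the distinct $2\times2$ minors, $b_1,\dots,b_5$ of the entries, and constant term $c$), with $d\neq0$. The completely exceptional Monge-Ampère equation of the fourth order is $h=0$ for $u_1=\frac{\partial^4u}{\partial x^4},\ u_2=\frac{\partial^4u}{\partial x^3\partial t},\ u_3=\frac{\partial^4u}{\partial x^2\partial t^2},\ u_4=\frac{\partial^4u}{\partial x\partial t^3},\ u_5=\frac{\partial^4u}{\partial t^4}$; it gives the system of conservation laws $(u_i)_t=(u_{i+1})_x$, $i=1,\dots,4$, together with $h(u_1,\dots,u_5)=0$. The corresponding congruence $B_{MA}$ is the (closure of the) family of lines in $\mathbb{P}^5$, with homogeneous coordinates $(y_0:\dots:y_5)$, given by $u_0y_i=u_iy_0-u_{i+1}y_5$, $i=1,\dots,4$,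 where, for $u_0=1$, $(u_1,\dots,u_5)$ satisfies $h=0$. Congruences. $\mathbb{G}(1,5)\subset\mathbb{P}^{14}$ is the Grassmannian of lines in $\mathbb{P}^5$ with Plücker coordinates $p_{ij}=x_iy_j-x_jy_i$ for the line joining $(x_0:\dots:x_5)$ and $(y_0:\dots:y_5)$. $\Gamma=\mathbb{G}(1,5)\cap V(p_{01}+p_{25},\,p_{02}+p_{35},\,p_{03}+p_{45})$, of dimension $5$. $L\cong\mathbb{P}^3$ is the subspace where the coordinates of index $0$ and $5$ vanish, and $\mathbb{G}(1,L)\subset\Gamma$ is the set of lines in $L$. $B''$ is the component of $\Gamma\cap V(p_{05})$ other than $\mathbb{G}(1,L)$ (set-theoretically $\Gamma\cap V(p_{05})=\mathbb{G}(1,L)\cup B''$). The quadrics containing $\mathbb{G}(1,L)\cup B''$ are, modulo those containing $\Gamma$, of the form $V(q)$ with $$q=-d(p_{15}p_{34}-p_{25}p_{24}+p_{35}p_{23})+p_{05}\big(a_1p_{12}+a_2p_{13}+a_3p_{14}+a_4p_{23}+a_5p_{24}+a_6p_{34}-(b_1p_{15}+b_2p_{25}+b_3p_{35}+b_4p_{45})+b_5p_{04}-cp_{05}\big).$$ A congruence of lines in $\mathbb{P}^5$ is a flat family of lines of dimension $4$; its multidegree $(a_0,a_1,a_2)$ consists of: $a_0$, the number of its lines through a general point; $a_1$, the number of its lines contained in a general hyperplane and meeting a general line of that hyperplane; $a_2$, the number of its lines contained in a general $\mathbb{P}^3$. *)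

theory Defs
  imports "HOL-Analysis.Analysis"
begin

section \<open>Polynomials and the Zariski topology\<close>

text \<open>Polynomial functions in the entries of a matrix. As the ground field is infinite,
  polynomials and polynomial functions are the same thing.\<close>

inductive_set mpoly_fun :: "((complex^'m^'n) \<Rightarrow> complex) set" where
  const: "(\<lambda>A. k) \<in> mpoly_fun"
| coord: "(\<lambda>A. A $ i $ j) \<in> mpoly_fun"
| add: "f \<in> mpoly_fun \<Longrightarrow> g \<in> mpoly_fun \<Longrightarrow> (\<lambda>A. f A + g A) \<in> mpoly_fun"
| mult: "f \<in> mpoly_fun \<Longrightarrow> g \<in> mpoly_fun \<Longrightarrow> (\<lambda>A. f A * g A) \<in> mpoly_fun"

definition form :: "nat \<Rightarrow> ((complex^'m^'n) \<Rightarrow> complex) \<Rightarrow> bool" where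
  "form e f \<longleftrightarrow> f \<in> mpoly_fun \<and> (\<forall>k A. f (\<chi> i j. k * A $ i $ j) = k ^ e * f A)"

text \<open>The property \<open>P\<close> holds for a general matrix, that is on a non-empty Zariski open set.\<close>

definition general :: "((complex^'m^'n) \<Rightarrow> bool) \<Rightarrow> bool" where
  "general P \<longleftrightarrow> (\<exists>F\<in>mpoly_fun. (\<exists>A. F A \<noteq> 0) \<and> (\<forall>A. F A \<noteq> 0 \<longrightarrow> P A))"

text \<open>A point of the 14-dimensional projective space with coordinates \<open>p\<^sub>i\<^sub>j\<close>, \<open>0 \<le> i < j \<le> 5\<close>, is
  represented by the non-zero skew-symmetric matrices of its homogeneous coordinates; a
  subset of this space is represented by the set of all representatives of its points.
  The type \<open>6\<close> has the elements \<open>0, \<dots>, 5\<close>.\<close>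

definition P14 :: "(complex^6^6) set" where
  "P14 = {p. p \<noteq> 0 \<and> (\<forall>i j. p $ i $ j = - p $ j $ i)}"

definition zariski :: "(complex^6^6) topology" where
  "zariski = topology_generated_by {{p \<in> P14. f p \<noteq> 0} | f. \<exists>e. form e f}"

definition irreducible_in :: "'a topology \<Rightarrow> 'a set \<Rightarrow> bool" where
  "irreducible_in X S \<longleftrightarrow> S \<subseteq> topspace X \<and> S \<noteq> {} \<and>
     (\<forall>C D. closedin X C \<longrightarrow> closedin X D \<longrightarrow> S \<subseteq> C \<union> D \<longrightarrow> S \<subseteq> C \<or> S \<subseteq> D)"

definition irreducible_component_of :: "'a topology \<Rightarrow> 'a set \<Rightarrow> 'a set \<Rightarrow> bool" where
  "irreducible_component_of X S Z \<longleftrightarrow> Z \<subseteq> S \<and> irreducible_in X Z \<and>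
     (\<forall>W. Z \<subseteq> W \<longrightarrow> W \<subseteq> S \<longrightarrow> irreducible_in X W \<longrightarrow> W = Z)"

definition irreducible_chain :: "'a topology \<Rightarrow> 'a set \<Rightarrow> nat \<Rightarrow> (nat \<Rightarrow> 'a set) \<Rightarrow> bool" where
  "irreducible_chain X S n Z \<longleftrightarrow>
     (\<forall>i\<le>n. closedin (subtopology X S) (Z i) \<and> irreducible_in X (Z i)) \<and>
     (\<forall>i<n. Z i \<subset> Z (Suc i))"

text \<open>The Krull dimension of \<open>S\<close> is \<open>n\<close>.\<close>

definition has_dim :: "'a topology \<Rightarrow> 'a set \<Rightarrow> nat \<Rightarrow> bool" where
  "has_dim X S n \<longleftrightarrow>
     (\<exists>Z. irreducible_chain X S n Z) \<and> (\<forall>m Z. irreducible_chain X S m Z \<longrightarrow> m \<le> n)"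

definition quadric :: "(complex^6^6) set \<Rightarrow> bool" where
  "quadric Q \<longleftrightarrow> (\<exists>q. form 2 q \<and> (\<exists>p\<in>P14. q p \<noteq> 0) \<and> Q = {p \<in> P14. q p = 0})"

text \<open>What remains of \<open>Y\<close> once \<open>X\<close> is removed: for closed \<open>X\<close> and \<open>Y\<close>, the union of the
  irreducible components of \<open>Y\<close> that are not contained in \<open>X\<close>.\<close>

definition residual :: "(complex^6^6) set \<Rightarrow> (complex^6^6) set \<Rightarrow> (complex^6^6) set" where
  "residual X Y = zariski closure_of (Y - X)"

section \<open>Families of lines in the 5-dimensional projective space\<close>

text \<open>Linear subspaces of the projective space are given by the corresponding vector
  subspaces of \<open>complex^6\<close>; in particular, lines by the two-dimensional ones.
  The prefix \<open>vec\<close> refers to linear algebra over the complex numbers.\<close>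

definition wedge :: "complex^6 \<Rightarrow> complex^6 \<Rightarrow> complex^6^6" where
  "wedge x y = (\<chi> i j. x $ i * y $ j - x $ j * y $ i)"

definition proj_line :: "(complex^6) set \<Rightarrow> bool" where
  "proj_line l \<longleftrightarrow> vec.subspace l \<and> vec.dim l = 2"

definition pluecker :: "(complex^6) set set \<Rightarrow> (complex^6^6) set" where
  "pluecker F = {wedge x y | x y. proj_line (vec.span {x, y}) \<and> vec.span {x, y} \<in> F}"

definition lines_of :: "(complex^6^6) set \<Rightarrow> (complex^6) set set" where
  "lines_of B = {l. proj_line l \<and> pluecker {l} \<subseteq> B}"

definition grassmannian :: "(complex^6^6) set" where
  "grassmannian = pluecker {l. proj_line l}"

text \<open>A family of lines parametrized by a closed subset \<open>B\<close> of the Grassmannian is the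
  restriction to \<open>B\<close> of the universal projective line bundle, so it is automatically flat.\<close>

definition congruence :: "(complex^6^6) set \<Rightarrow> bool" where
  "congruence B \<longleftrightarrow> closedin zariski B \<and> B \<subseteq> grassmannian \<and> has_dim zariski B 4"

text \<open>General points, flags (line in a hyperplane) and 3-spaces are the ones spanned by the
  rows of a general matrix. In the second clause, the line is spanned by the first two of
  the five rows that span the hyperplane.\<close>

definition has_multidegree :: "(complex^6^6) set \<Rightarrow> nat \<Rightarrow> nat \<Rightarrow> nat \<Rightarrow> bool" where
  "has_multidegree B a0 a1 a2 \<longleftrightarrow>
     general (\<lambda>A :: complex^6^1.
       let N = {l \<in> lines_of B. vec.span (rows A) \<subseteq> l} in finite N \<and> card N = a0) \<and>
     general (\<lambda>A :: complex^6^5.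
       let N = {l \<in> lines_of B. l \<subseteq> vec.span (rows A) \<and>
                  l \<inter> vec.span {row 1 A, row 2 A} \<noteq> {0}} in finite N \<and> card N = a1) \<and>
     general (\<lambda>A :: complex^6^4.
       let N = {l \<in> lines_of B. l \<subseteq> vec.span (rows A)} in finite N \<and> card N = a2)"

definition Gam :: "(complex^6^6) set" where
  "Gam = grassmannian \<inter> {p. p$0$1 + p$2$5 = 0 \<and> p$0$2 + p$3$5 = 0 \<and> p$0$3 + p$4$5 = 0}"

definition L :: "(complex^6) set" where
  "L = {x. x $ 0 = 0 \<and> x $ 5 = 0}"

definition G1L :: "(complex^6^6) set" where
  "G1L = pluecker {l. proj_line l \<and> l \<subseteq> L}"

definition B'' :: "(complex^6^6) set" where
  "B'' = (THE Z. irreducible_component_of zariski (Gam \<inter> {p. p $ 0 $ 5 = 0}) Z \<and> Z \<noteq> G1L)"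

section \<open>Completely exceptional Monge-Ampere systems of the fourth order\<close>

definition hankel :: "complex^6 \<Rightarrow> complex^3^3" where
  "hankel u = vector [vector [u$1, u$2, u$3], vector [u$2, u$3, u$4], vector [u$3, u$4, u$5]]"

text \<open>The coefficients \<open>a 1, \<dots>, a 6\<close> belong to the six distinct minors of order 2 of the
  (symmetric) matrix \<open>hankel u\<close>. The entry \<open>u $ 0\<close> does not occur; it plays the role of the
  homogenizing variable below.\<close>

definition MA_poly ::
  "complex \<Rightarrow> (nat \<Rightarrow> complex) \<Rightarrow> (nat \<Rightarrow> complex) \<Rightarrow> complex \<Rightarrow> complex^6 \<Rightarrow> complex" where
  "MA_poly d a b c u = d * det (hankel u)
     + a 1 * (u$1 * u$3 - u$2 * u$2) + a 2 * (u$1 * u$4 - u$2 * u$3)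
     + a 3 * (u$1 * u$5 - u$3 * u$3) + a 4 * (u$2 * u$4 - u$3 * u$3)
     + a 5 * (u$2 * u$5 - u$3 * u$4) + a 6 * (u$3 * u$5 - u$4 * u$4)
     + b 1 * u$1 + b 2 * u$2 + b 3 * u$3 + b 4 * u$4 + b 5 * u$5 + c"

definition MA_line :: "complex^6 \<Rightarrow> (complex^6) set" where
  "MA_line u = {y. \<forall>i\<in>{1, 2, 3, 4}. u$0 * y$i = u$i * y$0 - u$(i + 1) * y$5}"

definition B_MA ::
  "complex \<Rightarrow> (nat \<Rightarrow> complex) \<Rightarrow> (nat \<Rightarrow> complex) \<Rightarrow> complex \<Rightarrow> (complex^6^6) set" where
  "B_MA d a b c =
     zariski closure_of pluecker {MA_line u | u. u $ 0 = 1 \<and> MA_poly d a b c u = 0}"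

end

theory Submission
  imports Defs "HOL-Computational_Algebra.Fundamental_Theorem_Algebra"
begin

text \<open>
  Put the line \<open>MA_line u\<close> into Pluecker coordinates with \<open>p\<^sub>0\<^sub>5 = 1\<close>: the remaining coordinates are, up
  to sign, the unknowns \<open>u\<^sub>1, \<dots>, u\<^sub>5\<close> and linear combinations of the minors of order 2 of the Hankel
  matrix. The linear relations that define \<open>Gam\<close> say that all lines of \<open>Gam\<close> with \<open>p\<^sub>0\<^sub>5 \<noteq> 0\<close> arise in
  this way, so that this part of \<open>Gam\<close> is an affine space with coordinates \<open>u\<close> (\<open>Gam_chart\<close>). Expanding
  the determinant along a row, the equation becomes quadratic in the Pluecker coordinates; this is the
  quadric \<open>Q\<close>. Thus the lines of the system are exactly the points of \<open>Gam \<inter> Q\<close> with \<open>p\<^sub>0\<^sub>5 \<noteq> 0\<close>. The part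
  of \<open>Gam\<close> with \<open>p\<^sub>0\<^sub>5 = 0\<close> consists of the lines of \<open>L\<close> and of the lines that join a point of a twisted
  cubic in \<open>L\<close> to a point outside \<open>L\<close> with corresponding first and last coordinates (\<open>Gam_infinity\<close>). It
  has the two irreducible components \<open>G1L\<close> and \<open>B''\<close> (\<open>components_at_infinity\<close>), and \<open>Q\<close> contains it. So
  the residual is the closure of the lines of the system.

  The dimension is computed from chains. Along a chain of irreducible closed sets, forms that vanish
  on one member and not on the next are algebraically independent (\<open>monomials_independent\<close>). But six
  forms of equal degree are dependent on the congruence, by a dimension count: as the equation has leading term
  \<open>- d u\<^sub>3\<^sup>3\<close> in \<open>u\<^sub>3\<close>, the polynomial functions on the hypersurface are combinations of \<open>1, u\<^sub>3, u\<^sub>3\<^sup>2\<close> with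
  polynomials in the other four unknowns as coefficients (\<open>forms_dependent\<close>). A chain of length 4 is obtained from
  the rational parametrization that solves the equation for \<open>u\<^sub>1\<close>, in which it is linear
  (\<open>slice_chain\<close>).

  For the multidegree one has to find the lines of the closure, too. Those with \<open>p\<^sub>0\<^sub>5 = 0\<close> lie on a
  second quadric that contains neither \<open>B''\<close> nor \<open>G1L\<close> (\<open>MA_quadric2\<close>), and this excludes them for a
  general point, flag or 3-space. The points \<open>u\<close> whose lines contain a given point form an affine line
  with a direction of rank 1, on which the equation has degree 1. Those whose lines lie in a
  given 3-space form an affine line on which the equation has degree 3. The lines of \<open>Gam\<close> in a
  hyperplane that meet a given line of it form a rational cubic curve. Its six points of intersection
  with the quadric include the three points with \<open>p\<^sub>0\<^sub>5 = 0\<close>, so that a cubic equation remains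
  (\<open>pullback_identity\<close>). That these cubic polynomials have simple zeros for general data is the
  non-vanishing of a discriminant; it is checked for data so large that the term with the
  determinant dominates the equation.
\<close>

section \<open>Polynomial functions and general matrices\<close>

lemma mpoly_sum:
  assumes "\<And>i. i \<in> I \<Longrightarrow> (\<lambda>A. f i A) \<in> mpoly_fun"
  shows "(\<lambda>A. \<Sum>i\<in>I. f i A) \<in> mpoly_fun"
  using assms
  by (induction I rule: infinite_finite_induct) (auto intro: mpoly_fun.intros)

lemma mpoly_prod:
  assumes "\<And>i. i \<in> I \<Longrightarrow> (\<lambda>A. f i A) \<in> mpoly_fun"
  shows "(\<lambda>A. \<Prod>i\<in>I. f i A) \<in> mpoly_fun"
  using assms
  by (induction I rule: infinite_finite_induct) (auto intro: mpoly_fun.intros)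

lemma mpoly_power: "f \<in> mpoly_fun \<Longrightarrow> (\<lambda>A. f A ^ n) \<in> mpoly_fun"
  by (induction n) (auto intro: mpoly_fun.intros)

lemma mpoly_uminus: "f \<in> mpoly_fun \<Longrightarrow> (\<lambda>A. - f A) \<in> mpoly_fun"
  using mpoly_fun.mult[OF mpoly_fun.const[of "-1"]] by fastforce

lemma mpoly_diff:
  "f \<in> mpoly_fun \<Longrightarrow> g \<in> mpoly_fun \<Longrightarrow> (\<lambda>A. f A - g A) \<in> mpoly_fun"
  using mpoly_fun.add[OF _ mpoly_uminus] by fastforce

lemmas mpoly_intros = mpoly_fun.intros mpoly_sum mpoly_prod mpoly_power mpoly_uminus mpoly_diff

lemma mpoly_det:
  fixes M :: "complex^'m^'n \<Rightarrow> complex^'k^'k"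
  assumes "\<And>i j. (\<lambda>A. M A $ i $ j) \<in> mpoly_fun"
  shows "(\<lambda>A. det (M A)) \<in> mpoly_fun"
  unfolding det_def by (intro mpoly_intros assms)

lemma mpoly_curve:
  assumes "f \<in> mpoly_fun" and "\<And>i j. \<exists>p. \<forall>t. \<psi> t $ i $ j = poly p t"
  shows "\<exists>p. \<forall>t. f (\<psi> t) = poly p t"
  using assms(1)
proof induction
  case (const k)
  show ?case by (rule exI[of _ "[:k:]"]) simp
next
  case (coord i j)
  show ?case by (rule assms(2))
next
  case (add f g)
  then obtain p q where "\<forall>t. f (\<psi> t) = poly p t" "\<forall>t. g (\<psi> t) = poly q t" by blast
  then show ?case by (intro exI[of _ "p + q"]) simp
next
  case (mult f g)
  then obtain p q where "\<forall>t. f (\<psi> t) = poly p t" "\<forall>t. g (\<psi> t) = poly q t" by blast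
  then show ?case by (intro exI[of _ "p * q"]) simp
qed

text \<open>Polynomial functions form an integral domain: two of them that do not vanish at given
  matrices restrict to non-zero polynomials on the line joining these matrices.\<close>

lemma mpoly_mult_nonzero:
  assumes "F \<in> mpoly_fun" "G \<in> mpoly_fun" "F A \<noteq> 0" "G B \<noteq> 0"
  shows "\<exists>C. F C * G C \<noteq> 0"
proof -
  define \<psi> where "\<psi> = (\<lambda>t. (\<chi> i j. A $ i $ j + t * (B $ i $ j - A $ i $ j)))"
  have \<psi>: "\<exists>p. \<forall>t. \<psi> t $ i $ j = poly p t" for i j
    by (rule exI[of _ "[:A $ i $ j, B $ i $ j - A $ i $ j:]"]) (simp add: \<psi>_def)
  obtain p q where p: "\<And>t. F (\<psi> t) = poly p t" and q: "\<And>t. G (\<psi> t) = poly q t"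
    using mpoly_curve[OF assms(1) \<psi>] mpoly_curve[OF assms(2) \<psi>] by blast
  have "\<psi> 0 = A" "\<psi> 1 = B" by (simp_all add: \<psi>_def vec_eq_iff)
  then have "poly p 0 \<noteq> 0" "poly q 1 \<noteq> 0" using p[of 0] q[of 1] assms by simp_all
  then have "p * q \<noteq> 0" by auto
  then obtain t where "poly (p * q) t \<noteq> 0" using poly_all_0_iff_0 by blast
  then have "F (\<psi> t) * G (\<psi> t) \<noteq> 0" using p[of t] q[of t] by simp
  then show ?thesis by blast
qed

lemma general_conj:
  assumes "general P" "general Q"
  shows "general (\<lambda>A. P A \<and> Q A)"
proof -
  from assms obtain F G A B where
    F: "F \<in> mpoly_fun" "F A \<noteq> 0" "\<And>A. F A \<noteq> 0 \<Longrightarrow> P A" and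
    G: "G \<in> mpoly_fun" "G B \<noteq> 0" "\<And>A. G A \<noteq> 0 \<Longrightarrow> Q A"
    unfolding general_def by blast
  have "(\<lambda>A. F A * G A) \<in> mpoly_fun" using F G by (intro mpoly_intros)
  moreover have "\<exists>C. F C * G C \<noteq> 0" using mpoly_mult_nonzero F G by blast
  ultimately show ?thesis
    unfolding general_def using F G by (intro bexI[of _ "\<lambda>A. F A * G A"]) auto
qed

lemma general_mono: "general P \<Longrightarrow> (\<And>A. P A \<Longrightarrow> Q A) \<Longrightarrow> general Q"
  unfolding general_def by blast

text \<open>Rational functions whose denominator is a power of the polynomial function \<open>D\<close>; the
  values at the zeros of \<open>D\<close> are irrelevant.\<close>

definition ratf :: "((complex^'m^'n) \<Rightarrow> complex) \<Rightarrow> ((complex^'m^'n) \<Rightarrow> complex) \<Rightarrow> bool" where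
  "ratf D G \<longleftrightarrow> (\<exists>n. \<exists>F\<in>mpoly_fun. \<forall>A. D A \<noteq> 0 \<longrightarrow> G A * D A ^ n = F A)"

lemma ratf_mpoly: "G \<in> mpoly_fun \<Longrightarrow> ratf D G"
  unfolding ratf_def by (intro exI[of _ 0] bexI[of _ G]) auto

lemma ratf_const: "ratf D (\<lambda>A. k)"
  by (intro ratf_mpoly mpoly_intros)

lemma ratf_coord: "ratf D (\<lambda>A. A $ i $ j)"
  by (intro ratf_mpoly mpoly_intros)

lemma ratf_add:
  assumes "D \<in> mpoly_fun" "ratf D G" "ratf D H"
  shows "ratf D (\<lambda>A. G A + H A)"
proof -
  from assms obtain n m F F' where
    F: "F \<in> mpoly_fun" "\<And>A. D A \<noteq> 0 \<Longrightarrow> G A * D A ^ n = F A" and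
    F': "F' \<in> mpoly_fun" "\<And>A. D A \<noteq> 0 \<Longrightarrow> H A * D A ^ m = F' A"
    unfolding ratf_def by blast
  have "(G A + H A) * D A ^ (n + m) = F A * D A ^ m + F' A * D A ^ n" if "D A \<noteq> 0" for A
    by (simp flip: F(2)[OF that] F'(2)[OF that] add: power_add algebra_simps)
  moreover have "(\<lambda>A. F A * D A ^ m + F' A * D A ^ n) \<in> mpoly_fun"
    by (intro mpoly_intros F F' assms)
  ultimately show ?thesis
    unfolding ratf_def by (intro exI[of _ "n + m"] bexI[of _ "\<lambda>A. F A * D A ^ m + F' A * D A ^ n"]) auto
qed

lemma ratf_mult:
  assumes "ratf D G" "ratf D H"
  shows "ratf D (\<lambda>A. G A * H A)"
proof -
  from assms obtain n m F F' where
    F: "F \<in> mpoly_fun" "\<And>A. D A \<noteq> 0 \<Longrightarrow> G A * D A ^ n = F A" and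
    F': "F' \<in> mpoly_fun" "\<And>A. D A \<noteq> 0 \<Longrightarrow> H A * D A ^ m = F' A"
    unfolding ratf_def by blast
  have "(G A * H A) * D A ^ (n + m) = F A * F' A" if "D A \<noteq> 0" for A
    by (simp flip: F(2)[OF that] F'(2)[OF that] add: power_add algebra_simps)
  moreover have "(\<lambda>A. F A * F' A) \<in> mpoly_fun" by (intro mpoly_intros F F')
  ultimately show ?thesis
    unfolding ratf_def by (intro exI[of _ "n + m"] bexI[of _ "\<lambda>A. F A * F' A"]) auto
qed

lemma ratf_uminus: "ratf D G \<Longrightarrow> ratf D (\<lambda>A. - G A)"
  using ratf_mult[OF ratf_const[of D "-1"], of G] by simp

lemma ratf_diff:
  "D \<in> mpoly_fun \<Longrightarrow> ratf D G \<Longrightarrow> ratf D H \<Longrightarrow> ratf D (\<lambda>A. G A - H A)"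
  using ratf_add[of D G "\<lambda>A. - H A"] by (simp add: ratf_uminus)

lemma ratf_sum:
  assumes "D \<in> mpoly_fun" "\<And>i. i \<in> I \<Longrightarrow> ratf D (\<lambda>A. f i A)"
  shows "ratf D (\<lambda>A. \<Sum>i\<in>I. f i A)"
  using assms(2)
  by (induction I rule: infinite_finite_induct) (auto intro: ratf_const ratf_add assms(1))

lemma ratf_divide:
  assumes "ratf D G" "E' \<in> mpoly_fun" "\<And>A. D A = E A * E' A"
  shows "ratf D (\<lambda>A. G A / E A)"
proof -
  from assms obtain n F where
    F: "F \<in> mpoly_fun" "\<And>A. D A \<noteq> 0 \<Longrightarrow> G A * D A ^ n = F A"
    unfolding ratf_def by blast
  have "G A / E A * D A ^ Suc n = F A * E' A" if "D A \<noteq> 0" for A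
    using that assms(3)[of A] by (simp flip: F(2)[OF that] add: field_simps)
  moreover have "(\<lambda>A. F A * E' A) \<in> mpoly_fun" by (intro mpoly_intros F assms)
  ultimately show ?thesis
    unfolding ratf_def by (intro exI[of _ "Suc n"] bexI[of _ "\<lambda>A. F A * E' A"]) auto
qed

lemmas ratf_intros = ratf_add ratf_diff ratf_mult ratf_uminus ratf_sum ratf_const ratf_coord

lemma general_ratf:
  assumes "D \<in> mpoly_fun" "ratf D G" "D A \<noteq> 0" "G A \<noteq> 0"
  shows "general (\<lambda>A. D A \<noteq> 0 \<and> G A \<noteq> 0)"
proof -
  from assms obtain n F where
    F: "F \<in> mpoly_fun" "\<And>A. D A \<noteq> 0 \<Longrightarrow> G A * D A ^ n = F A"
    unfolding ratf_def by blast
  have "(\<lambda>A. F A * D A) \<in> mpoly_fun" by (intro mpoly_intros F assms)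
  moreover have "F A * D A \<noteq> 0" using F(2)[OF assms(3)] assms(3,4) by auto
  moreover have "D B \<noteq> 0 \<and> G B \<noteq> 0" if "F B * D B \<noteq> 0" for B
    using that F(2)[of B] by auto
  ultimately show ?thesis
    unfolding general_def by (intro bexI[of _ "\<lambda>A. F A * D A"]) auto
qed

text \<open>A parameter tending to \<open>0\<close> is used below to neglect terms of lower degree.\<close>

lemma nonzero_near_0:
  fixes G :: "complex \<Rightarrow> complex"
  assumes "isCont G 0" "G 0 \<noteq> 0"
  shows "\<exists>\<epsilon>. \<epsilon> \<noteq> 0 \<and> G \<epsilon> \<noteq> 0"
proof -
  have "\<forall>\<^sub>F x in at 0. G x \<noteq> 0"
    using assms by (metis isCont_def tendsto_imp_eventually_ne)
  then have "\<forall>\<^sub>F x in at 0. G x \<noteq> 0 \<and> x \<noteq> (0::complex)"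
    by (simp add: eventually_conj_iff eventually_neq_at_within)
  then show ?thesis
    using eventually_happens'[of "at (0::complex)"] by (metis (mono_tags, lifting) at_neq_bot)
qed

text \<open>Polynomial dependence on a complex parameter.\<close>

definition polyc :: "(complex \<Rightarrow> complex) \<Rightarrow> bool" where
  "polyc G \<longleftrightarrow> (\<exists>q. \<forall>t. G t = poly q t)"

lemma polyc_const: "polyc (\<lambda>t. k)"
  unfolding polyc_def by (intro exI[of _ "[:k:]"]) simp

lemma polyc_linear: "polyc (\<lambda>t. k + t * l)"
  unfolding polyc_def by (intro exI[of _ "[:k, l:]"]) simp

lemma polyc_add: "polyc F \<Longrightarrow> polyc G \<Longrightarrow> polyc (\<lambda>t. F t + G t)"
  unfolding polyc_def by (metis poly_add)

lemma polyc_mult: "polyc F \<Longrightarrow> polyc G \<Longrightarrow> polyc (\<lambda>t. F t * G t)"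
  unfolding polyc_def by (metis poly_mult)

lemma polyc_uminus: "polyc F \<Longrightarrow> polyc (\<lambda>t. - F t)"
  unfolding polyc_def by (metis poly_minus)

lemma polyc_diff: "polyc F \<Longrightarrow> polyc G \<Longrightarrow> polyc (\<lambda>t. F t - G t)"
  unfolding polyc_def by (metis poly_diff)

lemmas polyc_intros = polyc_const polyc_linear polyc_add polyc_mult polyc_uminus polyc_diff

lemma polyc_finite_zeros:
  assumes "polyc G" "G s \<noteq> 0"
  shows "finite {t. G t = 0}"
proof -
  obtain q where q: "\<And>t. G t = poly q t" using assms(1) unfolding polyc_def by blast
  then have "q \<noteq> 0" using assms(2) by auto
  then show ?thesis unfolding q by (rule poly_roots_finite)
qed

lemma polyc_nonzero_elsewhere:
  assumes "polyc G" "G s \<noteq> 0"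
  shows "\<exists>t. t \<noteq> r \<and> G t \<noteq> 0"
proof (rule ccontr)
  assume "\<not> ?thesis"
  then have "UNIV = insert r {t. G t = 0}" by blast
  then have "finite (UNIV :: complex set)" using polyc_finite_zeros[OF assms] by (metis finite_insert)
  then show False by (simp add: infinite_UNIV_char_0)
qed

section \<open>The Zariski topology\<close>

lemma form_mpoly: "form e f \<Longrightarrow> f \<in> mpoly_fun"
  by (simp add: form_def)

lemma form_scale: "form e f \<Longrightarrow> f (\<chi> i j. k * A $ i $ j) = k ^ e * f A"
  by (simp add: form_def)

lemma form_const: "form 0 (\<lambda>A. k)"
  by (simp add: form_def mpoly_intros)

lemma form_coord: "form 1 (\<lambda>A. A $ i $ j)"
  by (simp add: form_def mpoly_intros)

lemma form_zero: "form e (\<lambda>A. 0)"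
  by (simp add: form_def mpoly_intros)

lemma form_mult: "form e f \<Longrightarrow> form e' g \<Longrightarrow> form (e + e') (\<lambda>A. f A * g A)"
  by (simp add: form_def mpoly_intros power_add algebra_simps)

lemma form_add: "form e f \<Longrightarrow> form e g \<Longrightarrow> form e (\<lambda>A. f A + g A)"
  by (simp add: form_def mpoly_intros algebra_simps)

lemma form_cmult: "form e f \<Longrightarrow> form e (\<lambda>A. k * f A)"
  using form_mult[OF form_const, of e f k] by simp

lemma form_uminus: "form e f \<Longrightarrow> form e (\<lambda>A. - f A)"
  using form_cmult[of e f "-1"] by simp

lemma form_diff: "form e f \<Longrightarrow> form e g \<Longrightarrow> form e (\<lambda>A. f A - g A)"
  using form_add[OF _ form_uminus, of e f g] by simp

lemma form_power: "form e f \<Longrightarrow> form (e * n) (\<lambda>A. f A ^ n)"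
  by (induction n) (auto intro: form_const form_mult)

lemma form_sum:
  "(\<And>i. i \<in> I \<Longrightarrow> form e (f i)) \<Longrightarrow> form e (\<lambda>A. \<Sum>i\<in>I. f i A)"
  by (induction I rule: infinite_finite_induct) (auto intro: form_zero form_add)

lemma form_prod:
  "(\<And>i. i \<in> I \<Longrightarrow> form (e i) (f i)) \<Longrightarrow> form (\<Sum>i\<in>I. e i) (\<lambda>A. \<Prod>i\<in>I. f i A)"
  by (induction I rule: infinite_finite_induct) (auto intro: form_const form_mult)

lemma topspace_zariski: "topspace zariski = P14"
proof -
  have "P14 \<in> {{p \<in> P14. f p \<noteq> 0} |f. \<exists>e. form e f}"
    using form_const[of 1] by (auto intro!: exI[of _ "\<lambda>_. 1"])
  then show ?thesis
    unfolding zariski_def topology_generated_by_topspace by auto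
qed

lemma openin_zariski_basic:
  assumes "openin zariski U" "p \<in> U"
  shows "\<exists>e f. form e f \<and> f p \<noteq> 0 \<and> {x \<in> P14. f x \<noteq> 0} \<subseteq> U"
proof -
  have "generate_topology_on {{p \<in> P14. f p \<noteq> 0} |f. \<exists>e. form e f} U"
    using assms(1) unfolding zariski_def openin_topology_generated_by_iff .
  then show ?thesis using assms(2)
  proof (induction arbitrary: p)
    case (Int a b)
    then have "p \<in> a" "p \<in> b" by auto
    from Int.IH(1)[OF this(1)] Int.IH(2)[OF this(2)] obtain e f e' g where
      "form e f" "f p \<noteq> 0" "{x \<in> P14. f x \<noteq> 0} \<subseteq> a"
      "form e' g" "g p \<noteq> 0" "{x \<in> P14. g x \<noteq> 0} \<subseteq> b" by blast
    then show ?case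
      by (intro exI[of _ "e + e'"] exI[of _ "\<lambda>x. f x * g x"]) (auto intro: form_mult)
  next
    case (UN K)
    then obtain k where "k \<in> K" "p \<in> k" by blast
    with UN.IH[OF this] show ?case by blast
  qed auto
qed

lemma closedin_zariski_zeros:
  assumes "form e f"
  shows "closedin zariski {p \<in> P14. f p = 0}"
proof -
  have "openin zariski {p \<in> P14. f p \<noteq> 0}"
    unfolding zariski_def by (rule topology_generated_by_Basis) (use assms in auto)
  moreover have "topspace zariski - {p \<in> P14. f p = 0} = {p \<in> P14. f p \<noteq> 0}"
    by (auto simp: topspace_zariski)
  ultimately show ?thesis by (auto simp: closedin_def topspace_zariski)
qed

lemma closedin_zariski_separate:
  assumes "closedin zariski C" "p \<in> P14" "p \<notin> C"
  shows "\<exists>e f. form e f \<and> f p \<noteq> 0 \<and> (\<forall>x\<in>C. f x = 0)"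
proof -
  have "openin zariski (P14 - C)" "C \<subseteq> P14"
    using assms(1) by (auto simp: closedin_def topspace_zariski)
  with openin_zariski_basic[of "P14 - C" p] assms show ?thesis by blast
qed

lemma in_zariski_closure:
  assumes "p \<in> zariski closure_of S" "form e f" "\<And>x. x \<in> S \<Longrightarrow> f x = 0"
  shows "f p = 0"
proof (rule ccontr)
  assume "f p \<noteq> 0"
  have "p \<in> P14"
    using assms(1) closure_of_subset_topspace[of zariski S] by (auto simp: topspace_zariski)
  have "zariski closure_of S = zariski closure_of (P14 \<inter> S)"
    using closure_of_restrict[of zariski S] by (simp add: topspace_zariski)
  also have "\<dots> \<subseteq> {p \<in> P14. f p = 0}"
    by (intro closure_of_minimal closedin_zariski_zeros[OF assms(2)]) (use assms(3) in auto)
  finally show False using assms(1) \<open>f p \<noteq> 0\<close> by auto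
qed

lemma zariski_closure_sub: "zariski closure_of S \<subseteq> P14"
  using closure_of_subset_topspace[of zariski S] by (simp add: topspace_zariski)

lemma subset_zariski_closure: "S \<subseteq> P14 \<Longrightarrow> S \<subseteq> zariski closure_of S"
  by (simp add: closure_of_subset topspace_zariski)

lemma in_zariski_closureI:
  assumes "p \<in> P14" "S \<subseteq> P14" "\<And>e f. form e f \<Longrightarrow> (\<And>x. x \<in> S \<Longrightarrow> f x = 0) \<Longrightarrow> f p = 0"
  shows "p \<in> zariski closure_of S"
proof (rule ccontr)
  assume "p \<notin> zariski closure_of S"
  then obtain e f where "form e f" "f p \<noteq> 0" "\<forall>x\<in>zariski closure_of S. f x = 0"
    using closedin_zariski_separate[OF closedin_closure_of assms(1)] by blast
  then show False using assms(3)[of e f] subset_zariski_closure[OF assms(2)] by blast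
qed

lemma P14_skew: "p \<in> P14 \<Longrightarrow> p $ i $ j = - p $ j $ i"
  unfolding P14_def by blast

lemma P14_entry:
  assumes "p \<in> P14"
  obtains i j where "p $ i $ j \<noteq> 0"
proof -
  have "p \<noteq> 0" using assms unfolding P14_def by blast
  then have "\<exists>i j. p $ i $ j \<noteq> 0" by (auto simp: vec_eq_iff)
  then show thesis using that by blast
qed

lemma P14I: "p $ i $ j \<noteq> 0 \<Longrightarrow> (\<And>i j. p $ i $ j = - p $ j $ i) \<Longrightarrow> p \<in> P14"
  unfolding P14_def by (rule CollectI, rule conjI) (metis zero_index, blast)

lemma P14_scale: "p \<in> P14 \<Longrightarrow> k \<noteq> 0 \<Longrightarrow> (\<chi> i j. k * p $ i $ j) \<in> P14"
proof -
  assume p: "p \<in> P14" and k: "k \<noteq> 0"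
  obtain i j where "p $ i $ j \<noteq> 0" using P14_entry[OF p] .
  then show ?thesis
  proof (intro P14I[of _ i j])
    show "(\<chi> i j. k * p $ i $ j) $ i $ j \<noteq> 0" if "p $ i $ j \<noteq> 0" using that k by simp
    show "(\<chi> i j. k * p $ i $ j) $ i' $ j' = - (\<chi> i j. k * p $ i $ j) $ j' $ i'" for i' j'
    proof -
      have "p $ i' $ j' = - p $ j' $ i'" by (rule P14_skew[OF p])
      then show ?thesis by simp
    qed
  qed
qed

lemma irreducible_curve:
  assumes "\<And>i j. \<exists>p. \<forall>t. \<psi> t $ i $ j = poly p t" "finite (- T)" "\<psi> ` T \<subseteq> P14"
  shows "irreducible_in zariski (\<psi> ` T)"
  unfolding irreducible_in_def
proof (intro conjI allI impI)
  show "\<psi> ` T \<subseteq> topspace zariski" using assms by (simp add: topspace_zariski)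
  have inf: "infinite T" using assms(2) infinite_UNIV_char_0 finite_compl by blast
  then show "\<psi> ` T \<noteq> {}" by auto
  fix C D assume C: "closedin zariski C" and D: "closedin zariski D" and sub: "\<psi> ` T \<subseteq> C \<union> D"
  show "\<psi> ` T \<subseteq> C \<or> \<psi> ` T \<subseteq> D"
  proof (rule ccontr)
    assume "\<not> ?thesis"
    then obtain x y where xy: "x \<in> T" "\<psi> x \<notin> C" "y \<in> T" "\<psi> y \<notin> D" by blast
    then obtain e f e' g where
      f: "form e f" "f (\<psi> x) \<noteq> 0" "\<forall>x\<in>C. f x = 0" and g: "form e' g" "g (\<psi> y) \<noteq> 0" "\<forall>x\<in>D. g x = 0"
      using closedin_zariski_separate[OF C, of "\<psi> x"] closedin_zariski_separate[OF D, of "\<psi> y"]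
        assms(3) by blast
    obtain p q where p: "\<And>t. f (\<psi> t) = poly p t" and q: "\<And>t. g (\<psi> t) = poly q t"
      using mpoly_curve[OF form_mpoly[OF f(1)] assms(1)] mpoly_curve[OF form_mpoly[OF g(1)] assms(1)]
      by blast
    have "p * q \<noteq> 0" using p[of x] q[of y] f g by auto
    moreover have "poly (p * q) t = 0" if "t \<in> T" for t
      using sub that f(3) g(3) p[of t] q[of t] by fastforce
    then have "T \<subseteq> {t. poly (p * q) t = 0}" by blast
    ultimately show False using inf poly_roots_finite finite_subset by blast
  qed
qed

lemma irreducible_joined:
  assumes "S \<subseteq> topspace X" "S \<noteq> {}"
    and "\<And>x y. x \<in> S \<Longrightarrow> y \<in> S \<Longrightarrow> \<exists>I\<subseteq>S. irreducible_in X I \<and> x \<in> I \<and> y \<in> I"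
  shows "irreducible_in X S"
  unfolding irreducible_in_def
proof (intro conjI allI impI assms(1,2))
  fix C D assume C: "closedin X C" and D: "closedin X D" and sub: "S \<subseteq> C \<union> D"
  show "S \<subseteq> C \<or> S \<subseteq> D"
  proof (rule ccontr)
    assume "\<not> ?thesis"
    then obtain x y where xy: "x \<in> S" "x \<notin> C" "y \<in> S" "y \<notin> D" by blast
    then obtain I where I: "I \<subseteq> S" "irreducible_in X I" "x \<in> I" "y \<in> I" using assms(3) by blast
    then have "I \<subseteq> C \<or> I \<subseteq> D" using C D sub unfolding irreducible_in_def by blast
    then show False using I xy by blast
  qed
qed

lemma irreducible_closure:
  assumes "irreducible_in X S"
  shows "irreducible_in X (X closure_of S)"
proof -
  have S: "S \<subseteq> X closure_of S" using assms by (simp add: irreducible_in_def closure_of_subset)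
  moreover have "X closure_of S \<subseteq> C" if "closedin X C" "S \<subseteq> C" for C
    using that by (simp add: closure_of_minimal)
  ultimately show ?thesis
    using assms closure_of_subset_topspace[of X S] unfolding irreducible_in_def
    by (metis order_trans subset_empty)
qed

lemma irreducible_form_mult:
  assumes "irreducible_in zariski Z" "form e f" "form e' g" "\<And>p. p \<in> Z \<Longrightarrow> f p * g p = 0"
  shows "(\<forall>p\<in>Z. f p = 0) \<or> (\<forall>p\<in>Z. g p = 0)"
proof -
  have "Z \<subseteq> P14" using assms(1) by (simp add: irreducible_in_def topspace_zariski)
  then have "Z \<subseteq> {p \<in> P14. f p = 0} \<union> {p \<in> P14. g p = 0}" using assms(4) by auto
  then have "Z \<subseteq> {p \<in> P14. f p = 0} \<or> Z \<subseteq> {p \<in> P14. g p = 0}"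
    using assms(1) closedin_zariski_zeros[OF assms(2)] closedin_zariski_zeros[OF assms(3)]
    unfolding irreducible_in_def by blast
  then show ?thesis by blast
qed

section \<open>Lines and their Pluecker coordinates\<close>

lemma exhaust_6:
  fixes x :: 6
  shows "x = 0 \<or> x = 1 \<or> x = 2 \<or> x = 3 \<or> x = 4 \<or> x = 5"
proof (induct x)
  case (of_int z)
  then have "0 \<le> z" and "z < 6" by simp_all
  then have "z = 0 \<or> z = 1 \<or> z = 2 \<or> z = 3 \<or> z = 4 \<or> z = 5" by arith
  then show ?case by auto
qed

lemma exhaust_5:
  fixes x :: 5
  shows "x = 1 \<or> x = 2 \<or> x = 3 \<or> x = 4 \<or> x = 5"
proof (induct x)
  case (of_int z)
  then have "0 \<le> z" and "z < 5" by simp_all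
  then have "z = 0 \<or> z = 1 \<or> z = 2 \<or> z = 3 \<or> z = 4" by arith
  then show ?case by auto
qed

lemma forall_6: "(\<forall>i::6. P i) \<longleftrightarrow> P 0 \<and> P 1 \<and> P 2 \<and> P 3 \<and> P 4 \<and> P 5"
  by (metis exhaust_6)

lemma forall_5: "(\<forall>i::5. P i) \<longleftrightarrow> P 1 \<and> P 2 \<and> P 3 \<and> P 4 \<and> P 5"
  by (metis exhaust_5)

lemma sum_5: "sum f (UNIV::5 set) = f 1 + f 2 + f 3 + f 4 + f 5"
proof -
  have *: "UNIV = {1, 2, 3, 4, 5::5}" using exhaust_5 by auto
  show ?thesis unfolding * by (simp add: ac_simps)
qed

text \<open>Multiplication of homogeneous coordinates by a scalar.\<close>

abbreviation scal :: "complex \<Rightarrow> complex^6^6 \<Rightarrow> complex^6^6" where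
  "scal k p \<equiv> (\<chi> i j. k * p $ i $ j)"

lemma wedge_nth [simp]: "wedge x y $ i $ j = x $ i * y $ j - x $ j * y $ i"
  by (simp add: wedge_def)

lemma matrix_nonzeroI: "p $ i $ j \<noteq> 0 \<Longrightarrow> p \<noteq> 0"
  by auto

lemma wedge_P14: "wedge x y \<noteq> 0 \<Longrightarrow> wedge x y \<in> P14"
  by (simp add: P14_def)

lemma span_pair: "vec.span {x, y} = {a *s x + b *s y | a b. True}"
  by (auto simp: vec.span_insert vec.span_singleton)
    (metis add.commute diff_add_cancel, metis add_diff_cancel_left')

lemma wedge_combination:
  "wedge (a *s x + b *s y) (a' *s x + b' *s y) = scal (a * b' - a' * b) (wedge x y)"
  by (simp add: vec_eq_iff algebra_simps)

text \<open>A point lies on a line if and only if its exterior product with the line vanishes; hence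
  the line is determined by its coordinates.\<close>

lemma mem_span_wedge:
  assumes "wedge x y \<noteq> 0"
  shows "v \<in> vec.span {x, y} \<longleftrightarrow>
    (\<forall>i j k. v $ i * wedge x y $ j $ k - v $ j * wedge x y $ i $ k + v $ k * wedge x y $ i $ j = 0)"
    (is "_ \<longleftrightarrow> ?R")
proof
  assume "v \<in> vec.span {x, y}"
  then show ?R by (auto simp: span_pair algebra_simps)
next
  assume R: ?R
  obtain j k where jk: "wedge x y $ j $ k \<noteq> 0" using P14_entry[OF wedge_P14[OF assms]] .
  define w where "w = wedge x y $ j $ k"
  have "w \<noteq> 0" using jk by (simp add: w_def)
  have "v = ((v $ j * y $ k - v $ k * y $ j) / w) *s x + ((v $ k * x $ j - v $ j * x $ k) / w) *s y"
    (is "v = ?v")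
    unfolding vec_eq_iff
  proof
    fix i
    have "v $ i * w = v $ j * (x $ i * y $ k - x $ k * y $ i) - v $ k * (x $ i * y $ j - x $ j * y $ i)"
      using R[rule_format, of i j k] unfolding w_def wedge_nth
      by algebra
    then have "v $ i = (v $ j * (x $ i * y $ k - x $ k * y $ i) - v $ k * (x $ i * y $ j - x $ j * y $ i)) / w"
      using \<open>w \<noteq> 0\<close> by (simp add: eq_divide_eq)
    then show "v $ i = ?v $ i" by (simp add: algebra_simps add_divide_distrib diff_divide_distrib)
  qed
  then show "v \<in> vec.span {x, y}" unfolding span_pair by blast
qed

lemma proj_line_span_iff: "proj_line (vec.span {x, y}) \<longleftrightarrow> wedge x y \<noteq> 0"
proof
  assume L: "proj_line (vec.span {x, y})"
  show "wedge x y \<noteq> 0"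
  proof
    assume 0: "wedge x y = 0"
    have "\<exists>z. vec.span {x, y} \<subseteq> vec.span {z}"
    proof (cases "x = 0")
      case True
      then show ?thesis by (metis order_refl vec.span_insert_0)
    next
      case False
      then obtain i where "x $ i \<noteq> 0" by (auto simp: vec_eq_iff)
      have "y = (y $ i / x $ i) *s x"
        unfolding vec_eq_iff
      proof
        fix j
        have "wedge x y $ i $ j = 0" unfolding 0 by simp
        then show "y $ j = ((y $ i / x $ i) *s x) $ j"
          using \<open>x $ i \<noteq> 0\<close> by (simp add: field_simps)
      qed
      then have "y \<in> vec.span {x}" unfolding vec.span_singleton by blast
      then have "vec.span {x, y} = vec.span {x}"
        using vec.span_redundant[of y "{x}"] by (simp add: insert_commute)
      then show ?thesis by blast
    qed
    then obtain z where "vec.span {x, y} \<subseteq> vec.span {z}" by blast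
    then have "vec.dim (vec.span {x, y}) \<le> vec.dim (vec.span {z})" by (rule vec.dim_subset)
    also have "\<dots> \<le> card {z}" unfolding vec.dim_span by (rule vec.dim_le_card') simp
    finally show False using L by (simp add: proj_line_def)
  qed
next
  assume w: "wedge x y \<noteq> 0"
  have "x \<noteq> y"
  proof
    assume "x = y"
    then have "wedge x y = 0" by (simp add: vec_eq_iff)
    with w show False by simp
  qed
  have "x \<notin> vec.span {y}"
  proof
    assume "x \<in> vec.span {y}"
    then obtain k where "x = k *s y" unfolding vec.span_singleton by blast
    then have "wedge x y = 0" by (simp add: vec_eq_iff)
    with w show False by simp
  qed
  moreover have "y \<noteq> 0"
  proof
    assume "y = 0"
    then have "wedge x y = 0" by (simp add: vec_eq_iff)
    with w show False by simp
  qed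
  ultimately have "vec.independent {x, y}"
    using \<open>x \<noteq> y\<close> by (simp add: vec.independent_insert)
  then have "vec.dim (vec.span {x, y}) = 2"
    using \<open>x \<noteq> y\<close> vec.dim_span_eq_card_independent[of "{x, y}"] by simp
  then show "proj_line (vec.span {x, y})" by (simp add: proj_line_def)
qed

lemma proj_lineE:
  assumes "proj_line l"
  obtains x y where "l = vec.span {x, y}" "wedge x y \<noteq> 0"
proof -
  from assms have "vec.subspace l" "vec.dim l = 2" by (auto simp: proj_line_def)
  then obtain B where B: "vec.span B = l" "card B = 2"
    using vec.basis_subspace_exists[of l] by metis
  then obtain x y where "B = {x, y}" unfolding card_2_iff by blast
  with B(1) have l: "l = vec.span {x, y}" by simp
  with assms have "wedge x y \<noteq> 0" using proj_line_span_iff[of x y] by simp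
  with l show thesis by (rule that)
qed

lemma wedge_same_line:
  assumes "wedge x y \<noteq> 0" "vec.span {x', y'} \<subseteq> vec.span {x, y}"
  obtains k where "wedge x' y' = scal k (wedge x y)"
proof -
  have "x' \<in> vec.span {x, y}" "y' \<in> vec.span {x, y}"
    using assms(2) by (auto intro: vec.span_base)
  then obtain a b a' b' where "x' = a *s x + b *s y" "y' = a' *s x + b' *s y"
    unfolding span_pair by blast
  then show thesis using that by (simp only: wedge_combination)
qed

lemma same_line_wedge:
  assumes "wedge x y \<noteq> 0" "wedge x' y' = scal k (wedge x y)" "k \<noteq> 0"
  shows "vec.span {x', y'} = vec.span {x, y}"
proof -
  have "k * a - k * b + k * c = k * (a - b + c)" for a b c :: complex
    by (simp add: algebra_simps)
  moreover have "wedge x' y' \<noteq> 0"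
    unfolding assms(2) using P14_scale[OF wedge_P14[OF assms(1)] assms(3)]
    unfolding P14_def by blast
  ultimately have "v \<in> vec.span {x', y'} \<longleftrightarrow> v \<in> vec.span {x, y}" for v
    unfolding mem_span_wedge[OF assms(1)] mem_span_wedge[OF \<open>wedge x' y' \<noteq> 0\<close>]
    unfolding assms(2) vec_lambda_beta mult.left_commute[of _ k] using assms(3) by simp
  then show ?thesis by blast
qed

text \<open>Sets of representatives of points: closed under multiplication by non-zero scalars.\<close>

definition cone :: "(complex^6^6) set \<Rightarrow> bool" where
  "cone S \<longleftrightarrow> S \<subseteq> P14 \<and> (\<forall>p\<in>S. \<forall>k. k \<noteq> 0 \<longrightarrow> scal k p \<in> S)"

lemma cone_closure:
  assumes "cone S"
  shows "cone (zariski closure_of S)"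
  unfolding cone_def
proof (intro conjI ballI allI impI zariski_closure_sub)
  fix p k assume p: "p \<in> zariski closure_of S" and k: "k \<noteq> (0::complex)"
  show "scal k p \<in> zariski closure_of S"
  proof (rule in_zariski_closureI)
    show "scal k p \<in> P14" using P14_scale k p zariski_closure_sub by blast
    show "S \<subseteq> P14" using assms by (simp add: cone_def)
    fix e f assume f: "form e f" "\<And>x. x \<in> S \<Longrightarrow> f x = 0"
    then show "f (scal k p) = 0" using in_zariski_closure[OF p f] form_scale[OF f(1), of k p] by simp
  qed
qed

lemma in_lines_of:
  assumes "cone B" "wedge x y \<noteq> 0"
  shows "vec.span {x, y} \<in> lines_of B \<longleftrightarrow> wedge x y \<in> B"
proof
  assume "vec.span {x, y} \<in> lines_of B"
  then have "pluecker {vec.span {x, y}} \<subseteq> B" by (simp add: lines_of_def)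
  then show "wedge x y \<in> B"
    using assms(2) unfolding pluecker_def proj_line_span_iff by blast
next
  assume w: "wedge x y \<in> B"
  have "wedge x' y' \<in> B" if "wedge x' y' \<noteq> 0" "vec.span {x', y'} = vec.span {x, y}" for x' y'
  proof -
    have "vec.span {x', y'} \<subseteq> vec.span {x, y}" using that(2) by simp
    then obtain k where k: "wedge x' y' = scal k (wedge x y)"
      using wedge_same_line[OF assms(2)] by blast
    moreover have "k \<noteq> 0"
    proof
      assume "k = 0"
      then have "wedge x' y' = 0" unfolding k by (simp add: vec_eq_iff)
      with that(1) show False by simp
    qed
    ultimately show ?thesis unfolding k using assms(1) w unfolding cone_def by blast
  qed
  then have "pluecker {vec.span {x, y}} \<subseteq> B"
    unfolding pluecker_def proj_line_span_iff by blast
  then show "vec.span {x, y} \<in> lines_of B"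
    using assms(2) unfolding lines_of_def mem_Collect_eq proj_line_span_iff by blast
qed

lemma lines_ofE:
  assumes "cone B" "l \<in> lines_of B"
  obtains x y where "l = vec.span {x, y}" "wedge x y \<noteq> 0" "wedge x y \<in> B"
proof -
  have "proj_line l" using assms(2) by (simp add: lines_of_def)
  then obtain x y where l: "l = vec.span {x, y}" "wedge x y \<noteq> 0" by (rule proj_lineE)
  with assms in_lines_of[OF assms(1) l(2)] have "wedge x y \<in> B" by simp
  with l show thesis by (rule that)
qed

lemma grassmannian_iff: "p \<in> grassmannian \<longleftrightarrow> p \<noteq> 0 \<and> (\<exists>x y. p = wedge x y)"
  unfolding grassmannian_def pluecker_def proj_line_span_iff mem_Collect_eq by auto

lemma cone_grassmannian: "cone grassmannian"
  unfolding cone_def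
proof (intro conjI ballI allI impI)
  show sub: "grassmannian \<subseteq> P14"
  proof
    fix p assume "p \<in> grassmannian"
    then obtain x y where "p = wedge x y" "p \<noteq> 0" unfolding grassmannian_iff by blast
    then show "p \<in> P14" using wedge_P14 by blast
  qed
  fix p k assume p: "p \<in> grassmannian" and k: "k \<noteq> (0::complex)"
  then obtain x y where xy: "p = wedge x y" unfolding grassmannian_iff by blast
  have "scal k p = wedge (k *s x) y" unfolding xy by (simp add: vec_eq_iff algebra_simps)
  moreover have "scal k p \<noteq> 0"
    using P14_scale[OF subsetD[OF sub p] k] unfolding P14_def by blast
  ultimately show "scal k p \<in> grassmannian" unfolding grassmannian_iff by blast
qed

text \<open>The quadratic relations between the coordinates define the Grassmannian: if
  \<open>p $ a $ b \<noteq> 0\<close> then the rows \<open>a\<close> and \<open>b\<close> of \<open>p\<close> span the line.\<close>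

lemma grassmannian_relations:
  "grassmannian = {p \<in> P14. \<forall>(i, j, k, l) \<in> UNIV.
     p $ i $ j * p $ k $ l - p $ i $ k * p $ j $ l + p $ i $ l * p $ j $ k = 0}"
proof (intro equalityI subsetI)
  fix p assume "p \<in> grassmannian"
  then obtain x y where "p = wedge x y" "p \<noteq> 0" by (auto simp: grassmannian_iff)
  then show "p \<in> {p \<in> P14. \<forall>(i, j, k, l) \<in> UNIV.
     p $ i $ j * p $ k $ l - p $ i $ k * p $ j $ l + p $ i $ l * p $ j $ k = 0}"
    using wedge_P14 by (auto simp: algebra_simps)
next
  fix p assume p: "p \<in> {p \<in> P14. \<forall>(i, j, k, l) \<in> UNIV.
     p $ i $ j * p $ k $ l - p $ i $ k * p $ j $ l + p $ i $ l * p $ j $ k = 0}"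
  then have R: "p $ i $ j * p $ k $ l - p $ i $ k * p $ j $ l + p $ i $ l * p $ j $ k = 0"
    for i j k l by blast
  have P: "p \<in> P14" using p by blast
  obtain a b where ab: "p $ a $ b \<noteq> 0" using P14_entry[OF P] .
  have "p = wedge ((1 / p $ a $ b) *s p $ a) (p $ b)"
    unfolding vec_eq_iff
  proof (intro allI)
    fix k l
    have "p $ a $ b * p $ k $ l = p $ a $ k * p $ b $ l - p $ a $ l * p $ b $ k"
      using R[of a b k l] by algebra
    then show "p $ k $ l = wedge ((1 / p $ a $ b) *s p $ a) (p $ b) $ k $ l"
      using ab by (simp add: field_simps)
  qed
  moreover have "p \<noteq> 0" using P by (simp add: P14_def)
  ultimately show "p \<in> grassmannian" unfolding grassmannian_iff by blast
qed

lemma closedin_zariski_forms: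
  assumes "\<And>i. i \<in> I \<Longrightarrow> form (e i) (f i)"
  shows "closedin zariski {p \<in> P14. \<forall>i\<in>I. f i p = 0}"
proof (cases "I = {}")
  case True
  then show ?thesis using closedin_topspace[of zariski] by (simp add: topspace_zariski)
next
  case False
  then have "{p \<in> P14. \<forall>i\<in>I. f i p = 0} = (\<Inter>i\<in>I. {p \<in> P14. f i p = 0})" by auto
  then show ?thesis using False closedin_zariski_zeros[OF assms] by auto
qed

lemma closedin_grassmannian: "closedin zariski grassmannian"
proof -
  have "form 2 (\<lambda>p. p $ i $ j * p $ k $ l - p $ i $ k * p $ j $ l + p $ i $ l * p $ j $ k)"
    for i j k l :: 6
    unfolding one_add_one[symmetric]
    by (intro form_add form_diff form_mult form_coord)
  then show ?thesis
    unfolding grassmannian_relations split_def by (intro closedin_zariski_forms) blast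
qed

section \<open>The fivefold and its hyperplane section at infinity\<close>

lemma closedin_Gam: "closedin zariski Gam"
proof -
  have "form 1 (\<lambda>p. p $ i $ j + p $ k $ l)" for i j k l :: 6
    by (intro form_add form_coord)
  then have c: "closedin zariski {p \<in> P14. p $ i $ j + p $ k $ l = 0}" for i j k l
    by (rule closedin_zariski_zeros)
  have "grassmannian \<subseteq> P14" using cone_grassmannian by (simp add: cone_def)
  then have *: "Gam = grassmannian \<inter> ({p \<in> P14. p$0$1 + p$2$5 = 0} \<inter>
    ({p \<in> P14. p$0$2 + p$3$5 = 0} \<inter> {p \<in> P14. p$0$3 + p$4$5 = 0}))"
    unfolding Gam_def by blast
  show ?thesis unfolding * by (intro closedin_Int c closedin_grassmannian)
qed

lemma Gam_P14: "Gam \<subseteq> P14"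
  using cone_grassmannian by (auto simp: Gam_def cone_def)

lemma Gam_iff:
  "p \<in> Gam \<longleftrightarrow> p \<noteq> 0 \<and> (\<exists>x y. p = wedge x y) \<and>
    p$0$1 + p$2$5 = 0 \<and> p$0$2 + p$3$5 = 0 \<and> p$0$3 + p$4$5 = 0"
  by (auto simp: Gam_def grassmannian_iff)

text \<open>The two points of the line \<open>MA_line u\<close> (with \<open>u $ 0 = 1\<close>) on the hyperplanes where the
  last, respectively the first, coordinate vanishes.\<close>

definition xpt :: "complex^6 \<Rightarrow> complex^6" where
  "xpt u = (\<chi> i. if i = 0 then 1 else if i = 5 then 0 else u $ i)"

definition zpt :: "complex^6 \<Rightarrow> complex^6" where
  "zpt u = (\<chi> i. if i = 0 then 0 else if i = 5 then 1 else - u $ (i + 1))"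

lemma xpt_nth [simp]:
  "xpt u $ 0 = 1" "xpt u $ 1 = u $ 1" "xpt u $ 2 = u $ 2" "xpt u $ 3 = u $ 3"
  "xpt u $ 4 = u $ 4" "xpt u $ 5 = 0"
  by (simp_all add: xpt_def)

lemma zpt_nth [simp]:
  "zpt u $ 0 = 0" "zpt u $ 1 = - u $ 2" "zpt u $ 2 = - u $ 3" "zpt u $ 3 = - u $ 4"
  "zpt u $ 4 = - u $ 5" "zpt u $ 5 = 1"
  by (simp_all add: zpt_def)

lemma MA_line_nth:
  "u $ 0 = 1 \<Longrightarrow> y \<in> MA_line u \<longleftrightarrow> y$1 = u$1 * y$0 - u$2 * y$5 \<and> y$2 = u$2 * y$0 - u$3 * y$5 \<and>
    y$3 = u$3 * y$0 - u$4 * y$5 \<and> y$4 = u$4 * y$0 - u$5 * y$5"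
  by (simp add: MA_line_def)

lemma MA_line_span: "u $ 0 = 1 \<Longrightarrow> MA_line u = vec.span {xpt u, zpt u}"
  unfolding span_pair
proof (intro equalityI subsetI)
  fix y assume "u $ 0 = 1" "y \<in> MA_line u"
  then have "y = (y $ 0) *s xpt u + (y $ 5) *s zpt u"
    by (simp add: MA_line_nth vec_eq_iff forall_6)
  then show "y \<in> {a *s xpt u + b *s zpt u |a b. True}" by blast
qed (auto simp: MA_line_nth)

text \<open>The coordinates of the line \<open>MA_line u\<close>, normalized so that \<open>p\<^sub>0\<^sub>5 = 1\<close>; the others are the
  unknowns and, up to sign and sums, the minors of order 2 of \<open>hankel u\<close>.\<close>

definition chart :: "complex^6 \<Rightarrow> complex^6^6" where
  "chart u = wedge (xpt u) (zpt u)"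

lemma chart_05: "chart u $ 0 $ 5 = 1"
  by (simp add: chart_def)

lemma chart_nonzero: "chart u \<noteq> 0"
  using chart_05[of u] by (metis zero_index zero_neq_one)

text \<open>Outside the hyperplane \<open>p\<^sub>0\<^sub>5 = 0\<close> the fivefold is an affine space with coordinates
  \<open>u\<^sub>1, \<dots>, u\<^sub>5\<close>.\<close>

lemma Gam_chart:
  "p \<in> Gam \<and> p $ 0 $ 5 \<noteq> 0 \<longleftrightarrow> (\<exists>k u. k \<noteq> 0 \<and> u $ 0 = 1 \<and> p = scal k (chart u))"
proof
  assume p: "p \<in> Gam \<and> p $ 0 $ 5 \<noteq> 0"
  then obtain x y where xy: "p = wedge x y" by (auto simp: Gam_iff)
  define k where "k = p $ 0 $ 5"
  have k: "k \<noteq> 0" using p by (simp add: k_def)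
  define u :: "complex^6" where
    "u = (\<chi> i. if i = 0 then 1 else if i = 5 then - p $ 0 $ 4 / k else p $ i $ 5 / k)"
  have G: "p$0$1 = - p$2$5" "p$0$2 = - p$3$5" "p$0$3 = - p$4$5"
    using p by (auto simp: Gam_iff eq_neg_iff_add_eq_0)
  have "\<forall>i. k * xpt u $ i = p $ i $ 5" "\<forall>i. k * zpt u $ i = p $ 0 $ i"
    unfolding forall_6 using k G by (auto simp: u_def xy k_def[symmetric]) (simp_all add: k_def xy)
  then have u: "k * xpt u $ i = p $ i $ 5" "k * zpt u $ i = p $ 0 $ i" for i by auto
  have "p $ i $ j = scal k (chart u) $ i $ j" for i j
  proof -
    have "k * p $ i $ j = p $ i $ 5 * p $ 0 $ j - p $ j $ 5 * p $ 0 $ i"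
      by (simp add: xy k_def algebra_simps)
    also have "\<dots> = k * (k * chart u $ i $ j)"
      by (simp flip: u add: chart_def algebra_simps)
    finally show ?thesis using k by simp
  qed
  then have "p = scal k (chart u)" by (simp add: vec_eq_iff)
  moreover have "u $ 0 = 1" by (simp add: u_def)
  ultimately show "\<exists>k u. k \<noteq> 0 \<and> u $ 0 = 1 \<and> p = scal k (chart u)" using k by blast
next
  assume "\<exists>k u. k \<noteq> 0 \<and> u $ 0 = 1 \<and> p = scal k (chart u)"
  then obtain k u where k: "k \<noteq> 0" and p: "p = scal k (chart u)" by blast
  have p2: "p = wedge (k *s xpt u) (zpt u)"
    unfolding p by (simp add: chart_def vec_eq_iff algebra_simps)
  have p05: "p $ 0 $ 5 \<noteq> 0" unfolding p2 using k by simp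
  then have "p \<noteq> 0" by (metis zero_index)
  with p05 p2 show "p \<in> Gam \<and> p $ 0 $ 5 \<noteq> 0" unfolding Gam_iff by auto
qed

lemma pluecker_MA_lines:
  "pluecker {MA_line u | u. u $ 0 = 1 \<and> P u} = {scal k (chart u) | k u. k \<noteq> 0 \<and> u $ 0 = 1 \<and> P u}"
  (is "?A = ?B")
proof (intro equalityI subsetI)
  fix p assume "p \<in> ?A"
  then obtain x y u where p: "p = wedge x y" "wedge x y \<noteq> 0" "u $ 0 = 1" "P u"
    "vec.span {x, y} = vec.span {xpt u, zpt u}"
    unfolding pluecker_def proj_line_span_iff using MA_line_span by blast
  then have "vec.span {x, y} \<subseteq> vec.span {xpt u, zpt u}" by simp
  then obtain k where k: "p = scal k (chart u)"
    using wedge_same_line[of "xpt u" "zpt u" x y] chart_nonzero[of u] p(1) unfolding chart_def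
    by blast
  moreover have "k \<noteq> 0"
  proof
    assume "k = 0"
    then have "wedge x y = 0" unfolding p(1)[symmetric] k by (simp add: vec_eq_iff)
    with p(2) show False by simp
  qed
  ultimately show "p \<in> ?B" using p by blast
next
  fix p assume "p \<in> ?B"
  then obtain k u where p: "p = scal k (chart u)" "k \<noteq> 0" "u $ 0 = 1" "P u" by blast
  have p': "p = wedge (k *s xpt u) (zpt u)"
    by (simp add: p chart_def vec_eq_iff algebra_simps)
  have "vec.span {k *s xpt u, zpt u} = MA_line u"
    unfolding MA_line_span[OF p(3)]
    by (rule same_line_wedge[of _ _ _ _ k]) (use p p' chart_nonzero in \<open>simp_all add: chart_def\<close>)
  moreover have "wedge (k *s xpt u) (zpt u) \<noteq> 0"
    unfolding p'[symmetric] p(1)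
    by (rule matrix_nonzeroI[of _ 0 5]) (use p(2) chart_05[of u] in simp)
  ultimately show "p \<in> ?A"
    unfolding pluecker_def using p' p(3,4) proj_line_span_iff by blast
qed

text \<open>The twisted cubic in the 3-space \<open>L\<close>. The lines of \<open>Gam\<close> with \<open>p\<^sub>0\<^sub>5 = 0\<close> that
  contain a point with first and last coordinates \<open>(s, t) \<noteq> (0, 0)\<close> meet \<open>L\<close> in \<open>tcubic s t\<close>.\<close>

definition tcubic :: "complex \<Rightarrow> complex \<Rightarrow> complex^6" where
  "tcubic s t = (\<chi> i. if i = 1 then t^3 else if i = 2 then s * t^2 else if i = 3 then s^2 * t
     else if i = 4 then s^3 else 0)"

lemma tcubic_nth [simp]:
  "tcubic s t $ 0 = 0" "tcubic s t $ 1 = t^3" "tcubic s t $ 2 = s * t^2" "tcubic s t $ 3 = s^2 * t"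
  "tcubic s t $ 4 = s^3" "tcubic s t $ 5 = 0"
  by (simp_all add: tcubic_def)

lemma G1L_iff: "p \<in> G1L \<longleftrightarrow> p \<noteq> 0 \<and> (\<exists>x\<in>L. \<exists>y\<in>L. p = wedge x y)"
proof
  assume "p \<in> G1L"
  then have "\<exists>x y. p = wedge x y \<and> wedge x y \<noteq> 0 \<and> vec.span {x, y} \<subseteq> L"
    unfolding G1L_def pluecker_def proj_line_span_iff mem_Collect_eq by auto
  then obtain x y where xy: "p = wedge x y" "wedge x y \<noteq> 0" "vec.span {x, y} \<subseteq> L" by blast
  have "x \<in> vec.span {x, y}" "y \<in> vec.span {x, y}" by (auto intro: vec.span_base)
  then have "x \<in> L" "y \<in> L" using xy(3) by (meson subsetD)+
  moreover have "p \<noteq> 0" using xy by simp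
  ultimately show "p \<noteq> 0 \<and> (\<exists>x\<in>L. \<exists>y\<in>L. p = wedge x y)" using xy(1) by blast
next
  assume "p \<noteq> 0 \<and> (\<exists>x\<in>L. \<exists>y\<in>L. p = wedge x y)"
  then obtain x y where p: "p \<noteq> 0" "p = wedge x y" and "x \<in> L" "y \<in> L" by blast
  then have "vec.span {x, y} \<subseteq> L" unfolding span_pair by (auto simp: L_def)
  with p show "p \<in> G1L"
    unfolding G1L_def pluecker_def proj_line_span_iff mem_Collect_eq by blast
qed

text \<open>A line of \<open>Gam\<close> with \<open>p\<^sub>0\<^sub>5 = 0\<close> that is not contained in \<open>L\<close> meets \<open>L\<close> in one point,
  which lies on the twisted cubic and is determined by the first and last coordinates of the
  other points of the line.\<close>

lemma Gam_infinity:
  assumes "p \<in> Gam" "p $ 0 $ 5 = 0" "p \<notin> G1L"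
  obtains k x where "k \<noteq> 0" "x $ 0 \<noteq> 0 \<or> x $ 5 \<noteq> 0" "p = scal k (wedge (tcubic (x $ 0) (x $ 5)) x)"
proof -
  have main: "\<exists>k. k \<noteq> 0 \<and> p = scal k (wedge (tcubic (x $ 0) (x $ 5)) x)"
    if p: "p = wedge x y" and x: "x $ 0 \<noteq> 0 \<or> x $ 5 \<noteq> 0" for x y
  proof -
    define r where "r = (if x $ 0 \<noteq> 0 then y $ 0 / x $ 0 else y $ 5 / x $ 5)"
    define z where "z = y - r *s x"
    have p': "p = wedge x z" by (simp add: p z_def vec_eq_iff algebra_simps)
    have z0: "z $ 0 = 0" "z $ 5 = 0"
      using x assms(2) unfolding p by (auto simp: z_def r_def field_simps)
    have e: "x $ 0 * z $ 1 = x $ 5 * z $ 2" "x $ 0 * z $ 2 = x $ 5 * z $ 3"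
      "x $ 0 * z $ 3 = x $ 5 * z $ 4"
      using assms(1) z0 unfolding Gam_iff p' by auto
    have "\<exists>n. z = n *s tcubic (x $ 0) (x $ 5)"
    proof (cases "x $ 5 = 0")
      case True
      then have "x $ 0 \<noteq> 0" using x by simp
      with e True have "z $ 1 = 0" "z $ 2 = 0" "z $ 3 = 0" by simp_all
      then have "z = (z $ 4 / x $ 0 ^ 3) *s tcubic (x $ 0) (x $ 5)"
        using True \<open>x $ 0 \<noteq> 0\<close> z0 by (simp add: vec_eq_iff forall_6)
      then show ?thesis by blast
    next
      case False
      have "x $ 5 * z $ 2 = x $ 0 * z $ 1" "x $ 5 ^ 2 * z $ 3 = x $ 0 ^ 2 * z $ 1"
        "x $ 5 ^ 3 * z $ 4 = x $ 0 ^ 3 * z $ 1"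
        using e by algebra+
      then have "z = (z $ 1 / x $ 5 ^ 3) *s tcubic (x $ 0) (x $ 5)"
        using False z0 by (simp add: vec_eq_iff forall_6 field_simps power2_eq_square power3_eq_cube)
      then show ?thesis by blast
    qed
    then obtain n where n: "z = n *s tcubic (x $ 0) (x $ 5)" by blast
    have "p = scal (- n) (wedge (tcubic (x $ 0) (x $ 5)) x)"
      unfolding p' n by (simp add: vec_eq_iff algebra_simps)
    moreover have "n \<noteq> 0"
    proof
      assume "n = 0"
      then have "p = 0" using p' n by (simp add: vec_eq_iff)
      then show False using assms(1) by (simp add: Gam_iff)
    qed
    ultimately show ?thesis by (intro exI[of _ "- n"]) simp
  qed
  obtain x y where p: "p = wedge x y" using assms(1) by (auto simp: Gam_iff)
  have "\<not> (x \<in> L \<and> y \<in> L)" using assms p by (auto simp: G1L_iff Gam_iff)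
  then consider "x $ 0 \<noteq> 0 \<or> x $ 5 \<noteq> 0" | "y $ 0 \<noteq> 0 \<or> y $ 5 \<noteq> 0"
    by (auto simp: L_def)
  then show thesis
  proof cases
    case 1
    then show thesis using main[OF p] that by blast
  next
    case 2
    have "p = wedge y (- x)" by (simp add: p vec_eq_iff algebra_simps)
    then show thesis using main[of y "- x"] 2 that by blast
  qed
qed

lemma tcubic_wedge_nonzero:
  assumes "x $ 0 \<noteq> 0 \<or> x $ 5 \<noteq> 0"
  shows "wedge (tcubic (x $ 0) (x $ 5)) x \<noteq> 0"
proof -
  have "\<exists>i j. wedge (tcubic (x $ 0) (x $ 5)) x $ i $ j \<noteq> 0"
  proof (cases "x $ 0 = 0")
    case True
    then show ?thesis using assms by (intro exI[of _ 1] exI[of _ 5]) simp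
  next
    case False
    then show ?thesis by (intro exI[of _ 4] exI[of _ 0]) simp
  qed
  then show ?thesis using matrix_nonzeroI by blast
qed

lemma tcubic_wedge_Gam:
  assumes "k \<noteq> 0" "x $ 0 \<noteq> 0 \<or> x $ 5 \<noteq> 0"
  defines "p \<equiv> scal k (wedge (tcubic (x $ 0) (x $ 5)) x)"
  shows "p \<in> Gam" "p $ 0 $ 5 = 0" "p \<notin> G1L"
proof -
  have p: "p = wedge (k *s tcubic (x $ 0) (x $ 5)) x"
    by (simp add: p_def vec_eq_iff algebra_simps)
  have "p \<in> P14" unfolding p_def
    by (intro P14_scale wedge_P14 tcubic_wedge_nonzero assms)
  then have "p \<noteq> 0" by (simp add: P14_def)
  then show "p \<in> Gam"
    unfolding Gam_iff using p by (auto simp: power2_eq_square power3_eq_cube)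
  show "p $ 0 $ 5 = 0" by (simp add: p_def)
  show "p \<notin> G1L"
  proof
    assume "p \<in> G1L"
    then obtain a b where ab: "p = wedge a b" "a \<in> L" "b \<in> L" by (auto simp: G1L_iff)
    have "p $ 1 $ 5 = 0" "p $ 4 $ 0 = 0" using ab by (auto simp: L_def)
    then have "x $ 5 = 0" "x $ 0 = 0" using assms(1) by (simp_all add: p_def)
    then show False using assms(2) by simp
  qed
qed

lemma closedin_infinity: "closedin zariski (Gam \<inter> {p. p $ 0 $ 5 = 0})"
proof -
  have *: "Gam \<inter> {p. p $ 0 $ 5 = 0} = Gam \<inter> {p \<in> P14. p $ 0 $ 5 = 0}"
    using Gam_P14 by blast
  show ?thesis unfolding *
    by (intro closedin_Int closedin_Gam closedin_zariski_zeros[OF form_coord])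
qed

lemma G1L_subset: "G1L \<subseteq> Gam \<inter> {p. p $ 0 $ 5 = 0}"
proof
  fix p assume "p \<in> G1L"
  then obtain x y where p: "p \<noteq> 0" "p = wedge x y" "x \<in> L" "y \<in> L" unfolding G1L_iff by blast
  moreover from this have "p$0$1 + p$2$5 = 0 \<and> p$0$2 + p$3$5 = 0 \<and> p$0$3 + p$4$5 = 0" "p $ 0 $ 5 = 0"
    by (simp_all add: L_def)
  ultimately have "p \<in> Gam" unfolding Gam_iff by blast
  with \<open>p $ 0 $ 5 = 0\<close> show "p \<in> Gam \<inter> {p. p $ 0 $ 5 = 0}" by blast
qed

lemma G1L_equations:
  "G1L = Gam \<inter> {p \<in> P14. \<forall>(i, j) \<in> {0, 5} \<times> UNIV. p $ i $ j = 0}"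
proof (intro equalityI subsetI)
  fix p assume p: "p \<in> G1L"
  then obtain x y where "p = wedge x y" "x \<in> L" "y \<in> L" unfolding G1L_iff by blast
  then have "\<forall>(i, j) \<in> {0, 5} \<times> UNIV. p $ i $ j = 0" by (auto simp: L_def)
  moreover have "p \<in> Gam" using p G1L_subset by blast
  ultimately show "p \<in> Gam \<inter> {p \<in> P14. \<forall>(i, j) \<in> {0, 5} \<times> UNIV. p $ i $ j = 0}"
    using Gam_P14 by blast
next
  fix p assume "p \<in> Gam \<inter> {p \<in> P14. \<forall>(i, j) \<in> {0, 5} \<times> UNIV. p $ i $ j = 0}"
  then have p: "p \<in> Gam" and 0: "p $ 0 $ j = 0" "p $ 5 $ j = 0" for j by auto
  show "p \<in> G1L"
  proof (rule ccontr)
    assume n: "p \<notin> G1L"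
    obtain k x where kx: "k \<noteq> 0" "x $ 0 \<noteq> 0 \<or> x $ 5 \<noteq> 0"
      "p = scal k (wedge (tcubic (x $ 0) (x $ 5)) x)"
      by (rule Gam_infinity[OF p 0(1)[of 5] n])
    have "p $ 0 $ 4 = - k * x $ 0 ^ 4" "p $ 5 $ 1 = - k * x $ 5 ^ 4"
      unfolding kx(3) by (simp_all add: power3_eq_cube power4_eq_xxxx)
    then show False using kx(1,2) 0(1)[of 4] 0(2)[of 1] by simp
  qed
qed

lemma closedin_G1L: "closedin zariski G1L"
  unfolding G1L_equations split_def
  by (intro closedin_Int closedin_Gam closedin_zariski_forms[where e = "\<lambda>_. 1"] form_coord)

lemma finite_nonroots:
  fixes P :: "complex \<Rightarrow> bool"
  assumes "poly q 0 \<noteq> 0" "\<And>t. \<not> P t \<Longrightarrow> poly q t = 0"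
  shows "finite (- {t. P t})"
proof -
  have "q \<noteq> 0" using assms(1) by auto
  then have "finite {t. poly q t = 0}" by (rule poly_roots_finite)
  then show ?thesis by (rule rev_finite_subset) (use assms(2) in blast)
qed

text \<open>Any two lines of \<open>L\<close> are joined by a rational curve of lines of \<open>L\<close>, obtained by moving two
  points that span the line.\<close>

lemma irreducible_G1L: "irreducible_in zariski G1L"
proof (rule irreducible_joined)
  show "G1L \<subseteq> topspace zariski" using closedin_G1L by (simp add: closedin_subset)
  define e :: "6 \<Rightarrow> complex^6" where "e = (\<lambda>i. axis i 1)"
  have "wedge (e 2) (e 3) $ 2 $ 3 = 1" by (simp add: e_def axis_def)
  then have "wedge (e 2) (e 3) \<noteq> 0" by (intro matrix_nonzeroI[of _ 2 3]) simp
  moreover have "e 2 \<in> L" "e 3 \<in> L" by (simp_all add: e_def L_def axis_def)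
  ultimately have "wedge (e 2) (e 3) \<in> G1L" unfolding G1L_iff by blast
  then show "G1L \<noteq> {}" by blast
next
  fix p p' assume "p \<in> G1L" "p' \<in> G1L"
  then obtain x y x' y' where p: "p \<noteq> 0" "p = wedge x y" "x \<in> L" "y \<in> L"
    and p': "p' \<noteq> 0" "p' = wedge x' y'" "x' \<in> L" "y' \<in> L"
    unfolding G1L_iff by blast
  define X Y where "X = (\<lambda>t. x + t *s (x' - x))" and "Y = (\<lambda>t. y + t *s (y' - y))"
  define \<psi> where "\<psi> = (\<lambda>t. wedge (X t) (Y t))"
  define q where "q = (\<lambda>i j. [:x $ i, x' $ i - x $ i:] * [:y $ j, y' $ j - y $ j:]
    - [:x $ j, x' $ j - x $ j:] * [:y $ i, y' $ i - y $ i:])"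
  have q: "\<psi> t $ i $ j = poly (q i j) t" for t i j
    by (simp add: \<psi>_def X_def Y_def q_def algebra_simps)
  have ends: "\<psi> 0 = p" "\<psi> 1 = p'" by (simp_all add: \<psi>_def X_def Y_def p p')
  have L: "\<psi> t \<in> G1L" if "\<psi> t \<noteq> 0" for t
  proof -
    have "X t \<in> L" "Y t \<in> L" using p p' by (auto simp: X_def Y_def L_def)
    then show ?thesis using that unfolding G1L_iff \<psi>_def by blast
  qed
  have "\<exists>i j. p $ i $ j \<noteq> 0" using p(1) by (simp add: vec_eq_iff)
  then obtain i j where ij: "p $ i $ j \<noteq> 0" by blast
  have "finite (- {t. \<psi> t \<noteq> 0})"
    by (rule finite_nonroots[of "q i j"]) (use ij q[of 0 i j] q[of _ i j] ends(1) in \<open>simp_all flip: q\<close>)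
  moreover have "\<psi> ` {t. \<psi> t \<noteq> 0} \<subseteq> G1L" using L by blast
  moreover have "G1L \<subseteq> P14" using G1L_subset Gam_P14 by blast
  ultimately have "irreducible_in zariski (\<psi> ` {t. \<psi> t \<noteq> 0})"
    using q by (intro irreducible_curve) blast+
  moreover have "p \<in> \<psi> ` {t. \<psi> t \<noteq> 0}" "p' \<in> \<psi> ` {t. \<psi> t \<noteq> 0}"
    using ends p(1) p'(1) by (metis (mono_tags, lifting) image_eqI mem_Collect_eq)+
  ultimately show "\<exists>I\<subseteq>G1L. irreducible_in zariski I \<and> p \<in> I \<and> p' \<in> I"
    using \<open>\<psi> ` {t. \<psi> t \<noteq> 0} \<subseteq> G1L\<close> by blast
qed

text \<open>The lines of \<open>Gam\<close> with \<open>p\<^sub>0\<^sub>5 = 0\<close> that are not contained in \<open>L\<close>. They join a point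
  \<open>tcubic s t\<close> to a point with first and last coordinates \<open>s\<close>, \<open>t\<close>.\<close>

definition cubic_pencils :: "(complex^6^6) set" where
  "cubic_pencils = (Gam \<inter> {p. p $ 0 $ 5 = 0}) - G1L"

lemma cubic_pencils_iff: "p \<in> cubic_pencils \<longleftrightarrow> (\<exists>k x. k \<noteq> 0 \<and> (x $ 0 \<noteq> 0 \<or> x $ 5 \<noteq> 0) \<and>
    p = scal k (wedge (tcubic (x $ 0) (x $ 5)) x))"
proof
  assume "p \<in> cubic_pencils"
  then have "p \<in> Gam" "p $ 0 $ 5 = 0" "p \<notin> G1L" unfolding cubic_pencils_def by auto
  then show "\<exists>k x. k \<noteq> 0 \<and> (x $ 0 \<noteq> 0 \<or> x $ 5 \<noteq> 0) \<and>
    p = scal k (wedge (tcubic (x $ 0) (x $ 5)) x)" by (rule Gam_infinity) blast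
next
  assume "\<exists>k x. k \<noteq> 0 \<and> (x $ 0 \<noteq> 0 \<or> x $ 5 \<noteq> 0) \<and>
    p = scal k (wedge (tcubic (x $ 0) (x $ 5)) x)"
  then obtain k x where "k \<noteq> 0" "x $ 0 \<noteq> 0 \<or> x $ 5 \<noteq> 0"
    "p = scal k (wedge (tcubic (x $ 0) (x $ 5)) x)" by blast
  then show "p \<in> cubic_pencils"
    using tcubic_wedge_Gam[of k x] unfolding cubic_pencils_def by simp
qed

lemma irreducible_cubic_pencils: "irreducible_in zariski cubic_pencils"
proof (rule irreducible_joined)
  have sub: "cubic_pencils \<subseteq> P14" using Gam_P14 unfolding cubic_pencils_def by blast
  then show "cubic_pencils \<subseteq> topspace zariski" by (simp add: topspace_zariski)
  define x :: "complex^6" where "x = axis 0 1"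
  have "x $ 0 \<noteq> 0" by (simp add: x_def)
  then have "scal 1 (wedge (tcubic (x $ 0) (x $ 5)) x) \<in> cubic_pencils"
    unfolding cubic_pencils_iff by (intro exI[of _ 1] exI[of _ x] conjI disjI1 refl) simp_all
  then show "cubic_pencils \<noteq> {}" by blast
  fix p p' assume "p \<in> cubic_pencils" "p' \<in> cubic_pencils"
  then obtain k x k' x' where k: "k \<noteq> 0" "x $ 0 \<noteq> 0 \<or> x $ 5 \<noteq> 0"
      "p = scal k (wedge (tcubic (x $ 0) (x $ 5)) x)"
    and k': "k' \<noteq> 0" "x' $ 0 \<noteq> 0 \<or> x' $ 5 \<noteq> 0"
      "p' = scal k' (wedge (tcubic (x' $ 0) (x' $ 5)) x')"
    unfolding cubic_pencils_iff by blast
  define K X where "K = (\<lambda>t. k + t * (k' - k))" and "X = (\<lambda>t. x + t *s (x' - x))"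
  define \<psi> where "\<psi> = (\<lambda>t. scal (K t) (wedge (tcubic (X t $ 0) (X t $ 5)) (X t)))"
  define kp xp where "kp = [:k, k' - k:]" and "xp = (\<lambda>i. [:x $ i, x' $ i - x $ i:])"
  have K: "K t = poly kp t" and X: "X t $ i = poly (xp i) t" for t i
    by (simp_all add: K_def X_def kp_def xp_def algebra_simps)
  have pX: "polyc (\<lambda>t. X t $ i)" and pK: "polyc K" for i
    unfolding polyc_def using X K by blast+
  have tc: "polyc (\<lambda>t. tcubic (X t $ 0) (X t $ 5) $ i)" for i
  proof -
    have "\<forall>i. polyc (\<lambda>t. tcubic (X t $ 0) (X t $ 5) $ i)"
      unfolding forall_6 tcubic_nth power2_eq_square power3_eq_cube
      by (intro conjI polyc_const polyc_mult pX)
    then show ?thesis by blast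
  qed
  have \<psi>: "\<exists>q. \<forall>t. \<psi> t $ i $ j = poly q t" for i j
    unfolding \<psi>_def vec_lambda_beta wedge_nth polyc_def[symmetric]
    by (intro polyc_mult polyc_diff pK pX tc)
  define T where "T = {t. K t \<noteq> 0 \<and> (X t $ 0 \<noteq> 0 \<or> X t $ 5 \<noteq> 0)}"
  have T: "\<psi> ` T \<subseteq> cubic_pencils"
  proof (rule image_subsetI)
    fix t assume "t \<in> T"
    then have "K t \<noteq> 0 \<and> (X t $ 0 \<noteq> 0 \<or> X t $ 5 \<noteq> 0)" unfolding T_def by blast
    then show "\<psi> t \<in> cubic_pencils" unfolding cubic_pencils_iff \<psi>_def by blast
  qed
  obtain i where i: "x $ i \<noteq> 0" "i = 0 \<or> i = 5" using k(2) by blast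
  have KX: "poly (kp * xp i) t = K t * X t $ i" for t by (simp only: poly_mult K X)
  have "finite (- T)" unfolding T_def
    by (rule finite_nonroots[of "kp * xp i"], unfold KX) (use i k(1) in \<open>auto simp: K_def X_def\<close>)
  then have "irreducible_in zariski (\<psi> ` T)"
    using \<psi> T sub by (intro irreducible_curve) blast+
  moreover have "\<psi> 0 = p" "\<psi> 1 = p'" "0 \<in> T" "1 \<in> T"
    using k k' by (simp_all add: \<psi>_def T_def K_def X_def)
  then have "p \<in> \<psi> ` T" "p' \<in> \<psi> ` T" by blast+
  ultimately show "\<exists>I\<subseteq>cubic_pencils. irreducible_in zariski I \<and> p \<in> I \<and> p' \<in> I"
    using T by blast
qed

text \<open>The determinant of a symmetric matrix of order 3 with linear entries, up to sign. For a line in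
  \<open>L\<close> it is the resultant of the restrictions of two equations of the line to the twisted cubic, so
  that it vanishes if the line meets this curve. It separates the two components at infinity.\<close>

definition chow :: "complex^6^6 \<Rightarrow> complex" where
  "chow p = p$3$4 * ((p$1$4 + p$2$3) * p$1$2 - p$1$3 * p$1$3)
     + p$2$4 * (p$1$3 * p$2$3 - p$2$4 * p$1$2) + p$2$3 * (p$2$4 * p$1$3 - p$2$3 * (p$1$4 + p$2$3))"

lemma form_chow: "form 3 chow"
proof -
  have "form (1 + (1 + 1)) chow"
    unfolding chow_def[abs_def] by (intro form_add form_diff form_mult form_coord)
  then show ?thesis by (simp add: numeral_3_eq_3)
qed

lemma chow_cubic_pencils: "p \<in> cubic_pencils \<Longrightarrow> chow p = 0"
  unfolding cubic_pencils_iff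
proof (elim exE conjE)
  fix k x assume p: "p = scal k (wedge (tcubic (x $ 0) (x $ 5)) x)"
  show "chow p = 0" unfolding p chow_def by (simp, algebra)
qed

text \<open>As both sets are irreducible, closed and not contained in each other, they are the irreducible
  components of their union.\<close>

lemma components_at_infinity:
  "irreducible_component_of zariski (Gam \<inter> {p. p $ 0 $ 5 = 0}) Z \<and> Z \<noteq> G1L \<longleftrightarrow>
   Z = zariski closure_of cubic_pencils"
proof -
  let ?S = "Gam \<inter> {p. p $ 0 $ 5 = 0}" and ?C = "zariski closure_of cubic_pencils"
  have C: "closedin zariski ?C" "irreducible_in zariski ?C"
    by (simp_all add: irreducible_closure irreducible_cubic_pencils)
  have sub: "cubic_pencils \<subseteq> ?C"
    using Gam_P14 by (intro subset_zariski_closure) (auto simp: cubic_pencils_def)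
  have CS: "?C \<subseteq> ?S"
    by (rule closure_of_minimal[OF _ closedin_infinity]) (auto simp: cubic_pencils_def)
  have S: "?S = G1L \<union> ?C"
    using CS G1L_subset sub by (auto simp: cubic_pencils_def)
  have irr: "Y \<subseteq> G1L \<or> Y \<subseteq> ?C" if "Y \<subseteq> ?S" "irreducible_in zariski Y" for Y
  proof -
    have "\<And>C D. closedin zariski C \<Longrightarrow> closedin zariski D \<Longrightarrow> Y \<subseteq> C \<union> D \<Longrightarrow> Y \<subseteq> C \<or> Y \<subseteq> D"
      using that(2) unfolding irreducible_in_def by blast
    from this[OF closedin_G1L C(1)] show ?thesis using that(1) unfolding S .
  qed
  have "cubic_pencils \<noteq> {}" "cubic_pencils \<inter> G1L = {}"
    using irreducible_cubic_pencils by (auto simp: irreducible_in_def cubic_pencils_def)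
  with sub have nCG: "\<not> ?C \<subseteq> G1L" by blast
  have nGC: "\<not> G1L \<subseteq> ?C"
  proof
    assume G: "G1L \<subseteq> ?C"
    define e :: "6 \<Rightarrow> complex^6" where "e = (\<lambda>i. axis i 1)"
    define p where "p = wedge (e 2) (e 3)"
    have "p $ 2 $ 3 \<noteq> 0" by (simp add: p_def e_def axis_def)
    then have "p \<noteq> 0" by (rule matrix_nonzeroI)
    moreover have "e 2 \<in> L" "e 3 \<in> L" by (simp_all add: e_def L_def axis_def)
    ultimately have "p \<in> G1L" unfolding G1L_iff p_def by blast
    then have "chow p = 0" using G in_zariski_closure[OF _ form_chow chow_cubic_pencils] by blast
    then show False by (simp add: chow_def p_def e_def axis_def)
  qed
  show ?thesis
  proof
    assume Z: "irreducible_component_of zariski ?S Z \<and> Z \<noteq> G1L"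
    then have ZS: "Z \<subseteq> ?S" and Zi: "irreducible_in zariski Z"
      and mx: "\<And>W. Z \<subseteq> W \<Longrightarrow> W \<subseteq> ?S \<Longrightarrow> irreducible_in zariski W \<Longrightarrow> W = Z"
      unfolding irreducible_component_of_def by blast+
    from irr[OF ZS Zi] show "Z = ?C"
    proof
      assume "Z \<subseteq> G1L"
      from mx[OF this G1L_subset irreducible_G1L] Z show ?thesis by simp
    next
      assume "Z \<subseteq> ?C"
      from mx[OF this CS C(2)] show ?thesis by simp
    qed
  next
    assume Z: "Z = ?C"
    have "W = ?C" if "?C \<subseteq> W" "W \<subseteq> ?S" "irreducible_in zariski W" for W
      using irr[OF that(2,3)] that(1) nCG by blast
    then have "irreducible_component_of zariski ?S ?C"
      unfolding irreducible_component_of_def using CS C(2) by blast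
    then show "irreducible_component_of zariski ?S Z \<and> Z \<noteq> G1L" using Z nGC by blast
  qed
qed

lemma B''_eq: "B'' = zariski closure_of cubic_pencils"
  unfolding B''_def components_at_infinity by simp

lemma infinity_eq: "Gam \<inter> {p. p $ 0 $ 5 = 0} = G1L \<union> B''"
proof -
  have "cubic_pencils \<subseteq> B''" unfolding B''_eq
    using Gam_P14 by (intro subset_zariski_closure) (auto simp: cubic_pencils_def)
  moreover have "B'' \<subseteq> Gam \<inter> {p. p $ 0 $ 5 = 0}" unfolding B''_eq
    by (rule closure_of_minimal[OF _ closedin_infinity]) (auto simp: cubic_pencils_def)
  ultimately show ?thesis using G1L_subset by (auto simp: cubic_pencils_def)
qed

section \<open>The quadric of a Monge-Ampere equation\<close>

text \<open>The equation over an arbitrary integral domain, so that the unknowns may be polynomials.\<close>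

definition MAf :: "'a::idom \<Rightarrow> (nat \<Rightarrow> 'a) \<Rightarrow> (nat \<Rightarrow> 'a) \<Rightarrow> 'a \<Rightarrow> 'a \<Rightarrow> 'a \<Rightarrow> 'a \<Rightarrow> 'a \<Rightarrow> 'a \<Rightarrow> 'a" where
  "MAf d a b c u1 u2 u3 u4 u5 = d * (u1 * (u3 * u5 - u4 * u4) - u2 * (u2 * u5 - u3 * u4) + u3 * (u2 * u4 - u3 * u3))
     + a 1 * (u1 * u3 - u2 * u2) + a 2 * (u1 * u4 - u2 * u3)
     + a 3 * (u1 * u5 - u3 * u3) + a 4 * (u2 * u4 - u3 * u3)
     + a 5 * (u2 * u5 - u3 * u4) + a 6 * (u3 * u5 - u4 * u4)
     + b 1 * u1 + b 2 * u2 + b 3 * u3 + b 4 * u4 + b 5 * u5 + c"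

lemma MA_poly_eq: "MA_poly d a b c u = MAf d a b c (u$1) (u$2) (u$3) (u$4) (u$5)"
proof -
  have "det (hankel u) = u$1 * (u$3 * u$5 - u$4 * u$4) - u$2 * (u$2 * u$5 - u$3 * u$4)
      + u$3 * (u$2 * u$4 - u$3 * u$3)"
    by (simp add: det_3 hankel_def algebra_simps)
  then show ?thesis by (simp add: MA_poly_def MAf_def)
qed

text \<open>The part of the equation that is linear in the minors, as a linear form in the
  Pluecker coordinates; on \<open>chart u\<close> these are, up to sign, the minors of orders 0, 1 and 2.\<close>

definition minor_form :: "(nat \<Rightarrow> complex) \<Rightarrow> (nat \<Rightarrow> complex) \<Rightarrow> complex \<Rightarrow> complex^6^6 \<Rightarrow> complex" where
  "minor_form a b c p = - (a 1 * p$1$2 + a 2 * p$1$3 + a 3 * (p$1$4 + p$2$3) + a 4 * p$2$3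
       + a 5 * p$2$4 + a 6 * p$3$4)
     + b 1 * p$1$5 + b 2 * p$2$5 + b 3 * p$3$5 + b 4 * p$4$5 - b 5 * p$0$4 + c * p$0$5"

text \<open>The equation as a quadratic form in the Pluecker coordinates: expanding the determinant along a
  row, it is quadratic in the minors of orders 1 and 2.\<close>

definition MA_quadric :: "complex \<Rightarrow> (nat \<Rightarrow> complex) \<Rightarrow> (nat \<Rightarrow> complex) \<Rightarrow> complex \<Rightarrow> complex^6^6 \<Rightarrow> complex" where
  "MA_quadric d a b c p = d * (p$2$5 * p$2$4 - p$1$5 * p$3$4 - p$3$5 * p$2$3) + p$0$5 * minor_form a b c p"

text \<open>A second quadratic form vanishing on the congruence. On \<open>chart u\<close> it is the product of
  \<open>u $ 1\<close> and the equation: a minor of the adjugate of \<open>hankel u\<close> is \<open>u $ 1 * det (hankel u)\<close>.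
  Unlike the first one it does not vanish on all the lines with \<open>p\<^sub>0\<^sub>5 = 0\<close>.\<close>

definition MA_quadric2 :: "complex \<Rightarrow> (nat \<Rightarrow> complex) \<Rightarrow> (nat \<Rightarrow> complex) \<Rightarrow> complex \<Rightarrow> complex^6^6 \<Rightarrow> complex" where
  "MA_quadric2 d a b c p = d * (p$1$2 * (p$1$4 + p$2$3) - p$1$3 * p$1$3) + p$1$5 * minor_form a b c p"

lemma form_minor_form: "form 1 (minor_form a b c)"
  unfolding minor_form_def[abs_def]
  by (intro form_add form_diff form_uminus form_cmult form_coord)

lemma form_MA_quadric: "form 2 (MA_quadric d a b c)" "form 2 (MA_quadric2 d a b c)"
  unfolding MA_quadric_def[abs_def] MA_quadric2_def[abs_def] one_add_one[symmetric]
  by (intro form_add form_diff form_uminus form_cmult form_mult form_coord form_minor_form)+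

text \<open>The representatives of the lines of the system, before taking the closure.\<close>

abbreviation MA_points :: "complex \<Rightarrow> (nat \<Rightarrow> complex) \<Rightarrow> (nat \<Rightarrow> complex) \<Rightarrow> complex \<Rightarrow> (complex^6^6) set" where
  "MA_points d a b c \<equiv> {scal k (chart u) | k u. k \<noteq> 0 \<and> u $ 0 = 1 \<and> MA_poly d a b c u = 0}"

lemma MA_quadric_chart:
  assumes "u $ 0 = 1"
  shows "MA_quadric d a b c (chart u) = MA_poly d a b c u"
    "MA_quadric2 d a b c (chart u) = u $ 1 * MA_poly d a b c u"
  unfolding MA_quadric_def MA_quadric2_def minor_form_def MA_poly_eq MAf_def
  by (simp_all add: chart_def, algebra+)

lemma MA_quadric_infinity:
  assumes "p \<in> Gam" "p $ 0 $ 5 = 0"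
  shows "MA_quadric d a b c p = 0"
proof (cases "p \<in> G1L")
  case True
  then obtain x y where "p = wedge x y" "x \<in> L" "y \<in> L" unfolding G1L_iff by blast
  then show ?thesis by (simp add: MA_quadric_def L_def)
next
  case False
  with assms obtain k x where p: "p = scal k (wedge (tcubic (x $ 0) (x $ 5)) x)"
    using Gam_infinity by blast
  show ?thesis unfolding p MA_quadric_def by (simp, algebra)
qed

lemma Gam_MA_quadric:
  "(Gam \<inter> {p \<in> P14. MA_quadric d a b c p = 0}) - (G1L \<union> B'') =
   MA_points d a b c" (is "?A = ?B")
proof (intro equalityI subsetI)
  fix p assume p: "p \<in> ?A"
  then have "p \<in> Gam \<and> p $ 0 $ 5 \<noteq> 0" unfolding infinity_eq[symmetric] by blast
  then obtain k u where ku: "k \<noteq> 0" "u $ 0 = 1" "p = scal k (chart u)" unfolding Gam_chart by blast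
  have "0 = MA_quadric d a b c p" using p by simp
  also have "\<dots> = k ^ 2 * MA_poly d a b c u"
    unfolding ku(3) form_scale[OF form_MA_quadric(1)] MA_quadric_chart[OF ku(2)] ..
  finally have "MA_poly d a b c u = 0" using ku(1) by simp
  with ku show "p \<in> ?B" by blast
next
  fix p assume "p \<in> ?B"
  then obtain k u where ku: "k \<noteq> 0" "u $ 0 = 1" "p = scal k (chart u)" "MA_poly d a b c u = 0" by blast
  then have p: "p \<in> Gam" "p $ 0 $ 5 \<noteq> 0" using Gam_chart by blast+
  have "MA_quadric d a b c p = 0"
    unfolding ku(3) form_scale[OF form_MA_quadric(1)] MA_quadric_chart[OF ku(2)] using ku(4) by simp
  then show "p \<in> ?A" using p Gam_P14 unfolding infinity_eq[symmetric] by blast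
qed

lemma quadric_MA_quadric:
  assumes "d \<noteq> 0"
  shows "quadric {p \<in> P14. MA_quadric d a b c p = 0}"
proof -
  define e :: "6 \<Rightarrow> complex^6" where "e = (\<lambda>i. axis i 1)"
  define p where "p = wedge (e 1) (e 5) + wedge (e 3) (e 4)"
  have "p $ 1 $ 5 \<noteq> 0" by (simp add: p_def e_def axis_def)
  then have "p \<in> P14" by (rule P14I) (simp add: p_def algebra_simps)
  moreover have "MA_quadric d a b c p \<noteq> 0"
    using assms by (simp add: MA_quadric_def p_def e_def axis_def)
  ultimately show ?thesis
    unfolding quadric_def using form_MA_quadric(1) by blast
qed

lemma B_MA_residual:
  "B_MA d a b c = residual (G1L \<union> B'') (Gam \<inter> {p \<in> P14. MA_quadric d a b c p = 0})"
  unfolding B_MA_def residual_def Gam_MA_quadric pluecker_MA_lines ..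

section \<open>Bounding the length of chains of irreducible sets\<close>

text \<open>A homogeneous system of linear equations with more unknowns than equations has a non-trivial
  solution.\<close>

lemma homogeneous_system_solution:
  fixes M :: "'i \<Rightarrow> 'j \<Rightarrow> complex"
  assumes "finite I" "finite J" "card I < card J"
  shows "\<exists>c. (\<exists>j\<in>J. c j \<noteq> 0) \<and> (\<forall>i\<in>I. (\<Sum>j\<in>J. c j * M i j) = 0)"
  using assms
proof (induction I arbitrary: J M rule: finite_induct)
  case empty
  then have "J \<noteq> {}" by auto
  then show ?case by (intro exI[of _ "\<lambda>_. 1"]) auto
next
  case (insert i I)
  show ?case
  proof (cases "\<forall>j\<in>J. M i j = 0")
    case True
    have "card I < card J" using insert by simp
    from insert.IH[OF insert.prems(1) this, of M] True show ?thesis by auto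
  next
    case False
    then obtain j0 where j0: "j0 \<in> J" "M i j0 \<noteq> 0" by blast
    define J' where "J' = J - {j0}"
    define M' where "M' = (\<lambda>i' j. M i' j - M i' j0 * M i j / M i j0)"
    have "finite J'" "card I < card J'" using insert j0 by (auto simp: J'_def)
    from insert.IH[OF this, of M'] obtain c where
      c: "\<exists>j\<in>J'. c j \<noteq> 0" "\<And>i'. i' \<in> I \<Longrightarrow> (\<Sum>j\<in>J'. c j * M' i' j) = 0" by blast
    define c' where "c' = c(j0 := - (\<Sum>j\<in>J'. c j * M i j) / M i j0)"
    have sum: "(\<Sum>j\<in>J. c' j * M i' j) = c' j0 * M i' j0 + (\<Sum>j\<in>J'. c j * M i' j)" for i'
    proof -
      have "(\<Sum>j\<in>J. c' j * M i' j) = c' j0 * M i' j0 + (\<Sum>j\<in>J'. c' j * M i' j)"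
        unfolding J'_def using insert.prems(1) j0(1) by (rule sum.remove)
      also have "(\<Sum>j\<in>J'. c' j * M i' j) = (\<Sum>j\<in>J'. c j * M i' j)"
        by (rule sum.cong) (auto simp: c'_def J'_def)
      finally show ?thesis .
    qed
    have "(\<Sum>j\<in>J. c' j * M i' j) = 0" if "i' \<in> insert i I" for i'
    proof (cases "i' = i")
      case True
      then show ?thesis unfolding sum using j0 by (simp add: c'_def)
    next
      case False
      then have "(\<Sum>j\<in>J'. c j * M i' j) = (\<Sum>j\<in>J'. c j * (M i' j0 * M i j / M i j0))"
        using c(2)[of i'] that by (simp add: M'_def right_diff_distrib sum_subtractf)
      also have "\<dots> = (\<Sum>j\<in>J'. (c j * M i j) * (M i' j0 / M i j0))"
        by (intro sum.cong refl) simp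
      also have "\<dots> = (\<Sum>j\<in>J'. c j * M i j) * (M i' j0 / M i j0)"
        by (rule sum_distrib_right[symmetric])
      finally show ?thesis unfolding sum by (simp add: c'_def)
    qed
    moreover have "\<exists>j\<in>J. c' j \<noteq> 0" using c(1) by (auto simp: c'_def J'_def)
    ultimately show ?thesis by blast
  qed
qed

text \<open>Homogeneous monomials of degree \<open>D\<close> in \<open>f 0, \<dots>, f n\<close>, given by the exponents of
  \<open>f 1, \<dots>, f n\<close>; the factor \<open>f 0\<close> takes the remaining degree.\<close>

definition fmono :: "nat \<Rightarrow> nat \<Rightarrow> (nat \<Rightarrow> 'a \<Rightarrow> complex) \<Rightarrow> (nat \<Rightarrow> nat) \<Rightarrow> 'a \<Rightarrow> complex" where
  "fmono n D f m p = f 0 p ^ (D - (\<Sum>i\<in>{1..n}. m i)) * (\<Prod>i\<in>{1..n}. f i p ^ m i)"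

lemma fmono_exponent_le:
  fixes m :: "nat \<Rightarrow> nat"
  assumes "m \<in> PiE {1..n} (\<lambda>_. {..k})"
  shows "(\<Sum>i\<in>{1..n}. m i) \<le> n * k"
proof -
  have "(\<Sum>i\<in>{1..n}. m i) \<le> (\<Sum>i\<in>{1..n}. k)"
    using assms by (intro sum_mono) (auto simp: PiE_iff)
  then show ?thesis by simp
qed

lemma form_fmono:
  assumes "\<And>i. i \<le> n \<Longrightarrow> form e (f i)" "(\<Sum>i\<in>{1..n}. m i) \<le> D"
  shows "form (e * D) (fmono n D f m)"
proof -
  have "form (e * (D - (\<Sum>i\<in>{1..n}. m i)) + (\<Sum>i\<in>{1..n}. e * m i)) (fmono n D f m)"
    unfolding fmono_def[abs_def]
    by (intro form_mult form_power form_prod) (use assms(1) in auto)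
  also have "e * (D - (\<Sum>i\<in>{1..n}. m i)) + (\<Sum>i\<in>{1..n}. e * m i) = e * D"
    using assms(2) by (simp flip: sum_distrib_left distrib_left)
  finally show ?thesis .
qed

lemma form_relation:
  assumes "\<And>i. i \<le> n \<Longrightarrow> form e (f i)" "n * k \<le> D"
  shows "form (e * D) (\<lambda>p. \<Sum>m\<in>PiE {1..n} (\<lambda>_. {..k}). c m * fmono n D f m p)"
proof (rule form_sum)
  fix m assume "m \<in> PiE {1..n} (\<lambda>_. {..k})"
  from fmono_exponent_le[OF this] assms(2) have "(\<Sum>i\<in>{1..n}. m i) \<le> D" by simp
  then have "form (e * D) (fmono n D f m)" by (intro form_fmono assms(1))
  then show "form (e * D) (\<lambda>p. c m * fmono n D f m p)" by (rule form_cmult)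
qed

text \<open>Along a chain of irreducible sets, forms \<open>f i\<close> that vanish on one member of the chain but
  not on the next one are algebraically independent on the last member. A relation is divided
  by the largest possible power of \<open>f n\<close> and then restricted to the previous member.\<close>

lemma monomials_independent:
  assumes "\<And>i. i \<le> n \<Longrightarrow> irreducible_in zariski (Z i)" "\<And>i. i < n \<Longrightarrow> Z i \<subseteq> Z (Suc i)"
    and "\<And>i. i \<le> n \<Longrightarrow> form e (f i)" "\<And>i p. i < n \<Longrightarrow> p \<in> Z i \<Longrightarrow> f (Suc i) p = 0"
    and "\<And>i. i \<le> n \<Longrightarrow> \<exists>p\<in>Z i. f i p \<noteq> 0" "n * k \<le> D"
    and "\<And>p. p \<in> Z n \<Longrightarrow> (\<Sum>m\<in>PiE {1..n} (\<lambda>_. {..k}). c m * fmono n D f m p) = 0"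
  shows "\<forall>m\<in>PiE {1..n} (\<lambda>_. {..k}). c m = 0"
  using assms
proof (induction n arbitrary: c D)
  case 0
  obtain p where "p \<in> Z 0" "f 0 p \<noteq> 0" using "0.prems"(5)[of 0] by blast
  with "0.prems"(7)[of p] show ?case by (simp add: fmono_def)
next
  case (Suc n)
  define E where "E = PiE {1..n} (\<lambda>_. {..k})"
  define g where "g = f (Suc n)"
  define S where "S = (\<lambda>t p. \<Sum>m\<in>E. c (m(Suc n := t)) * fmono n (D - t) f m p)"
  have ins: "{1..Suc n} = insert (Suc n) {1..n}" "Suc n \<notin> {1..n}" by auto
  have PiE: "PiE {1..Suc n} (\<lambda>_. {..k}) = (\<lambda>(t, m). m(Suc n := t)) ` ({..k} \<times> E)"
    unfolding ins(1) PiE_insert_eq E_def ..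
  have inj: "inj_on (\<lambda>(t, m). m(Suc n := t)) ({..k} \<times> E)"
    unfolding E_def using inj_combinator[OF ins(2), of "\<lambda>_. {..k}"] .
  have mono: "fmono (Suc n) D f (m(Suc n := t)) p = g p ^ t * fmono n (D - t) f m p" for t m p
  proof -
    have "(\<Sum>i\<in>{1..n}. (m(Suc n := t)) i) = (\<Sum>i\<in>{1..n}. m i)" by (rule sum.cong) auto
    moreover have "(\<Prod>i\<in>{1..n}. f i p ^ (m(Suc n := t)) i) = (\<Prod>i\<in>{1..n}. f i p ^ m i)"
      by (rule prod.cong) auto
    ultimately show ?thesis unfolding fmono_def g_def by (simp add: mult_ac add_ac)
  qed
  have rel: "(\<Sum>t\<le>k. g p ^ t * S t p) = 0" if "p \<in> Z (Suc n)" for p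
  proof -
    have "0 = (\<Sum>m\<in>PiE {1..Suc n} (\<lambda>_. {..k}). c m * fmono (Suc n) D f m p)"
      using Suc.prems(7)[OF that] by simp
    also have "\<dots> = (\<Sum>(t, m)\<in>{..k} \<times> E. c (m(Suc n := t)) * (g p ^ t * fmono n (D - t) f m p))"
      unfolding PiE sum.reindex[OF inj] by (simp add: split_def mono)
    also have "\<dots> = (\<Sum>t\<le>k. \<Sum>m\<in>E. c (m(Suc n := t)) * (g p ^ t * fmono n (D - t) f m p))"
      by (simp add: sum.cartesian_product)
    also have "\<dots> = (\<Sum>t\<le>k. g p ^ t * S t p)"
      by (simp add: S_def sum_distrib_left mult_ac)
    finally show ?thesis by simp
  qed
  have kD: "t \<le> k \<Longrightarrow> n * k \<le> D - t" for t using Suc.prems(6) by simp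
  have formS: "form (e * (D - t)) (S t)" if "t \<le> k" for t
    unfolding S_def
  proof (intro form_sum form_cmult form_fmono)
    fix m assume "m \<in> E"
    then show "(\<Sum>i\<in>{1..n}. m i) \<le> D - t"
      using fmono_exponent_le[of m n k] kD[OF that] unfolding E_def by linarith
  qed (use Suc.prems(3) in auto)
  have "\<forall>m\<in>E. c (m(Suc n := t)) = 0" if "t \<le> k" for t
    using that
  proof (induction t rule: less_induct)
    case (less t)
    \<comment> \<open>The quotient of the relation by \<open>g ^ t\<close>; only the term \<open>S t\<close> survives where \<open>g\<close> vanishes.\<close>
    define R where "R = (\<lambda>p. \<Sum>s\<in>{t..k}. g p ^ (s - t) * S s p)"
    have S0: "S s p = 0" if "s < t" for s p
    proof -
      have "s \<le> k" using that less.prems by simp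
      with less.IH[OF that] have c0: "\<And>m. m \<in> E \<Longrightarrow> c (m(Suc n := s)) = 0" by blast
      show ?thesis unfolding S_def by (intro sum.neutral ballI) (simp only: c0 mult_zero_left)
    qed
    have fac: "g p ^ t * R p = 0" if "p \<in> Z (Suc n)" for p
    proof -
      have "(\<Sum>s\<le>k. g p ^ s * S s p) = (\<Sum>s\<in>{t..k}. g p ^ s * S s p)"
        by (rule sum.mono_neutral_right) (use S0 in auto)
      also have "\<dots> = (\<Sum>s\<in>{t..k}. g p ^ t * (g p ^ (s - t) * S s p))"
        by (rule sum.cong) (auto simp flip: power_add mult.assoc)
      finally show ?thesis using rel[OF that] by (simp add: R_def sum_distrib_left)
    qed
    have "form (e * (D - t)) (\<lambda>p. g p ^ (s - t) * S s p)" if "s \<in> {t..k}" for s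
    proof -
      have "form (e * (s - t) + e * (D - s)) (\<lambda>p. g p ^ (s - t) * S s p)"
        using that Suc.prems(3)[of "Suc n"] formS[of s]
        unfolding g_def by (intro form_mult form_power) auto
      also have "e * (s - t) + e * (D - s) = e * (D - t)"
        using that Suc.prems(6) by (simp flip: distrib_left)
      finally show ?thesis .
    qed
    then have formR: "form (e * (D - t)) R" unfolding R_def by (intro form_sum)
    have "form (e * t) (\<lambda>p. g p ^ t)" unfolding g_def by (intro form_power Suc.prems(3)) simp
    from irreducible_form_mult[OF Suc.prems(1)[of "Suc n"] this formR fac]
    have "(\<forall>p\<in>Z (Suc n). g p ^ t = 0) \<or> (\<forall>p\<in>Z (Suc n). R p = 0)" by simp
    moreover have "\<exists>p\<in>Z (Suc n). g p ^ t \<noteq> 0" using Suc.prems(5)[of "Suc n"] by (simp add: g_def) blast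
    ultimately have R0: "R p = 0" if "p \<in> Z (Suc n)" for p using that by blast
    have "S t p = 0" if "p \<in> Z n" for p
    proof -
      have "g p = 0" using Suc.prems(4)[of n p] that by (simp add: g_def)
      then have "R p = (\<Sum>s\<in>{t..k}. if s = t then S s p else 0)"
        unfolding R_def by (intro sum.cong) auto
      also have "\<dots> = S t p" using less.prems by simp
      finally show ?thesis using R0 Suc.prems(2)[of n] that by auto
    qed
    then have "\<forall>m\<in>PiE {1..n} (\<lambda>_. {..k}). c (m(Suc n := t)) = 0"
      using Suc.prems kD[OF less.prems]
      by (intro Suc.IH[of "D - t" "\<lambda>m. c (m(Suc n := t))"]) (simp_all add: S_def E_def)
    then show ?case unfolding E_def .
  qed
  then show ?case unfolding PiE by auto
qed

text \<open>A chain of length \<open>n\<close> provides \<open>n + 1\<close> independent forms, which are raised to powers so that they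
  get the same degree.\<close>

lemma chain_length_bound:
  assumes "irreducible_chain zariski (zariski closure_of A) m Z"
    and dep: "\<And>f e. (\<And>i. i \<le> n \<Longrightarrow> form e (f i)) \<Longrightarrow> \<exists>k c.
      (\<exists>m\<in>PiE {1..n} (\<lambda>_. {..k}). c m \<noteq> 0) \<and>
      (\<forall>p\<in>A. (\<Sum>m\<in>PiE {1..n} (\<lambda>_. {..k}). c m * fmono n (n * k) f m p) = 0)"
  shows "m < n"
proof (rule ccontr)
  assume "\<not> m < n"
  then have nm: "n \<le> m" by simp
  let ?B = "zariski closure_of A"
  have cl: "closedin zariski (Z i)" if "i \<le> n" for i
    using assms(1) that nm unfolding irreducible_chain_def
    by (meson closedin_closure_of closedin_trans_full le_trans)
  have irr: "irreducible_in zariski (Z i)" if "i \<le> n" for i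
    using assms(1) that nm unfolding irreducible_chain_def by auto
  have ss: "Z i \<subset> Z (Suc i)" if "i < n" for i
    using assms(1) that nm unfolding irreducible_chain_def by auto
  have ZB: "Z n \<subseteq> ?B"
  proof -
    have "closedin (subtopology zariski ?B) (Z n)"
      using assms(1) nm unfolding irreducible_chain_def by blast
    from closedin_subset[OF this] show ?thesis by simp
  qed
  have ZP: "Z i \<subseteq> P14" if "i \<le> n" for i
    using irr[OF that] by (simp add: irreducible_in_def topspace_zariski)
  have ex: "\<exists>e g. e > 0 \<and> form e g \<and> (\<exists>p\<in>Z i. g p \<noteq> 0) \<and> (\<forall>j. i = Suc j \<longrightarrow> (\<forall>p\<in>Z j. g p = 0))"
    if i: "i \<le> n" for i
  proof (cases i)
    case 0
    obtain p where p: "p \<in> Z 0" using irr[of 0] by (auto simp: irreducible_in_def)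
    then have "p \<in> P14" using ZP[of 0] by auto
    then obtain a b where "p $ a $ b \<noteq> 0" by (rule P14_entry)
    then show ?thesis using p 0 form_coord[of a b]
      by (intro exI[of _ 1] exI[of _ "\<lambda>p. p $ a $ b"]) auto
  next
    case (Suc j)
    then obtain p where p: "p \<in> Z i" "p \<notin> Z j" using ss[of j] i by auto
    then have P: "p \<in> P14" using ZP[OF i] by auto
    then obtain a b where ab: "p $ a $ b \<noteq> 0" by (rule P14_entry)
    have "j \<le> n" using Suc i by simp
    then obtain e g where "form e g" "g p \<noteq> 0" "\<forall>x\<in>Z j. g x = 0"
      using closedin_zariski_separate[OF cl P p(2)] by blast
    moreover from this have "form (e + 1) (\<lambda>p. g p * p $ a $ b)" by (intro form_mult form_coord)
    ultimately show ?thesis using p ab Suc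
      by (intro exI[of _ "e + 1"] exI[of _ "\<lambda>p. g p * p $ a $ b"]) auto
  qed
  then obtain e g where eg: "\<And>i. i \<le> n \<Longrightarrow> e i > 0 \<and> form (e i) (g i) \<and> (\<exists>p\<in>Z i. g i p \<noteq> 0) \<and>
      (\<forall>j. i = Suc j \<longrightarrow> (\<forall>p\<in>Z j. g i p = 0))" by metis
  define E where "E = (\<Prod>i\<le>n. e i)"
  define f where "f = (\<lambda>i p. g i p ^ (E div e i))"
  have E: "E > 0" using eg by (simp add: E_def prod_pos)
  have dvd: "e i dvd E" if "i \<le> n" for i
    unfolding E_def using that by (intro dvd_prodI) auto
  have form: "form E (f i)" if "i \<le> n" for i
    using form_power[of "e i" "g i" "E div e i"] eg[OF that] dvd[OF that] by (simp add: f_def)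
  have pos: "E div e i > 0" if "i \<le> n" for i
    using dvd[OF that] E eg[OF that] by (simp add: div_greater_zero_iff dvd_imp_le)
  obtain k c where kc: "\<exists>m\<in>PiE {1..n} (\<lambda>_. {..k}). c m \<noteq> 0"
    "\<And>p. p \<in> A \<Longrightarrow> (\<Sum>m\<in>PiE {1..n} (\<lambda>_. {..k}). c m * fmono n (n * k) f m p) = 0"
    using dep[of E f] form by blast
  have "form (E * (n * k)) (\<lambda>p. \<Sum>m\<in>PiE {1..n} (\<lambda>_. {..k}). c m * fmono n (n * k) f m p)"
    by (rule form_relation) (use form in auto)
  then have rel: "(\<Sum>m\<in>PiE {1..n} (\<lambda>_. {..k}). c m * fmono n (n * k) f m p) = 0" if "p \<in> Z n" for p
    using in_zariski_closure[of p A] ZB that kc(2) by blast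
  have "\<forall>m\<in>PiE {1..n} (\<lambda>_. {..k}). c m = 0"
  proof (rule monomials_independent[where Z = Z and e = E and f = f and D = "n * k"])
    show "f (Suc i) p = 0" if "i < n" "p \<in> Z i" for i p
      using eg[of "Suc i"] pos[of "Suc i"] that by (simp add: f_def)
    show "\<exists>p\<in>Z i. f i p \<noteq> 0" if "i \<le> n" for i using eg[OF that] by (auto simp: f_def)
    show "Z i \<subseteq> Z (Suc i)" if "i < n" for i using ss[OF that] by blast
  qed (use irr form rel in auto)
  with kc(1) show False by blast
qed

section \<open>Dimension of the congruence\<close>

text \<open>Exponents of monomials in \<open>u\<^sub>1, u\<^sub>2, u\<^sub>4, u\<^sub>5, u\<^sub>3\<close>, in this order.\<close>

definition box :: "nat \<Rightarrow> (nat \<times> nat \<times> nat \<times> nat \<times> nat) set" where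
  "box n = {..n} \<times> {..n} \<times> {..n} \<times> {..n} \<times> {..2}"

fun boxmono :: "nat \<times> nat \<times> nat \<times> nat \<times> nat \<Rightarrow> complex^6 \<Rightarrow> complex" where
  "boxmono (i, j, k, l, m) u = u$1 ^ i * u$2 ^ j * u$4 ^ k * u$5 ^ l * u$3 ^ m"

text \<open>Functions that agree on \<open>S\<close> with a polynomial of degree at most 2 in \<open>u\<^sub>3\<close> and at most
  \<open>n\<close> in each of the other variables.\<close>

definition boxed :: "(complex^6) set \<Rightarrow> nat \<Rightarrow> (complex^6 \<Rightarrow> complex) \<Rightarrow> bool" where
  "boxed S n F \<longleftrightarrow> (\<exists>c. \<forall>u\<in>S. F u = (\<Sum>i\<in>box n. c i * boxmono i u))"

lemma finite_box [simp]: "finite (box n)"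
  by (simp add: box_def)

lemma card_box: "card (box n) = 3 * (n + 1) ^ 4"
  by (simp add: box_def card_cartesian_product power4_eq_xxxx algebra_simps)

lemma boxed_boxmono:
  assumes "i \<in> box n"
  shows "boxed S n (boxmono i)"
  unfolding boxed_def
proof (intro exI ballI)
  fix u
  have "(\<Sum>j\<in>box n. (if j = i then 1 else 0) * boxmono j u) = (\<Sum>j\<in>box n. if j = i then boxmono j u else 0)"
    by (rule sum.cong) auto
  then show "boxmono i u = (\<Sum>j\<in>box n. (if j = i then 1 else 0) * boxmono j u)"
    using assms by simp
qed

lemma boxed_add: "boxed S n F \<Longrightarrow> boxed S n G \<Longrightarrow> boxed S n (\<lambda>u. F u + G u)"
  unfolding boxed_def
proof (elim exE)
  fix c c' assume "\<forall>u\<in>S. F u = (\<Sum>i\<in>box n. c i * boxmono i u)" "\<forall>u\<in>S. G u = (\<Sum>i\<in>box n. c' i * boxmono i u)"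
  then show "\<exists>c. \<forall>u\<in>S. F u + G u = (\<Sum>i\<in>box n. c i * boxmono i u)"
    by (intro exI[of _ "\<lambda>i. c i + c' i"]) (simp add: sum.distrib distrib_right)
qed

lemma boxed_cmult: "boxed S n F \<Longrightarrow> boxed S n (\<lambda>u. k * F u)"
  unfolding boxed_def
proof (elim exE)
  fix c assume "\<forall>u\<in>S. F u = (\<Sum>i\<in>box n. c i * boxmono i u)"
  then show "\<exists>c. \<forall>u\<in>S. k * F u = (\<Sum>i\<in>box n. c i * boxmono i u)"
    by (intro exI[of _ "\<lambda>i. k * c i"]) (simp add: sum_distrib_left mult_ac)
qed

lemma boxed_diff: "boxed S n F \<Longrightarrow> boxed S n G \<Longrightarrow> boxed S n (\<lambda>u. F u - G u)"
  using boxed_add[OF _ boxed_cmult, of S n F G "-1"] by simp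

lemma boxed_zero: "boxed S n (\<lambda>u. 0)"
  unfolding boxed_def by (intro exI[of _ "\<lambda>_. 0"]) simp

lemma boxed_sum: "(\<And>i. i \<in> I \<Longrightarrow> boxed S n (F i)) \<Longrightarrow> boxed S n (\<lambda>u. \<Sum>i\<in>I. F i u)"
  by (induction I rule: infinite_finite_induct) (auto intro: boxed_zero boxed_add)

lemma boxed_cong: "boxed S n F \<Longrightarrow> (\<And>u. u \<in> S \<Longrightarrow> F u = G u) \<Longrightarrow> boxed S n G"
  unfolding boxed_def by auto

lemma boxed_le:
  assumes "boxed S n F" "n \<le> n'"
  shows "boxed S n' F"
proof -
  obtain c where c: "\<forall>u\<in>S. F u = (\<Sum>i\<in>box n. c i * boxmono i u)" using assms(1) by (auto simp: boxed_def)
  have "boxed S n' (\<lambda>u. \<Sum>i\<in>box n. c i * boxmono i u)"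
    by (intro boxed_sum boxed_cmult boxed_boxmono) (use assms(2) in \<open>auto simp: box_def\<close>)
  then show ?thesis by (rule boxed_cong) (use c in simp)
qed

text \<open>Multiplication by \<open>G\<close> raises the bound on the degrees by at most \<open>D\<close>.\<close>

definition weight :: "(complex^6) set \<Rightarrow> nat \<Rightarrow> (complex^6 \<Rightarrow> complex) \<Rightarrow> bool" where
  "weight S D G \<longleftrightarrow> (\<forall>n F. boxed S n F \<longrightarrow> boxed S (n + D) (\<lambda>u. G u * F u))"

lemma weightI:
  assumes "\<And>n i. i \<in> box n \<Longrightarrow> boxed S (n + D) (\<lambda>u. G u * boxmono i u)"
  shows "weight S D G"
  unfolding weight_def
proof (intro allI impI)
  fix n F assume "boxed S n F"
  then obtain c where c: "\<forall>u\<in>S. F u = (\<Sum>i\<in>box n. c i * boxmono i u)" by (auto simp: boxed_def)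
  have "boxed S (n + D) (\<lambda>u. \<Sum>i\<in>box n. c i * (G u * boxmono i u))"
    by (intro boxed_sum boxed_cmult assms)
  then show "boxed S (n + D) (\<lambda>u. G u * F u)"
    by (rule boxed_cong) (use c in \<open>simp add: sum_distrib_left mult_ac\<close>)
qed

lemma weight_le: "weight S D G \<Longrightarrow> D \<le> D' \<Longrightarrow> weight S D' G"
  unfolding weight_def by (meson add_left_mono boxed_le)

lemma weight_const: "weight S 0 (\<lambda>u. k)"
  unfolding weight_def by (simp add: boxed_cmult)

lemma weight_mult:
  assumes "weight S D F" "weight S D' G"
  shows "weight S (D + D') (\<lambda>u. F u * G u)"
  unfolding weight_def
proof (intro allI impI)
  fix n H assume "boxed S n H"
  then have "boxed S (n + D' + D) (\<lambda>u. F u * (G u * H u))"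
    using assms unfolding weight_def by blast
  then show "boxed S (n + (D + D')) (\<lambda>u. F u * G u * H u)" by (simp add: add_ac mult_ac)
qed

lemma weight_add:
  assumes "weight S D F" "weight S D' G"
  shows "weight S (D + D') (\<lambda>u. F u + G u)"
  unfolding weight_def
proof (intro allI impI)
  fix n H assume H: "boxed S n H"
  have "weight S (D + D') F" "weight S (D + D') G" using assms by (auto intro: weight_le)
  then show "boxed S (n + (D + D')) (\<lambda>u. (F u + G u) * H u)"
    using H unfolding weight_def distrib_right by (intro boxed_add) blast+
qed

lemma weight_power: "weight S D F \<Longrightarrow> weight S (D * n) (\<lambda>u. F u ^ n)"
  by (induction n) (use weight_const[of S 1] weight_mult in auto)

lemma weight_prod:
  "finite I \<Longrightarrow> (\<And>i. i \<in> I \<Longrightarrow> weight S (D i) (F i)) \<Longrightarrow> weight S (\<Sum>i\<in>I. D i) (\<lambda>u. \<Prod>i\<in>I. F i u)"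
  by (induction I rule: finite_induct) (use weight_const[of S 1] weight_mult in auto)

lemma weight_coord:
  "weight S 1 (\<lambda>u. u $ 1)" "weight S 1 (\<lambda>u. u $ 2)" "weight S 1 (\<lambda>u. u $ 4)" "weight S 1 (\<lambda>u. u $ 5)"
proof -
  have *: "weight S 1 G"
    if "\<And>n i. i \<in> box n \<Longrightarrow> T i \<in> box (n + 1)" "\<And>i u. G u * boxmono i u = boxmono (T i) u" for G T
    by (rule weightI) (simp only: that(2) boxed_boxmono[OF that(1)])
  show "weight S 1 (\<lambda>u. u $ 1)"
    by (rule *[of "\<lambda>(i, j, k, l, m). (Suc i, j, k, l, m)"]) (auto simp: box_def)
  show "weight S 1 (\<lambda>u. u $ 2)"
    by (rule *[of "\<lambda>(i, j, k, l, m). (i, Suc j, k, l, m)"]) (auto simp: box_def)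
  show "weight S 1 (\<lambda>u. u $ 4)"
    by (rule *[of "\<lambda>(i, j, k, l, m). (i, j, Suc k, l, m)"]) (auto simp: box_def)
  show "weight S 1 (\<lambda>u. u $ 5)"
    by (rule *[of "\<lambda>(i, j, k, l, m). (i, j, k, Suc l, m)"]) (auto simp: box_def)
qed

text \<open>As the equation contains \<open>- d * u\<^sub>3\<^sup>3\<close> and is of degree at most 2 in \<open>u\<^sub>3\<close> otherwise, it reduces
  the degree in \<open>u\<^sub>3\<close> to at most 2.\<close>

lemma weight_coord_3:
  assumes "d \<noteq> 0"
  shows "weight {u. MA_poly d a b c u = 0} 2 (\<lambda>u. u $ 3)" (is "weight ?S _ _")
proof (rule weightI)
  fix n x assume "x \<in> box n"
  then obtain i j k l m where x: "x = (i, j, k, l, m)" "i \<le> n" "j \<le> n" "k \<le> n" "l \<le> n" "m \<le> 2"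
    by (auto simp: box_def)
  show "boxed ?S (n + 2) (\<lambda>u. u $ 3 * boxmono x u)"
  proof (cases "m = 2")
    case False
    then have "(i, j, k, l, Suc m) \<in> box (n + 2)" using x by (auto simp: box_def)
    from boxed_boxmono[OF this] show ?thesis by (rule boxed_cong) (simp add: x mult_ac)
  next
    case True
    let ?m = "\<lambda>i' j' k' l'. boxmono (i + i', j + j', k + k', l + l', 0)"
    let ?m1 = "\<lambda>i' j' k' l'. boxmono (i + i', j + j', k + k', l + l', 1)"
    let ?m2 = "\<lambda>i' j' k' l'. boxmono (i + i', j + j', k + k', l + l', 2)"
    let ?F = "\<lambda>u. ?m1 1 0 0 1 u + 2 * ?m1 0 1 1 0 u - ?m 1 0 2 0 u - ?m 0 2 0 1 u
      + 1 / d * (a 1 * (?m1 1 0 0 0 u - ?m 0 2 0 0 u) + a 2 * (?m 1 0 1 0 u - ?m1 0 1 0 0 u)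
        + a 3 * (?m 1 0 0 1 u - ?m2 0 0 0 0 u) + a 4 * (?m 0 1 1 0 u - ?m2 0 0 0 0 u)
        + a 5 * (?m 0 1 0 1 u - ?m1 0 0 1 0 u) + a 6 * (?m1 0 0 0 1 u - ?m 0 0 2 0 u)
        + b 1 * ?m 1 0 0 0 u + b 2 * ?m 0 1 0 0 u + b 3 * ?m1 0 0 0 0 u + b 4 * ?m 0 0 1 0 u
        + b 5 * ?m 0 0 0 1 u + c * ?m 0 0 0 0 u)"
    have "boxed ?S (n + 2) ?F"
      by (intro boxed_add boxed_diff boxed_cmult boxed_boxmono) (use x in \<open>auto simp: box_def\<close>)
    then show ?thesis
    proof (rule boxed_cong)
      fix u assume "u \<in> ?S"
      then have h: "MAf d a b c (u$1) (u$2) (u$3) (u$4) (u$5) = 0" by (simp add: MA_poly_eq)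
      define M where "M = u$1 ^ i * u$2 ^ j * u$4 ^ k * u$5 ^ l"
      have d: "d * (X + 1 / d * Y) = d * X + Y" for X Y
        using assms by (simp add: distrib_left)
      have "d * ?F u = d * (u $ 3 * boxmono x u) + M * MAf d a b c (u$1) (u$2) (u$3) (u$4) (u$5)"
        unfolding d x(1) True MAf_def M_def boxmono.simps power_add power_0 power_one_right mult_1_right
          power2_eq_square
        by algebra
      then show "?F u = u $ 3 * boxmono x u" unfolding h using assms by simp
    qed
  qed
qed

lemma weight_mpoly_chart:
  assumes "d \<noteq> 0" "f \<in> mpoly_fun"
  shows "\<exists>D. weight {u. MA_poly d a b c u = 0} D (\<lambda>u. f (chart u))" (is "\<exists>D. weight ?S _ _")
  using assms(2)
proof induction
  case (const k)
  show ?case using weight_const by blast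
next
  case (coord i j)
  note w = weight_coord[of ?S] weight_coord_3[OF assms(1), of a b c] weight_const[of ?S]
  have neg: "\<exists>D. weight ?S D (\<lambda>u. - F u)" if "weight ?S D F" for D F
    using weight_mult[OF weight_const[of ?S "-1"] that] by auto
  have "\<forall>i. \<exists>D. weight ?S D (\<lambda>u. xpt u $ i)"
    unfolding forall_6 xpt_nth using w by blast
  moreover have "\<forall>i. \<exists>D. weight ?S D (\<lambda>u. zpt u $ i)"
    unfolding forall_6 zpt_nth using w neg by blast
  ultimately obtain Dx Dz where D: "\<And>i. weight ?S (Dx i) (\<lambda>u. xpt u $ i)" "\<And>i. weight ?S (Dz i) (\<lambda>u. zpt u $ i)"
    by metis
  have "weight ?S (Dx i + Dz j + (0 + (Dx j + Dz i))) (\<lambda>u. xpt u $ i * zpt u $ j + -1 * (xpt u $ j * zpt u $ i))"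
    by (intro weight_add weight_mult D weight_const)
  then show ?case by (auto simp: chart_def)
next
  case (add f g)
  then show ?case using weight_add by blast
next
  case (mult f g)
  then show ?case using weight_mult by blast
qed

text \<open>Six forms of the same degree are dependent on the congruence: there are \<open>(k + 1)\<^sup>5\<close> monomials with
  exponents up to \<open>k\<close>, but the functions that they define on the hypersurface span a space whose
  dimension is of order \<open>k\<^sup>4\<close>.\<close>

lemma forms_dependent:
  assumes "d \<noteq> 0" "\<And>i. i \<le> 5 \<Longrightarrow> form e (f i)"
  shows "\<exists>k c'. (\<exists>m\<in>PiE {1..5} (\<lambda>_. {..k}). c' m \<noteq> 0) \<and>
    (\<forall>p\<in>MA_points d a b c.
      (\<Sum>m\<in>PiE {1..5} (\<lambda>_. {..k}). c' m * fmono 5 (5 * k) f m p) = 0)"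
proof -
  let ?S = "{u. MA_poly d a b c u = 0}"
  have "\<forall>i. \<exists>D. i \<le> 5 \<longrightarrow> weight ?S D (\<lambda>u. f i (chart u))"
    using weight_mpoly_chart[OF assms(1) form_mpoly[OF assms(2)]] by blast
  then obtain Ds where Ds: "\<And>i. i \<le> (5::nat) \<Longrightarrow> weight ?S (Ds i) (\<lambda>u. f i (chart u))" by metis
  define D where "D = (\<Sum>i\<le>5. Ds i)"
  have D: "weight ?S D (\<lambda>u. f i (chart u))" if "i \<le> 5" for i
    using Ds[OF that] by (rule weight_le) (use that in \<open>auto simp: D_def intro: member_le_sum\<close>)
  \<comment> \<open>Chosen such that \<open>3 * ((5 * D + 1) * k) ^ 4 = k ^ 5\<close>.\<close>
  define k where "k = 3 * (5 * D + 1) ^ 4"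
  define J where "J = PiE {1..5::nat} (\<lambda>_. {..k})"
  define N where "N = D * (5 * k)"
  have finJ: "finite J" unfolding J_def by (intro finite_PiE) auto
  have "card J = (k + 1) ^ 5" unfolding J_def by (subst card_PiE) auto
  moreover have "card (box N) < (k + 1) ^ 5"
  proof -
    have "k \<ge> 1" unfolding k_def by simp
    then have "N + 1 \<le> (5 * D + 1) * k" by (simp add: N_def algebra_simps)
    then have "(N + 1) ^ 4 \<le> ((5 * D + 1) * k) ^ 4" by (intro power_mono) auto
    then have "card (box N) \<le> 3 * ((5 * D + 1) * k) ^ 4" unfolding card_box by simp
    also have "\<dots> = k * k ^ 4" by (simp only: power_mult_distrib k_def mult.assoc)
    also have "\<dots> = k ^ 5" by (simp add: eval_nat_numeral)
    also have "\<dots> < (k + 1) ^ 5" by (intro power_strict_mono) auto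
    finally show ?thesis .
  qed
  ultimately have card: "card (box N) < card J" by simp
  have "boxed ?S N (\<lambda>u. fmono 5 (5 * k) f m (chart u))" if "m \<in> J" for m
  proof -
    have le: "(\<Sum>i\<in>{1..5}. m i) \<le> 5 * k" using fmono_exponent_le that unfolding J_def by blast
    have "weight ?S (D * (5 * k - (\<Sum>i\<in>{1..5}. m i)) + (\<Sum>i\<in>{1..5}. D * m i))
        (\<lambda>u. fmono 5 (5 * k) f m (chart u))"
      unfolding fmono_def by (intro weight_mult weight_power weight_prod D) auto
    also have "D * (5 * k - (\<Sum>i\<in>{1..5}. m i)) + (\<Sum>i\<in>{1..5}. D * m i) = N"
      unfolding N_def using le by (simp flip: sum_distrib_left distrib_left)
    finally have w: "weight ?S N (\<lambda>u. fmono 5 (5 * k) f m (chart u))" .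
    have "boxed ?S 0 (boxmono (0, 0, 0, 0, 0))" by (rule boxed_boxmono) (simp add: box_def)
    then have "boxed ?S (0 + N) (\<lambda>u. fmono 5 (5 * k) f m (chart u) * boxmono (0, 0, 0, 0, 0) u)"
      using w unfolding weight_def by blast
    then show ?thesis by simp
  qed
  then have "\<forall>m\<in>J. \<exists>C. \<forall>u\<in>?S. fmono 5 (5 * k) f m (chart u) = (\<Sum>i\<in>box N. C i * boxmono i u)"
    unfolding boxed_def by (rule ballI)
  from bchoice[OF this] obtain C where C': "\<forall>m\<in>J. \<forall>u\<in>?S.
      fmono 5 (5 * k) f m (chart u) = (\<Sum>i\<in>box N. C m i * boxmono i u)" ..
  have C: "fmono 5 (5 * k) f m (chart u) = (\<Sum>i\<in>box N. C m i * boxmono i u)"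
    if "m \<in> J" "u \<in> ?S" for m u using bspec[OF bspec[OF C' that(1)] that(2)] .
  obtain c' where c': "\<exists>m\<in>J. c' m \<noteq> 0" "\<And>i. i \<in> box N \<Longrightarrow> (\<Sum>m\<in>J. c' m * C m i) = 0"
    using homogeneous_system_solution[OF finite_box finJ card, of "\<lambda>i m. C m i"] by blast
  define R where "R = (\<lambda>p. \<Sum>m\<in>J. c' m * fmono 5 (5 * k) f m p)"
  have R0: "R (chart u) = 0" if "u \<in> ?S" for u
  proof -
    have "R (chart u) = (\<Sum>m\<in>J. \<Sum>i\<in>box N. c' m * C m i * boxmono i u)"
      unfolding R_def by (intro sum.cong refl) (simp only: C that sum_distrib_left mult.assoc)
    also have "\<dots> = (\<Sum>i\<in>box N. \<Sum>m\<in>J. c' m * C m i * boxmono i u)" by (rule sum.swap)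
    also have "\<dots> = (\<Sum>i\<in>box N. (\<Sum>m\<in>J. c' m * C m i) * boxmono i u)"
      by (simp only: sum_distrib_right)
    also have "\<dots> = 0" by (intro sum.neutral ballI) (simp only: c'(2) mult_zero_left)
    finally show ?thesis .
  qed
  have "form (e * (5 * k)) R"
    unfolding R_def J_def by (rule form_relation) (use assms(2) in auto)
  from form_scale[OF this] R0 have "R (scal \<kappa> (chart u)) = 0" if "u \<in> ?S" for \<kappa> u
    using that by (simp only: mult_zero_right)
  then have "\<forall>p\<in>MA_points d a b c. R p = 0"
    by blast
  then show ?thesis using c'(1) unfolding R_def J_def by (intro exI conjI)
qed

text \<open>The equation is linear in \<open>u\<^sub>1\<close>; this is the coefficient.\<close>

definition MA_coeff1 :: "complex \<Rightarrow> (nat \<Rightarrow> complex) \<Rightarrow> (nat \<Rightarrow> complex) \<Rightarrow>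
    complex \<Rightarrow> complex \<Rightarrow> complex \<Rightarrow> complex" where
  "MA_coeff1 d a b u3 u4 u5 = d * (u3 * u5 - u4 * u4) + a 1 * u3 + a 2 * u4 + a 3 * u5 + b 1"

lemma MAf_linear:
  "MAf d a b c u1 u2 u3 u4 u5 = u1 * MA_coeff1 d a b u3 u4 u5 + MAf d a b c 0 u2 u3 u4 u5"
  unfolding MAf_def MA_coeff1_def by algebra

text \<open>Linear slices, of dimension \<open>j\<close>, of the part of the hypersurface where the equation can be
  solved for \<open>u\<^sub>1\<close>.\<close>

definition slice :: "complex \<Rightarrow> (nat \<Rightarrow> complex) \<Rightarrow> (nat \<Rightarrow> complex) \<Rightarrow> complex \<Rightarrow> complex \<Rightarrow> nat \<Rightarrow>
    (complex^6) set" where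
  "slice d a b c w j = {u. u $ 0 = 1 \<and> MA_poly d a b c u = 0 \<and> MA_coeff1 d a b (u$3) (u$4) (u$5) \<noteq> 0 \<and>
     (j < 1 \<longrightarrow> u $ 2 = 0) \<and> (j < 2 \<longrightarrow> u $ 3 = 0) \<and> (j < 3 \<longrightarrow> u $ 4 = w) \<and> (j < 4 \<longrightarrow> u $ 5 = 0)}"

text \<open>The representatives of the corresponding lines.\<close>

definition slice_lines :: "complex \<Rightarrow> (nat \<Rightarrow> complex) \<Rightarrow> (nat \<Rightarrow> complex) \<Rightarrow> complex \<Rightarrow> complex \<Rightarrow> nat \<Rightarrow>
    (complex^6^6) set" where
  "slice_lines d a b c w j = {scal k (chart u) | k u. k \<noteq> 0 \<and> u \<in> slice d a b c w j}"

lemma slice_linesI: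
  assumes "k \<noteq> 0" "u \<in> slice d a b c w j"
  shows "scal k (chart u) \<in> slice_lines d a b c w j"
  unfolding slice_lines_def mem_Collect_eq using assms by (intro exI[of _ k] exI[of _ u]) simp

lemma chart_P14: "k \<noteq> 0 \<Longrightarrow> scal k (chart u) \<in> P14"
  using P14_scale[OF wedge_P14[OF chart_nonzero[unfolded chart_def]]] by (simp only: chart_def)

lemma slice_lines_P14: "slice_lines d a b c w j \<subseteq> P14"
  using chart_P14 unfolding slice_lines_def by blast

lemma slice_point:
  assumes "MA_coeff1 d a b u3 u4 u5 \<noteq> 0"
  obtains u :: "complex^6" where "u $ 0 = 1" "u $ 2 = u2" "u $ 3 = u3" "u $ 4 = u4" "u $ 5 = u5"
    "u $ 1 = - MAf d a b c 0 u2 u3 u4 u5 / MA_coeff1 d a b u3 u4 u5" "MA_poly d a b c u = 0"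
proof -
  define u :: "complex^6" where "u = (\<chi> i. if i = 0 then 1
    else if i = 1 then - MAf d a b c 0 u2 u3 u4 u5 / MA_coeff1 d a b u3 u4 u5
    else if i = 2 then u2 else if i = 3 then u3 else if i = 4 then u4 else u5)"
  have n: "u $ 0 = 1" "u $ 2 = u2" "u $ 3 = u3" "u $ 4 = u4" "u $ 5 = u5"
    "u $ 1 = - MAf d a b c 0 u2 u3 u4 u5 / MA_coeff1 d a b u3 u4 u5"
    by (simp_all add: u_def)
  moreover have "MA_poly d a b c u = 0"
    unfolding MA_poly_eq n MAf_linear[of _ _ _ _ "_ / _"] using assms by simp
  ultimately show thesis by (rule that)
qed

text \<open>Two points of a slice are joined by the graph, over the complex line through their projections, of the
  rational function that gives \<open>u\<^sub>1\<close>; the denominator is cleared in the coordinates of the lines.\<close>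

lemma irreducible_slice_lines:
  assumes "slice d a b c w j \<noteq> {}"
  shows "irreducible_in zariski (slice_lines d a b c w j)" (is "irreducible_in _ ?Y")
proof (rule irreducible_joined)
  show "?Y \<subseteq> topspace zariski" using slice_lines_P14 by (simp add: topspace_zariski)
  obtain u0 where "u0 \<in> slice d a b c w j" using assms by blast
  then have "scal 1 (chart u0) \<in> ?Y" by (intro slice_linesI) simp_all
  then show "?Y \<noteq> {}" by blast
  fix p p' assume "p \<in> ?Y" "p' \<in> ?Y"
  then obtain k u k' u' where
    k: "k \<noteq> 0" "u \<in> slice d a b c w j" "p = scal k (chart u)" and
    k': "k' \<noteq> 0" "u' \<in> slice d a b c w j" "p' = scal k' (chart u')"
    unfolding slice_lines_def by blast
  define U where "U = (\<lambda>i t. u $ i + t * (u' $ i - u $ i))"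
  define C where "C = (\<lambda>t. MA_coeff1 d a b (U 3 t) (U 4 t) (U 5 t))"
  define N where "N = (\<lambda>t. - MAf d a b c 0 (U 2 t) (U 3 t) (U 4 t) (U 5 t))"
  define X where "X = (\<lambda>t. (\<chi> i. if i = 0 then C t else if i = 1 then N t else if i = 5 then 0
      else C t * U i t) :: complex^6)"
  define Z where "Z = (\<lambda>t. (\<chi> i. if i = 0 then 0 else if i = 5 then 1 else - U (i + 1) t) :: complex^6)"
  \<comment> \<open>The scalar interpolates so that the curve passes through the given representatives.\<close>
  define K where "K = (\<lambda>t. k / C 0 + t * (k' / C 1 - k / C 0))"
  define \<psi> where "\<psi> = (\<lambda>t. scal (K t) (wedge (X t) (Z t)))"
  have U: "polyc (U i)" for i unfolding U_def by (rule polyc_linear)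
  have C: "polyc C" unfolding C_def MA_coeff1_def by (intro polyc_intros U)
  have N: "polyc N" unfolding N_def MAf_def by (intro polyc_intros U)
  have X: "polyc (\<lambda>t. X t $ i)" for i
    unfolding X_def vec_lambda_beta
    by (cases "i = 0"; cases "i = 1"; cases "i = 5") (simp_all add: polyc_const polyc_mult U C N)
  have Z: "polyc (\<lambda>t. Z t $ i)" for i
    unfolding Z_def vec_lambda_beta
    by (cases "i = 0"; cases "i = 5") (simp_all add: polyc_const polyc_uminus U)
  have K: "polyc K" unfolding K_def by (rule polyc_linear)
  have \<psi>: "polyc (\<lambda>t. \<psi> t $ i $ j)" for i j
    unfolding \<psi>_def vec_lambda_beta wedge_nth by (intro polyc_intros K X Z)
  have U01: "U i 0 = u $ i" "U i 1 = u' $ i" for i by (simp_all add: U_def)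
  have C01: "C 0 \<noteq> 0" "C 1 \<noteq> 0" using k(2) k'(2) by (simp_all add: C_def U01 slice_def)
  have K01: "K 0 = k / C 0" "K 1 = k' / C 1" by (simp_all add: K_def)
  define T where "T = {t. K t * C t \<noteq> 0}"
  have \<psi>_chart: "\<psi> t = scal (K t * C t) (chart v)"
    if "C t \<noteq> 0" "v $ 0 = 1" "v $ 1 = N t / C t" "v $ 2 = U 2 t" "v $ 3 = U 3 t" "v $ 4 = U 4 t" "v $ 5 = U 5 t"
    for t v
  proof -
    have "\<forall>i. X t $ i = C t * xpt v $ i" unfolding forall_6 using that by (simp add: X_def)
    moreover have "\<forall>i. Z t $ i = zpt v $ i" unfolding forall_6 using that by (simp add: Z_def)
    ultimately show ?thesis
      unfolding \<psi>_def chart_def by (simp add: vec_eq_iff algebra_simps)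
  qed
  have T: "\<psi> ` T \<subseteq> ?Y"
  proof (rule image_subsetI)
    fix t assume "t \<in> T"
    then have nz: "K t * C t \<noteq> 0" "C t \<noteq> 0" by (simp_all add: T_def)
    obtain v where v: "v $ 0 = 1" "v $ 2 = U 2 t" "v $ 3 = U 3 t" "v $ 4 = U 4 t" "v $ 5 = U 5 t"
      "v $ 1 = N t / C t" "MA_poly d a b c v = 0"
      unfolding N_def C_def by (rule slice_point[OF nz(2)[unfolded C_def], of "U 2 t" c])
    have "v \<in> slice d a b c w j"
      using k(2) k'(2) nz(2) v unfolding slice_def C_def by (simp add: U_def)
    moreover have "\<psi> t = scal (K t * C t) (chart v)" by (rule \<psi>_chart) (use nz v in simp_all)
    ultimately show "\<psi> t \<in> ?Y" using nz(1) slice_linesI by simp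
  qed
  have end1: "v $ 1 = N t / C t" if "MA_poly d a b c v = 0" "C t \<noteq> 0"
    "v $ 2 = U 2 t" "v $ 3 = U 3 t" "v $ 4 = U 4 t" "v $ 5 = U 5 t" for v t
  proof -
    have "v $ 1 * C t - N t = 0"
      using that(1) unfolding MA_poly_eq MAf_linear[of _ _ _ _ "v $ 1"] by (simp add: C_def N_def that)
    then show ?thesis using that(2) by (simp add: field_simps)
  qed
  have "\<psi> 0 = scal (K 0 * C 0) (chart u)"
    by (rule \<psi>_chart, rule C01, use k(2) in \<open>simp add: slice_def\<close>, rule end1)
      (use k(2) C01 in \<open>simp_all add: slice_def U01\<close>)
  then have "\<psi> 0 = p" using C01 by (simp add: K01 k(3))
  have "\<psi> 1 = scal (K 1 * C 1) (chart u')"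
    by (rule \<psi>_chart, rule C01, use k'(2) in \<open>simp add: slice_def\<close>, rule end1)
      (use k'(2) C01 in \<open>simp_all add: slice_def U01\<close>)
  then have "\<psi> 1 = p'" using C01 by (simp add: K01 k'(3))
  have "0 \<in> T" "1 \<in> T" using C01 k(1) k'(1) by (simp_all add: T_def K01)
  then have mem: "p \<in> \<psi> ` T" "p' \<in> \<psi> ` T"
    using \<open>\<psi> 0 = p\<close> \<open>\<psi> 1 = p'\<close> by (metis image_eqI)+
  have "finite (- T)"
    using polyc_finite_zeros[OF polyc_mult[OF K C], of 0] C01 k(1) by (simp add: T_def K01 Compl_eq)
  then have "irreducible_in zariski (\<psi> ` T)"
    using \<psi> T slice_lines_P14 unfolding polyc_def by (intro irreducible_curve) blast+
  then show "\<exists>I\<subseteq>?Y. irreducible_in zariski I \<and> p \<in> I \<and> p' \<in> I" using T mem by blast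
qed

text \<open>The slices are nested and consecutive ones are separated by the linear form that fixes one more
  coordinate.\<close>

lemma slice_chain:
  fixes a b :: "nat \<Rightarrow> complex" and c d :: complex
  assumes "d \<noteq> 0"
  defines "A \<equiv> MA_points d a b c"
  shows "\<exists>Z. irreducible_chain zariski (zariski closure_of A) 4 Z"
proof -
  have pc: "polyc (\<lambda>t. MA_coeff1 d a b (F t) (G t) (H t))" if "polyc F" "polyc G" "polyc H" for F G H
    unfolding MA_coeff1_def by (intro polyc_intros that)
  have id: "polyc (\<lambda>t. t)" using polyc_linear[of 0 1] by simp
  have "\<exists>w. MA_coeff1 d a b 0 w 0 \<noteq> 0"
  proof (rule ccontr)
    assume n: "\<nexists>w. MA_coeff1 d a b 0 w 0 \<noteq> 0"
    have "poly [:b 1, a 2, - d:] w = MA_coeff1 d a b 0 w 0" for w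
      by (simp add: MA_coeff1_def algebra_simps)
    then have "\<forall>w. poly [:b 1, a 2, - d:] w = 0" using n by simp
    then have "[:b 1, a 2, - d:] = 0" by (simp only: poly_all_0_iff_0)
    then show False using assms(1) by simp
  qed
  then obtain w where w: "MA_coeff1 d a b 0 w 0 \<noteq> 0" by blast
  let ?s = "slice d a b c w"
  let ?Y = "slice_lines d a b c w"
  have mono: "?s i \<subseteq> ?s j" if "i \<le> j" for i j using that by (auto simp: slice_def)
  have YA: "?Y j \<subseteq> A" for j unfolding slice_lines_def A_def slice_def by blast
  have AP: "A \<subseteq> P14" unfolding A_def using chart_P14 by blast
  obtain u0 where "u0 $ 0 = 1" "u0 $ 2 = 0" "u0 $ 3 = 0" "u0 $ 4 = w" "u0 $ 5 = 0" "MA_poly d a b c u0 = 0"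
    by (rule slice_point[OF w, of 0 c])
  then have "u0 \<in> ?s 0" using w by (simp add: slice_def)
  then have ne: "?s j \<noteq> {}" for j using mono[of 0 j] by blast
  have strict: "\<not> zariski closure_of ?Y (Suc j) \<subseteq> zariski closure_of ?Y j"
    if f: "form 1 f" "\<And>v. v \<in> ?s j \<Longrightarrow> f (chart v) = 0" and v: "v \<in> ?s (Suc j)" "f (chart v) \<noteq> 0" for f j v
  proof
    assume sub: "zariski closure_of ?Y (Suc j) \<subseteq> zariski closure_of ?Y j"
    have "scal 1 (chart v) \<in> ?Y (Suc j)" using v(1) by (intro slice_linesI) simp_all
    then have "scal 1 (chart v) \<in> zariski closure_of ?Y j"
      using subset_zariski_closure[OF slice_lines_P14] sub by blast
    then have "f (scal 1 (chart v)) = 0"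
    proof (rule in_zariski_closure[OF _ f(1)])
      fix x assume "x \<in> ?Y j"
      then obtain k v' where "x = scal k (chart v')" "v' \<in> ?s j" unfolding slice_lines_def by blast
      then show "f x = 0" using form_scale[OF f(1), of k "chart v'"] f(2) by simp
    qed
    then show False using v(2) form_scale[OF f(1), of 1 "chart v"] by simp
  qed
  have s0: "\<not> zariski closure_of ?Y (Suc 0) \<subseteq> zariski closure_of ?Y 0"
  proof -
    obtain v where "v $ 0 = 1" "v $ 2 = 1" "v $ 3 = 0" "v $ 4 = w" "v $ 5 = 0" "MA_poly d a b c v = 0"
      by (rule slice_point[OF w, of 1 c])
    then show ?thesis
      by (intro strict[of "\<lambda>p. p $ 2 $ 5" _ v] form_coord) (use w in \<open>simp_all add: slice_def chart_def\<close>)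
  qed
  have s1: "\<not> zariski closure_of ?Y (Suc 1) \<subseteq> zariski closure_of ?Y 1"
  proof -
    obtain t where t: "t \<noteq> 0" "MA_coeff1 d a b t w 0 \<noteq> 0"
      using polyc_nonzero_elsewhere[OF pc[OF id polyc_const polyc_const], of 0 w 0 0] w by blast
    obtain v where "v $ 0 = 1" "v $ 2 = 0" "v $ 3 = t" "v $ 4 = w" "v $ 5 = 0" "MA_poly d a b c v = 0"
      by (rule slice_point[OF t(2), of 0 c])
    then show ?thesis
      by (intro strict[of "\<lambda>p. p $ 3 $ 5" _ v] form_coord) (use t in \<open>simp_all add: slice_def chart_def\<close>)
  qed
  have s2: "\<not> zariski closure_of ?Y (Suc 2) \<subseteq> zariski closure_of ?Y 2"
  proof -
    obtain t where t: "t \<noteq> w" "MA_coeff1 d a b 0 t 0 \<noteq> 0"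
      using polyc_nonzero_elsewhere[OF pc[OF polyc_const id polyc_const], of 0 w 0 w] w by blast
    obtain v where "v $ 0 = 1" "v $ 2 = 0" "v $ 3 = 0" "v $ 4 = t" "v $ 5 = 0" "MA_poly d a b c v = 0"
      by (rule slice_point[OF t(2), of 0 c])
    moreover have "form 1 (\<lambda>p. p $ 4 $ 5 - w * p $ 0 $ 5)"
      by (intro form_diff form_cmult form_coord)
    ultimately show ?thesis
      by (intro strict[of "\<lambda>p. p $ 4 $ 5 - w * p $ 0 $ 5" _ v]) (use t in \<open>simp_all add: slice_def chart_def\<close>)
  qed
  have s3: "\<not> zariski closure_of ?Y (Suc 3) \<subseteq> zariski closure_of ?Y 3"
  proof -
    obtain t where t: "t \<noteq> 0" "MA_coeff1 d a b 0 w t \<noteq> 0"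
      using polyc_nonzero_elsewhere[OF pc[OF polyc_const polyc_const id], of 0 w 0 0] w by blast
    obtain v where "v $ 0 = 1" "v $ 2 = 0" "v $ 3 = 0" "v $ 4 = w" "v $ 5 = t" "MA_poly d a b c v = 0"
      by (rule slice_point[OF t(2), of 0 c])
    then show ?thesis
      by (intro strict[of "\<lambda>p. p $ 0 $ 4" _ v] form_coord) (use t in \<open>simp_all add: slice_def chart_def\<close>)
  qed
  have ss: "zariski closure_of ?Y i \<subset> zariski closure_of ?Y (Suc i)" if "i < 4" for i
  proof -
    have "?Y i \<subseteq> ?Y (Suc i)"
    proof
      fix x assume "x \<in> ?Y i"
      then obtain k u where "x = scal k (chart u)" "k \<noteq> 0" "u \<in> ?s i" unfolding slice_lines_def by blast
      then show "x \<in> ?Y (Suc i)" using mono[of i "Suc i"] by (auto intro!: slice_linesI)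
    qed
    then have "zariski closure_of ?Y i \<subseteq> zariski closure_of ?Y (Suc i)" by (rule closure_of_mono)
    moreover have "i = 0 \<or> i = 1 \<or> i = 2 \<or> i = 3" using that by linarith
    then have "\<not> zariski closure_of ?Y (Suc i) \<subseteq> zariski closure_of ?Y i"
      using s0 s1 s2 s3 by metis
    ultimately show ?thesis by blast
  qed
  have "closedin (subtopology zariski (zariski closure_of A)) (zariski closure_of ?Y i)" for i
    unfolding closedin_subtopology
    by (intro exI[of _ "zariski closure_of ?Y i"] conjI closedin_closure_of)
      (use closure_of_mono[OF YA] in blast)
  then have "irreducible_chain zariski (zariski closure_of A) 4 (\<lambda>i. zariski closure_of ?Y i)"
    unfolding irreducible_chain_def
    using ss irreducible_closure[OF irreducible_slice_lines[OF ne]] by blast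
  then show ?thesis by blast
qed

lemma MA_lines_cone: "cone {scal k (chart u) | k u. k \<noteq> 0 \<and> u $ 0 = 1 \<and> P u}"
  unfolding cone_def
proof (intro conjI ballI allI impI)
  show "{scal k (chart u) | k u. k \<noteq> 0 \<and> u $ 0 = 1 \<and> P u} \<subseteq> P14" using chart_P14 by blast
  fix p l assume p: "p \<in> {scal k (chart u) | k u. k \<noteq> 0 \<and> u $ 0 = 1 \<and> P u}" and l: "l \<noteq> (0::complex)"
  then obtain k u where ku: "p = scal k (chart u)" "k \<noteq> 0" "u $ 0 = 1" "P u" by blast
  have "scal l p = scal (l * k) (chart u)" unfolding ku(1) by (simp add: vec_eq_iff mult_ac)
  moreover have "l * k \<noteq> 0" using l ku by simp
  ultimately show "scal l p \<in> {scal k (chart u) | k u. k \<noteq> 0 \<and> u $ 0 = 1 \<and> P u}" using ku by blast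
qed

lemma B_MA_closure:
  "B_MA d a b c = zariski closure_of MA_points d a b c"
  unfolding B_MA_def pluecker_MA_lines ..

lemma cone_B_MA: "cone (B_MA d a b c)"
  unfolding B_MA_closure by (intro cone_closure MA_lines_cone)

lemma B_MA_Gam: "B_MA d a b c \<subseteq> Gam"
  unfolding B_MA_closure
  by (rule closure_of_minimal[OF _ closedin_Gam]) (use Gam_chart in blast)

lemma B_MA_quadrics:
  assumes "p \<in> B_MA d a b c"
  shows "MA_quadric d a b c p = 0" "MA_quadric2 d a b c p = 0"
proof -
  have *: "MA_quadric d a b c x = 0 \<and> MA_quadric2 d a b c x = 0"
    if "x \<in> MA_points d a b c" for x
  proof -
    from that obtain k u where "x = scal k (chart u)" "u $ 0 = 1" "MA_poly d a b c u = 0" by blast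
    then show ?thesis
      using form_scale[OF form_MA_quadric(1), of d a b c k "chart u"]
        form_scale[OF form_MA_quadric(2), of d a b c k "chart u"] by (simp add: MA_quadric_chart)
  qed
  show "MA_quadric d a b c p = 0"
    using in_zariski_closure[OF assms[unfolded B_MA_closure] form_MA_quadric(1)] * by blast
  show "MA_quadric2 d a b c p = 0"
    using in_zariski_closure[OF assms[unfolded B_MA_closure] form_MA_quadric(2)] * by blast
qed

lemma congruence_B_MA:
  assumes "d \<noteq> 0"
  shows "congruence (B_MA d a b c)"
  unfolding congruence_def
proof (intro conjI)
  show "closedin zariski (B_MA d a b c)" unfolding B_MA_closure by simp
  show "B_MA d a b c \<subseteq> grassmannian" using B_MA_Gam by (auto simp: Gam_def)
  have "m \<le> 4" if "irreducible_chain zariski (B_MA d a b c) m Z" for m Z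
  proof -
    have "m < 5" by (rule chain_length_bound[OF that[unfolded B_MA_closure] forms_dependent[OF assms]])
    then show ?thesis by simp
  qed
  then show "has_dim zariski (B_MA d a b c) 4"
    unfolding has_dim_def using slice_chain[OF assms, of a b c, folded B_MA_closure] by (intro conjI allI impI)
qed

lemma B_MA_residual_congruence:
  assumes "d \<noteq> 0"
  shows "\<exists>Q B. quadric Q \<and> G1L \<union> B'' \<subseteq> Q \<and> B = residual (G1L \<union> B'') (Gam \<inter> Q) \<and>
            congruence B \<and> B_MA d a b c = B"
proof -
  have "G1L \<union> B'' \<subseteq> {p \<in> P14. MA_quadric d a b c p = 0}"
    unfolding infinity_eq[symmetric] using Gam_P14 MA_quadric_infinity by blast
  then show ?thesis
    using quadric_MA_quadric[OF assms] congruence_B_MA[OF assms, of a b c] B_MA_residual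
    by (intro exI[of _ "{p \<in> P14. MA_quadric d a b c p = 0}"] exI[of _ "B_MA d a b c"] conjI refl)
qed

section \<open>The lines of the congruence\<close>

text \<open>The coefficient of \<open>u\<^sub>1\<close> in the equation restricted to the points \<open>u\<close> whose lines contain
  the point \<open>(s : w\<^sub>1 : w\<^sub>2 : w\<^sub>3 : w\<^sub>4 : 1)\<close>; these points form an affine line with direction
  \<open>(1, s, s\<^sup>2, s\<^sup>3, s\<^sup>4)\<close>, a vector whose Hankel matrix has rank 1.\<close>

definition MA_slope :: "'a::idom \<Rightarrow> (nat \<Rightarrow> 'a) \<Rightarrow> (nat \<Rightarrow> 'a) \<Rightarrow> 'a \<Rightarrow> 'a \<Rightarrow> 'a \<Rightarrow> 'a \<Rightarrow> 'a \<Rightarrow> 'a" where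
  "MA_slope d a b s w1 w2 w3 w4 = (let c1 = w2 - s * w1; c2 = w3 - s * w2; c3 = w4 - s * w3 in
     d * (c1 * c3 - c2 * c2) - (a 1 * c1 + a 2 * (c2 + s * c1) + a 3 * (c3 + 2 * s * c2 + s * s * c1)
       + a 4 * (s * c2) + a 5 * (s * (c3 + s * c2)) + a 6 * (s * s * c3))
     + b 1 + b 2 * s + b 3 * (s * s) + b 4 * (s * s * s) + b 5 * (s * s * s * s))"

text \<open>The value of the equation at the point with \<open>u\<^sub>1 = 0\<close> of the same affine line.\<close>

definition MA_start :: "'a::idom \<Rightarrow> (nat \<Rightarrow> 'a) \<Rightarrow> (nat \<Rightarrow> 'a) \<Rightarrow> 'a \<Rightarrow> 'a \<Rightarrow> 'a \<Rightarrow> 'a \<Rightarrow> 'a \<Rightarrow> 'a \<Rightarrow> 'a" where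
  "MA_start d a b c s w1 w2 w3 w4 = MAf d a b c 0 (- w1) (- (s * w1 + w2)) (- (s * (s * w1 + w2) + w3))
     (- (s * (s * (s * w1 + w2) + w3) + w4))"

lemma MAf_through_point:
  fixes u1 :: "'a::idom"
  assumes "u2 = s * u1 - w1" "u3 = s * u2 - w2" "u4 = s * u3 - w3" "u5 = s * u4 - w4"
  shows "MAf d a b c u1 u2 u3 u4 u5 = MA_start d a b c s w1 w2 w3 w4 + u1 * MA_slope d a b s w1 w2 w3 w4"
  unfolding assms MA_start_def MA_slope_def MAf_def Let_def by algebra

text \<open>The same coefficient decides whether the second quadric contains the line at infinity through
  the point: this line is the limit of the lines of \<open>Gam\<close> through the point as \<open>u\<^sub>1\<close> tends to
  infinity.\<close>

lemma MA_quadric2_slope: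
  assumes "v $ 5 = 1"
  shows "MA_quadric2 d a b c (wedge (tcubic (v $ 0) 1) v) = MA_slope d a b (v$0) (v$1) (v$2) (v$3) (v$4)"
  unfolding MA_quadric2_def minor_form_def MA_slope_def Let_def wedge_nth tcubic_nth assms
    power_one mult_1_right mult_1_left mult_zero_left mult_zero_right
  by algebra

lemma tcubic_scale: "tcubic (k * s) (k * t) = k ^ 3 *s tcubic s t"
  by (simp add: vec_eq_iff forall_6 power2_eq_square power3_eq_cube)

lemma line_at_infinity_slope:
  assumes "x $ 0 \<noteq> 0 \<or> x $ 5 \<noteq> 0" "MA_quadric2 d a b c (wedge (tcubic (x $ 0) (x $ 5)) x) = 0"
    and "v \<in> vec.span {tcubic (x $ 0) (x $ 5), x}" "v $ 5 \<noteq> 0"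
  shows "MA_slope d a b (v$0 / v$5) (v$1 / v$5) (v$2 / v$5) (v$3 / v$5) (v$4 / v$5) = 0"
    and "tcubic (v $ 0) (v $ 5) \<in> vec.span {tcubic (x $ 0) (x $ 5), x}"
proof -
  obtain k l where v: "v = k *s tcubic (x $ 0) (x $ 5) + l *s x"
    using assms(3) unfolding span_pair by blast
  have v05: "v $ 0 = l * x $ 0" "v $ 5 = l * x $ 5" by (simp_all add: v)
  then have l: "l \<noteq> 0" using assms(4) by auto
  have tv: "tcubic (v $ 0) (v $ 5) = l ^ 3 *s tcubic (x $ 0) (x $ 5)"
    unfolding v05 tcubic_scale ..
  then show "tcubic (v $ 0) (v $ 5) \<in> vec.span {tcubic (x $ 0) (x $ 5), x}"
    by (simp add: vec.span_base vec.span_scale)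
  define y where "y = (1 / v $ 5) *s v"
  have y5: "y $ 5 = 1" using assms(4) by (simp add: y_def)
  have "tcubic (y $ 0) 1 = (1 / v $ 5) ^ 3 *s tcubic (v $ 0) (v $ 5)"
    unfolding tcubic_scale[symmetric] using assms(4) by (simp add: y_def)
  then have sc: "wedge (tcubic (y $ 0) 1) y = scal ((1 / v $ 5) ^ 4 * l ^ 4) (wedge (tcubic (x $ 0) (x $ 5)) x)"
    unfolding tv by (simp add: vec_eq_iff y_def v power3_eq_cube power4_eq_xxxx algebra_simps)
  have "MA_quadric2 d a b c (wedge (tcubic (y $ 0) 1) y) = 0"
    unfolding sc form_scale[OF form_MA_quadric(2)] assms(2) by simp
  then show "MA_slope d a b (v$0 / v$5) (v$1 / v$5) (v$2 / v$5) (v$3 / v$5) (v$4 / v$5) = 0"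
    unfolding MA_quadric2_slope[OF y5] by (simp add: y_def)
qed

lemma MA_line_in_congruence:
  assumes "u $ 0 = 1" "MA_poly d a b c u = 0"
  shows "MA_line u \<in> lines_of (B_MA d a b c)"
proof -
  let ?A = "MA_points d a b c"
  have mem: "scal 1 (chart u) \<in> ?A"
    unfolding mem_Collect_eq by (rule exI[of _ 1], rule exI[of _ u]) (use assms in simp)
  have "?A \<subseteq> P14"
    using MA_lines_cone[of "\<lambda>u. MA_poly d a b c u = 0"] unfolding cone_def by (rule conjunct1)
  from subsetD[OF subset_zariski_closure[OF this] mem] have "scal 1 (chart u) \<in> B_MA d a b c"
    unfolding B_MA_closure .
  then have "wedge (xpt u) (zpt u) \<in> B_MA d a b c" by (simp add: chart_def wedge_def)
  then show ?thesis
    unfolding MA_line_span[OF assms(1)]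
    using in_lines_of[OF cone_B_MA] chart_nonzero[of u] by (simp add: chart_def)
qed

lemma MA_line_inj:
  assumes "MA_line u = MA_line v" "u $ 0 = 1" "v $ 0 = 1"
  shows "u = v"
proof -
  have "xpt u \<in> MA_line u" "zpt u \<in> MA_line u"
    unfolding MA_line_span[OF assms(2)] by (auto intro: vec.span_base)
  then have "xpt u \<in> MA_line v" "zpt u \<in> MA_line v" using assms(1) by auto
  then show ?thesis unfolding MA_line_nth[OF assms(3)] using assms by (simp add: vec_eq_iff forall_6)
qed

text \<open>The closure may contain, besides the lines of the system, only lines at infinity that lie on the
  second quadric.\<close>

lemma congruence_line_cases:
  assumes "l \<in> lines_of (B_MA d a b c)"
  obtains (affine) u where "u $ 0 = 1" "MA_poly d a b c u = 0" "l = MA_line u"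
  | (inside) x y where "x \<in> L" "y \<in> L" "l = vec.span {x, y}" "wedge x y \<noteq> 0"
      "MA_quadric2 d a b c (wedge x y) = 0"
  | (pencil) x where "x $ 0 \<noteq> 0 \<or> x $ 5 \<noteq> 0" "l = vec.span {tcubic (x $ 0) (x $ 5), x}"
      "MA_quadric2 d a b c (wedge (tcubic (x $ 0) (x $ 5)) x) = 0"
proof -
  obtain x y where l: "l = vec.span {x, y}" "wedge x y \<noteq> 0" "wedge x y \<in> B_MA d a b c"
    by (rule lines_ofE[OF cone_B_MA assms])
  let ?p = "wedge x y"
  have G: "?p \<in> Gam" using l(3) B_MA_Gam by blast
  note q = B_MA_quadrics[OF l(3)]
  show thesis
  proof (cases "?p $ 0 $ 5 = 0")
    case False
    then obtain k u where ku: "k \<noteq> 0" "u $ 0 = 1" "?p = scal k (chart u)"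
      using G Gam_chart by blast
    have "k ^ 2 * MA_poly d a b c u = 0"
      using q(1) unfolding ku(3) form_scale[OF form_MA_quadric(1)] MA_quadric_chart[OF ku(2)] .
    then have "MA_poly d a b c u = 0" using ku(1) by simp
    moreover have "l = MA_line u"
      unfolding l(1) MA_line_span[OF ku(2)]
      using same_line_wedge[OF _ _ ku(1)] chart_nonzero[of u] ku(3) unfolding chart_def by blast
    ultimately show thesis by (rule affine[OF ku(2)])
  next
    case True
    show thesis
    proof (cases "?p \<in> G1L")
      case True
      then obtain x' y' where xy: "x' \<in> L" "y' \<in> L" "?p = wedge x' y'" unfolding G1L_iff by blast
      have "wedge x' y' \<noteq> 0" using xy(3) l(2) by simp
      moreover have "wedge x y = scal 1 (wedge x' y')" unfolding xy(3) by (simp add: wedge_def)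
      ultimately have "vec.span {x, y} = vec.span {x', y'}"
        using same_line_wedge[of x' y' x y 1] by simp
      then show thesis
        using inside[OF xy(1,2)] l(1) \<open>wedge x' y' \<noteq> 0\<close> q(2) unfolding xy(3) by blast
    next
      case False
      obtain k z where z: "k \<noteq> 0" "z $ 0 \<noteq> 0 \<or> z $ 5 \<noteq> 0"
        "?p = scal k (wedge (tcubic (z $ 0) (z $ 5)) z)"
        by (rule Gam_infinity[OF G True False])
      have "l = vec.span {tcubic (z $ 0) (z $ 5), z}"
        unfolding l(1) by (rule same_line_wedge[OF tcubic_wedge_nonzero[OF z(2)] z(3) z(1)])
      moreover have "k ^ 2 * MA_quadric2 d a b c (wedge (tcubic (z $ 0) (z $ 5)) z) = 0"
        using q(2) unfolding z(3) form_scale[OF form_MA_quadric(2)] .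
      then have "MA_quadric2 d a b c (wedge (tcubic (z $ 0) (z $ 5)) z) = 0" using z(1) by simp
      ultimately show thesis by (rule pencil[OF z(2)])
    qed
  qed
qed

section \<open>Cubic polynomials\<close>

text \<open>The discriminant of \<open>n0 + n1 * s + n2 * s\<^sup>2 + n3 * s\<^sup>3\<close>.\<close>

definition discr3 :: "complex \<Rightarrow> complex \<Rightarrow> complex \<Rightarrow> complex \<Rightarrow> complex" where
  "discr3 n0 n1 n2 n3 = n1 * n1 * (n2 * n2) - 4 * n3 * (n1 * n1 * n1) - 4 * (n2 * n2 * n2) * n0
     - 27 * (n3 * n3) * (n0 * n0) + 18 * n0 * n1 * n2 * n3"

lemma card_cubic_roots:
  fixes p :: "complex poly"
  assumes "degree p \<le> 3" "coeff p 3 \<noteq> 0" "discr3 (coeff p 0) (coeff p 1) (coeff p 2) (coeff p 3) \<noteq> 0"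
  shows "finite {s. poly p s = 0}" "card {s. poly p s = 0} = 3"
proof -
  have deg: "degree p = 3" using assms(1) le_degree[OF assms(2)] by simp
  then have "p \<noteq> 0" by auto
  from alg_closed_imp_factorization[OF this] obtain A where
    A: "size A = degree p" "p = smult (lead_coeff p) (\<Prod>x\<in>#A. [:-x, 1:])" by (elim exE conjE)
  define k where "k = coeff p 3"
  have A0: "size A = Suc (Suc (Suc 0))" using A(1) deg by simp
  from size_eq_Suc_imp_eq_union[OF A0] obtain x A1 where A1: "A = add_mset x A1" by blast
  then have "size A1 = Suc (Suc 0)" using A0 by simp
  from size_eq_Suc_imp_eq_union[OF this] obtain y A2 where A2: "A1 = add_mset y A2" by blast
  then have "size A2 = Suc 0" using \<open>size A1 = _\<close> by simp
  from size_eq_Suc_imp_eq_union[OF this] obtain z A3 where A3: "A2 = add_mset z A3" by blast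
  then have "A3 = {#}" using \<open>size A2 = _\<close> by simp
  then have xyz: "A = {#x, y, z#}" by (simp add: A1 A2 A3)
  have p: "p = [: - (k * x * y * z), k * (x * y + y * z + x * z), - (k * (x + y + z)), k :]"
    using A(2) unfolding xyz deg k_def[symmetric] by (simp add: algebra_simps)
  have c: "coeff p 0 = - (k * x * y * z)" "coeff p 1 = k * (x * y + y * z + x * z)"
    "coeff p 2 = - (k * (x + y + z))" "coeff p 3 = k"
    by (subst p, simp add: numeral_2_eq_2 numeral_3_eq_3)+
  have "discr3 (coeff p 0) (coeff p 1) (coeff p 2) (coeff p 3) = k^4 * ((x - y) * (y - z) * (x - z))^2"
    unfolding c discr3_def by algebra
  then have "x \<noteq> y" "y \<noteq> z" "x \<noteq> z" using assms(3) by auto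
  moreover have "poly p s = k * ((s - x) * (s - y) * (s - z))" for s
    by (subst p) (simp add: algebra_simps)
  then have "{s. poly p s = 0} = {x, y, z}" using assms(2) k_def by auto
  ultimately show "finite {s. poly p s = 0}" "card {s. poly p s = 0} = 3" by simp_all
qed

section \<open>Lines through a general point\<close>

text \<open>Along the affine line of points \<open>u\<close> whose lines contain the given point the equation has degree
  1, as the direction has rank 1; its slope is not zero for a general point.\<close>

lemma multidegree_0:
  assumes "d \<noteq> 0"
  shows "general (\<lambda>A :: complex^6^1.
       let N = {l \<in> lines_of (B_MA d a b c). vec.span (rows A) \<subseteq> l} in finite N \<and> card N = 1)"
proof -
  define D :: "complex^6^1 \<Rightarrow> complex" where "D = (\<lambda>A. A $ 1 $ 5)"
  define w where "w = (\<lambda>i (A :: complex^6^1). A $ 1 $ i / A $ 1 $ 5)"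
  define G where "G = (\<lambda>A. MA_slope d a b (w 0 A) (w 1 A) (w 2 A) (w 3 A) (w 4 A))"
  have D: "D \<in> mpoly_fun" unfolding D_def by (rule mpoly_fun.coord)
  have w: "ratf D (w i)" for i
    unfolding w_def by (rule ratf_divide[where E' = "\<lambda>_. 1"]) (auto intro: ratf_coord mpoly_intros simp: D_def)
  have G: "ratf D G" unfolding G_def MA_slope_def Let_def by (intro ratf_intros D w)
  have "\<exists>A. D A \<noteq> 0 \<and> G A \<noteq> 0"
  proof -
    \<comment> \<open>For the point with \<open>w\<^sub>3 = 1 / e\<close> and the other coordinates 0 the slope is \<open>H e / e\<^sup>2\<close>.\<close>
    define H where "H = (\<lambda>e::complex. - d - a 2 * e + b 1 * e * e)"
    have "isCont H 0" unfolding H_def by (intro continuous_intros)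
    moreover have "H 0 \<noteq> 0" using assms by (simp add: H_def)
    ultimately obtain e where e: "e \<noteq> 0" "H e \<noteq> 0" using nonzero_near_0 by blast
    define A :: "complex^6^1" where "A = (\<chi> i j. if j = 3 then 1 / e else if j = 5 then 1 else 0)"
    have "G A = d * - (1 / e * (1 / e)) - a 2 * (1 / e) + b 1"
      by (simp add: G_def w_def A_def MA_slope_def)
    also have "\<dots> = H e / (e * e)" using e(1) by (simp add: H_def field_simps)
    finally have "G A \<noteq> 0" using e by simp
    moreover have "D A \<noteq> 0" by (simp add: D_def A_def)
    ultimately show ?thesis by blast
  qed
  then obtain A0 where "D A0 \<noteq> 0" "G A0 \<noteq> 0" by blast
  from general_ratf[OF D G this] show ?thesis
  proof (rule general_mono)
    fix A assume A: "D A \<noteq> 0 \<and> G A \<noteq> 0"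
    define v where "v = A $ 1"
    have v5: "v $ 5 \<noteq> 0" using A by (simp add: D_def v_def)
    define s where "s = v $ 0 / v $ 5"
    have w': "w i A = v $ i / v $ 5" for i by (simp add: w_def v_def)
    have v: "v $ 0 = s * v $ 5" "v $ 1 = w 1 A * v $ 5" "v $ 2 = w 2 A * v $ 5" "v $ 3 = w 3 A * v $ 5"
      "v $ 4 = w 4 A * v $ 5"
      using v5 by (simp_all add: w' s_def)
    have s: "w 0 A = s" by (simp add: w' s_def)
    have slope: "MA_slope d a b s (w 1 A) (w 2 A) (w 3 A) (w 4 A) \<noteq> 0"
      using A by (simp add: G_def s)
    have rows: "rows A = {v}"
      unfolding rows_def v_def by (auto simp: row_def vec_eq_iff)
    have span: "vec.span (rows A) \<subseteq> l \<longleftrightarrow> v \<in> l" if "l \<in> lines_of (B_MA d a b c)" for l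
    proof -
      have "vec.subspace l" using that by (simp add: lines_of_def proj_line_def)
      then show ?thesis unfolding rows
        by (meson empty_subsetI insert_subset vec.span_minimal vec.span_base singletonI subsetD)
    qed
    have mem: "v \<in> MA_line u \<longleftrightarrow> u$2 = s * u$1 - w 1 A \<and> u$3 = s * u$2 - w 2 A \<and>
        u$4 = s * u$3 - w 3 A \<and> u$5 = s * u$4 - w 4 A" if "u $ 0 = 1" for u
    proof -
      have *: "x * v $ 5 = y * (s * v $ 5) - z * v $ 5 \<longleftrightarrow> z = s * y - x" for x y z
      proof -
        have "x * v $ 5 = y * (s * v $ 5) - z * v $ 5 \<longleftrightarrow> v $ 5 * (z - (s * y - x)) = 0"
          by (simp add: algebra_simps)
        then show ?thesis using v5 by simp
      qed
      show ?thesis unfolding MA_line_nth[OF that] v * ..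
    qed
    define u1 where "u1 = - MA_start d a b c s (w 1 A) (w 2 A) (w 3 A) (w 4 A) /
      MA_slope d a b s (w 1 A) (w 2 A) (w 3 A) (w 4 A)"
    define u2 where "u2 = s * u1 - w 1 A"
    define u3 where "u3 = s * u2 - w 2 A"
    define u4 where "u4 = s * u3 - w 3 A"
    define u :: "complex^6" where "u = (\<chi> i. if i = 0 then 1 else if i = 1 then u1 else if i = 2 then u2
      else if i = 3 then u3 else if i = 4 then u4 else s * u4 - w 4 A)"
    have u: "u $ 0 = 1" "u $ 1 = u1" "u $ 2 = u2" "u $ 3 = u3" "u $ 4 = u4" "u $ 5 = s * u4 - w 4 A"
      by (simp_all add: u_def)
    have "v \<in> MA_line u" unfolding mem[OF u(1)] u by (simp add: u2_def u3_def u4_def)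
    moreover have "MA_poly d a b c u = 0"
    proof -
      have "MA_poly d a b c u = MA_start d a b c s (w 1 A) (w 2 A) (w 3 A) (w 4 A)
          + u1 * MA_slope d a b s (w 1 A) (w 2 A) (w 3 A) (w 4 A)"
        unfolding MA_poly_eq u by (rule MAf_through_point) (simp_all add: u2_def u3_def u4_def)
      then show ?thesis using slope by (simp add: u1_def)
    qed
    ultimately have u_mem: "MA_line u \<in> {l \<in> lines_of (B_MA d a b c). vec.span (rows A) \<subseteq> l}"
      using MA_line_in_congruence[OF u(1)] span by blast
    have "l = MA_line u" if l: "l \<in> lines_of (B_MA d a b c)" "v \<in> l" for l
      using l(1)
    proof (cases rule: congruence_line_cases)
      case (affine u')
      then have m: "u'$2 = s * u'$1 - w 1 A" "u'$3 = s * u'$2 - w 2 A" "u'$4 = s * u'$3 - w 3 A"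
        "u'$5 = s * u'$4 - w 4 A" using l(2) mem by auto
      have "MA_start d a b c s (w 1 A) (w 2 A) (w 3 A) (w 4 A)
          + u'$1 * MA_slope d a b s (w 1 A) (w 2 A) (w 3 A) (w 4 A) = 0"
        using affine(2) unfolding MA_poly_eq MAf_through_point[OF m] .
      then have "u'$1 = u1" using slope by (simp add: u1_def field_simps add_eq_0_iff)
      then have "u' = u" using m affine(1) u by (simp add: vec_eq_iff forall_6 u2_def u3_def u4_def)
      then show ?thesis using affine(3) by simp
    next
      case (inside x y)
      then have "v \<in> L" using l(2) unfolding span_pair by (auto simp: L_def)
      then show ?thesis using v5 by (simp add: L_def)
    next
      case (pencil x)
      have "MA_slope d a b (v$0 / v$5) (v$1 / v$5) (v$2 / v$5) (v$3 / v$5) (v$4 / v$5) = 0"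
        using line_at_infinity_slope(1)[OF pencil(1,3) _ v5] l(2) pencil(2) by blast
      then show ?thesis using slope by (simp add: w' s_def)
    qed
    then have "{l \<in> lines_of (B_MA d a b c). vec.span (rows A) \<subseteq> l} = {MA_line u}"
      using u_mem span by blast
    then show "let N = {l \<in> lines_of (B_MA d a b c). vec.span (rows A) \<subseteq> l} in finite N \<and> card N = 1"
      by simp
  qed
qed

section \<open>Row spaces in graph form\<close>

lemma span_pair_subset:
  assumes "vec.subspace V"
  shows "vec.span {x, y} \<subseteq> V \<longleftrightarrow> x \<in> V \<and> y \<in> V"
proof
  assume "vec.span {x, y} \<subseteq> V"
  moreover have "x \<in> vec.span {x, y}" "y \<in> vec.span {x, y}" by (auto intro: vec.span_base)
  ultimately show "x \<in> V \<and> y \<in> V" by (meson subsetD)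
next
  assume "x \<in> V \<and> y \<in> V"
  then have "{x, y} \<subseteq> V" by simp
  then show "vec.span {x, y} \<subseteq> V" using assms by (rule vec.span_minimal)
qed

text \<open>The columns of \<open>A\<close> selected by \<open>\<sigma>\<close>. If they form an invertible matrix, the row space is
  the graph of a linear map; \<open>gcoeff \<sigma> A k\<close> expresses the coordinate \<open>k\<close> of its elements through
  the selected ones (Cramer's rule).\<close>

definition columns_at :: "('n \<Rightarrow> 6) \<Rightarrow> complex^6^'n \<Rightarrow> complex^'n^'n" where
  "columns_at \<sigma> A = (\<chi> i j. A $ i $ \<sigma> j)"

definition gcoeff :: "('n::finite \<Rightarrow> 6) \<Rightarrow> complex^6^'n \<Rightarrow> 6 \<Rightarrow> complex^'n" where
  "gcoeff \<sigma> A k = (\<chi> j. det (\<chi> i l. if l = j then A $ i $ k else A $ i $ \<sigma> l) / det (columns_at \<sigma> A))"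

lemma gcoeff_iff:
  assumes "det (columns_at \<sigma> A) \<noteq> 0"
  shows "columns_at \<sigma> A *v x = (\<chi> i. A $ i $ k) \<longleftrightarrow> x = gcoeff \<sigma> A k"
  unfolding cramer[OF assms] gcoeff_def
  by (simp add: columns_at_def cong: if_cong)

lemma gcoeff_selected:
  assumes "det (columns_at \<sigma> A) \<noteq> 0"
  shows "gcoeff \<sigma> A (\<sigma> j) = axis j 1"
proof -
  have "columns_at \<sigma> A *v axis j 1 = (\<chi> i. A $ i $ \<sigma> j)"
    by (simp add: matrix_vector_mul_component vec_eq_iff inner_axis' columns_at_def matrix_vector_mult_def axis_def
      if_distrib[of "\<lambda>x. _ * x"] cong: if_cong)
  then show ?thesis using gcoeff_iff[OF assms] by metis
qed

lemma row_space_graph: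
  fixes A :: "complex^6^'n"
  assumes "det (columns_at \<sigma> A) \<noteq> 0"
  shows "y \<in> vec.span (rows A) \<longleftrightarrow> (\<forall>k. y $ k = (\<Sum>j\<in>UNIV. gcoeff \<sigma> A k $ j * y $ \<sigma> j))"
proof
  define S where "S = {y :: complex^6. \<forall>k. y $ k = (\<Sum>j\<in>UNIV. gcoeff \<sigma> A k $ j * y $ \<sigma> j)}"
  assume y: "y \<in> vec.span (rows A)"
  have rS: "rows A \<subseteq> S"
  proof
    fix v assume "v \<in> rows A"
    then obtain i where v: "v = row i A" unfolding rows_def by blast
    have "A $ i $ k = (\<Sum>j\<in>UNIV. gcoeff \<sigma> A k $ j * A $ i $ \<sigma> j)" for k
    proof -
      have "(columns_at \<sigma> A *v gcoeff \<sigma> A k) $ i = A $ i $ k"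
        using gcoeff_iff[OF assms, of "gcoeff \<sigma> A k" k] by simp
      then show ?thesis by (simp add: matrix_vector_mult_def columns_at_def mult.commute)
    qed
    then show "v \<in> S" unfolding S_def v row_def mem_Collect_eq vec_lambda_beta by blast
  qed
  have "vec.subspace S"
  proof (rule vec.subspaceI)
    show "0 \<in> S" by (simp add: S_def)
    show "x + z \<in> S" if "x \<in> S" "z \<in> S" for x z
    proof -
      have "(x + z) $ k = (\<Sum>j\<in>UNIV. gcoeff \<sigma> A k $ j * (x + z) $ \<sigma> j)" for k
      proof -
        have "x $ k = (\<Sum>j\<in>UNIV. gcoeff \<sigma> A k $ j * x $ \<sigma> j)"
          "z $ k = (\<Sum>j\<in>UNIV. gcoeff \<sigma> A k $ j * z $ \<sigma> j)" using that unfolding S_def by blast+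
        from arg_cong2[OF this, of "(+)"] show ?thesis
          by (simp only: vector_add_component distrib_left sum.distrib)
      qed
      then show ?thesis unfolding S_def by blast
    qed
    show "c *s x \<in> S" if "x \<in> S" for c x
    proof -
      have "(c *s x) $ k = (\<Sum>j\<in>UNIV. gcoeff \<sigma> A k $ j * (c *s x) $ \<sigma> j)" for k
      proof -
        have "x $ k = (\<Sum>j\<in>UNIV. gcoeff \<sigma> A k $ j * x $ \<sigma> j)" using that unfolding S_def by blast
        from arg_cong[OF this, of "\<lambda>x. c * x"] show ?thesis
          by (simp only: vector_smult_component sum_distrib_left mult.left_commute)
      qed
      then show ?thesis unfolding S_def by blast
    qed
  qed
  from subsetD[OF vec.span_minimal[OF rS this] y] have "y \<in> S" .
  then show "\<forall>k. y $ k = (\<Sum>j\<in>UNIV. gcoeff \<sigma> A k $ j * y $ \<sigma> j)" unfolding S_def by blast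
next
  assume y: "\<forall>k. y $ k = (\<Sum>j\<in>UNIV. gcoeff \<sigma> A k $ j * y $ \<sigma> j)"
  have "det (transpose (columns_at \<sigma> A)) \<noteq> 0" using assms by simp
  from cramer[OF this] obtain c where c: "transpose (columns_at \<sigma> A) *v c = (\<chi> j. y $ \<sigma> j)" by blast
  then have cj: "(\<Sum>i\<in>UNIV. A $ i $ \<sigma> j * c $ i) = y $ \<sigma> j" for j
    by (simp add: vec_eq_iff matrix_vector_mult_def transpose_def columns_at_def)
  have Ag: "A $ i $ k = (\<Sum>j\<in>UNIV. A $ i $ \<sigma> j * gcoeff \<sigma> A k $ j)" for i k
  proof -
    have "(columns_at \<sigma> A *v gcoeff \<sigma> A k) $ i = A $ i $ k"
      using gcoeff_iff[OF assms, of "gcoeff \<sigma> A k" k] by simp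
    then show ?thesis by (simp add: matrix_vector_mult_def columns_at_def)
  qed
  have "y $ k = (\<Sum>i\<in>UNIV. c $ i *s row i A) $ k" for k
  proof -
    have "(\<Sum>i\<in>UNIV. c $ i *s row i A) $ k = (\<Sum>i\<in>UNIV. c $ i * A $ i $ k)"
      by (simp add: row_def)
    also have "\<dots> = (\<Sum>i\<in>UNIV. \<Sum>j\<in>UNIV. c $ i * (A $ i $ \<sigma> j * gcoeff \<sigma> A k $ j))"
      unfolding sum_distrib_left[symmetric] by (intro sum.cong refl arg_cong[of _ _ "\<lambda>x. _ * x"] Ag)
    also have "\<dots> = (\<Sum>j\<in>UNIV. \<Sum>i\<in>UNIV. c $ i * (A $ i $ \<sigma> j * gcoeff \<sigma> A k $ j))"
      by (rule sum.swap)
    also have "\<dots> = (\<Sum>j\<in>UNIV. gcoeff \<sigma> A k $ j * (\<Sum>i\<in>UNIV. A $ i $ \<sigma> j * c $ i))"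
      by (simp add: sum_distrib_left mult_ac)
    also have "\<dots> = y $ k" unfolding cj using y[rule_format, of k] by (rule sym)
    finally show ?thesis by simp
  qed
  then have "y = (\<Sum>i\<in>UNIV. c $ i *s row i A)" unfolding vec_eq_iff by blast
  also have "\<dots> \<in> vec.span (rows A)"
    by (intro vec.span_sum vec.span_scale vec.span_base) (auto simp: rows_def)
  finally show "y \<in> vec.span (rows A)" .
qed

lemma mpoly_det_columns: "(\<lambda>A. det (columns_at \<sigma> A)) \<in> mpoly_fun"
  by (rule mpoly_det) (simp add: columns_at_def mpoly_fun.coord)

lemma mpoly_gcoeff_numerator:
  "(\<lambda>A. det (\<chi> i l. if l = j then A $ i $ k else A $ i $ \<sigma> l)) \<in> mpoly_fun"
proof (rule mpoly_det)
  fix i' l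
  show "(\<lambda>A. (\<chi> i l. if l = j then A $ i $ k else A $ i $ \<sigma> l) $ i' $ l) \<in> mpoly_fun"
    by (cases "l = j") (simp_all add: mpoly_fun.coord)
qed

lemma ratf_gcoeff:
  assumes "E \<in> mpoly_fun"
  shows "ratf (\<lambda>A. det (columns_at \<sigma> A) * E A) (\<lambda>A. gcoeff \<sigma> A k $ j)"
  unfolding gcoeff_def vec_lambda_beta
  by (rule ratf_divide[OF ratf_mpoly[OF mpoly_gcoeff_numerator] assms]) simp

text \<open>Polynomials with coefficients depending rationally on a matrix.\<close>

definition rpoly :: "((complex^'m^'n) \<Rightarrow> complex) \<Rightarrow> ((complex^'m^'n) \<Rightarrow> complex poly) \<Rightarrow> bool" where
  "rpoly D P \<longleftrightarrow> (\<forall>k. ratf D (\<lambda>A. coeff (P A) k))"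

lemma rpoly_add: "D \<in> mpoly_fun \<Longrightarrow> rpoly D P \<Longrightarrow> rpoly D Q \<Longrightarrow> rpoly D (\<lambda>A. P A + Q A)"
  by (simp add: rpoly_def ratf_add)

lemma rpoly_uminus: "rpoly D P \<Longrightarrow> rpoly D (\<lambda>A. - P A)"
  by (simp add: rpoly_def ratf_uminus)

lemma rpoly_diff: "D \<in> mpoly_fun \<Longrightarrow> rpoly D P \<Longrightarrow> rpoly D Q \<Longrightarrow> rpoly D (\<lambda>A. P A - Q A)"
  by (simp add: rpoly_def ratf_diff)

lemma rpoly_mult: "D \<in> mpoly_fun \<Longrightarrow> rpoly D P \<Longrightarrow> rpoly D Q \<Longrightarrow> rpoly D (\<lambda>A. P A * Q A)"
  unfolding rpoly_def coeff_mult by (intro allI ratf_sum ratf_mult) auto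

lemma rpoly_0: "rpoly D (\<lambda>A. 0)"
  by (simp add: rpoly_def ratf_const)

lemma rpoly_const: "rpoly D (\<lambda>A. P)"
  by (simp add: rpoly_def ratf_const)

lemma rpoly_pCons:
  assumes "ratf D G" "rpoly D P"
  shows "rpoly D (\<lambda>A. pCons (G A) (P A))"
  unfolding rpoly_def
proof
  fix k
  show "ratf D (\<lambda>A. coeff (pCons (G A) (P A)) k)"
    using assms by (cases k) (simp_all add: rpoly_def)
qed

lemmas rpoly_intros = rpoly_add rpoly_diff rpoly_uminus rpoly_mult rpoly_0

text \<open>The equation for unknowns that are polynomials in one variable.\<close>

abbreviation MAp :: "complex \<Rightarrow> (nat \<Rightarrow> complex) \<Rightarrow> (nat \<Rightarrow> complex) \<Rightarrow> complex \<Rightarrow>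
    complex poly \<Rightarrow> complex poly \<Rightarrow> complex poly \<Rightarrow> complex poly \<Rightarrow> complex poly \<Rightarrow> complex poly" where
  "MAp d a b c \<equiv> MAf [:d:] (\<lambda>i. [:a i:]) (\<lambda>i. [:b i:]) [:c:]"

lemma poly_MAp:
  "poly (MAp d a b c U1 U2 U3 U4 U5) s = MAf d a b c (poly U1 s) (poly U2 s) (poly U3 s) (poly U4 s) (poly U5 s)"
  by (simp add: MAf_def)

lemma rpoly_MAp:
  assumes "D \<in> mpoly_fun" "rpoly D U1" "rpoly D U2" "rpoly D U3" "rpoly D U4" "rpoly D U5"
  shows "rpoly D (\<lambda>A. MAp d a b c (U1 A) (U2 A) (U3 A) (U4 A) (U5 A))"
  unfolding MAf_def by (intro rpoly_add rpoly_diff rpoly_mult rpoly_const assms)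

lemma degree_mult_bound: "degree p \<le> m \<Longrightarrow> degree q \<le> n \<Longrightarrow> m + n \<le> k \<Longrightarrow> degree (p * q) \<le> k"
  using degree_mult_le[of p q] by linarith

lemma degree_MAp:
  assumes "degree U1 \<le> 1" "degree U2 \<le> 1" "degree U3 \<le> 1" "degree U4 \<le> 1" "degree U5 \<le> 1"
  shows "degree (MAp d a b c U1 U2 U3 U4 U5) \<le> 3"
proof -
  have c: "degree ([:k:] * P) \<le> 3" if "degree P \<le> 3" for k P
    using that degree_smult_le[of k P] by simp
  have 1: "degree P \<le> 3" if "degree P \<le> 1" for P :: "complex poly" using that by simp
  have 2: "degree (P * Q) \<le> 2" if "degree P \<le> 1" "degree Q \<le> 1" for P Q :: "complex poly"
    using degree_mult_bound[OF that] by simp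
  have 22: "degree P \<le> 3" if "degree P \<le> 2" for P :: "complex poly" using that by simp
  have 3: "degree (P * Q) \<le> 3" if "degree P \<le> 1" "degree Q \<le> 2" for P Q :: "complex poly"
    using degree_mult_bound[OF that] by simp
  show ?thesis unfolding MAf_def
    by (intro degree_add_le c) (intro degree_add_le degree_diff_le 3 2 22 1 assms; simp)+
qed

section \<open>Lines in a general 3-space\<close>

text \<open>A general 3-space is the graph of a linear map giving \<open>y\<^sub>1\<close> and \<open>y\<^sub>4\<close>.\<close>

definition sel4 :: "4 \<Rightarrow> 6" where
  "sel4 j = (if j = 1 then 0 else if j = 2 then 2 else if j = 3 then 3 else 5)"

lemma sel4_simps [simp]: "sel4 1 = 0" "sel4 2 = 2" "sel4 3 = 3" "sel4 4 = 5"
  by (simp_all add: sel4_def)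

lemma row_space_graph_4:
  assumes "det (columns_at sel4 A) \<noteq> 0"
  defines "g \<equiv> gcoeff sel4 A"
  shows "y \<in> vec.span (rows A) \<longleftrightarrow>
    y$1 = g 1 $ 1 * y$0 + g 1 $ 2 * y$2 + g 1 $ 3 * y$3 + g 1 $ 4 * y$5 \<and>
    y$4 = g 4 $ 1 * y$0 + g 4 $ 2 * y$2 + g 4 $ 3 * y$3 + g 4 $ 4 * y$5"
proof -
  have "g 0 = axis 1 1" "g 2 = axis 2 1" "g 3 = axis 3 1" "g 5 = axis 4 1"
    using gcoeff_selected[OF assms(1), of 1] gcoeff_selected[OF assms(1), of 2]
      gcoeff_selected[OF assms(1), of 3] gcoeff_selected[OF assms(1), of 4] by (simp_all add: g_def)
  then show ?thesis
    unfolding row_space_graph[OF assms(1)] g_def[symmetric] forall_6 sum_4 sel4_simps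
    by (simp add: axis_def)
qed

text \<open>A matrix whose row space is the graph with the given coefficients.\<close>

definition graph4 :: "complex^4 \<Rightarrow> complex^4 \<Rightarrow> complex^6^4" where
  "graph4 p q = (\<chi> i k. if k = 1 then p $ i else if k = 4 then q $ i else if k = sel4 i then 1 else 0)"

lemma graph4:
  "columns_at sel4 (graph4 p q) = mat 1"
  "gcoeff sel4 (graph4 p q) 1 = p" "gcoeff sel4 (graph4 p q) 4 = q"
proof -
  have "sel4 j \<noteq> 1 \<and> sel4 j \<noteq> 4 \<and> (sel4 j = sel4 i \<longleftrightarrow> i = j)" for i j
    using exhaust_4[of i] exhaust_4[of j] by auto
  then show 1: "columns_at sel4 (graph4 p q) = mat 1"
    by (simp add: columns_at_def graph4_def mat_def vec_eq_iff)
  then have d: "det (columns_at sel4 (graph4 p q)) \<noteq> 0" by simp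
  show "gcoeff sel4 (graph4 p q) 1 = p"
    by (rule gcoeff_iff[OF d, THEN iffD1, symmetric], unfold 1) (simp add: graph4_def vec_eq_iff)
  show "gcoeff sel4 (graph4 p q) 4 = q"
    by (rule gcoeff_iff[OF d, THEN iffD1, symmetric], unfold 1) (simp add: graph4_def vec_eq_iff)
qed

text \<open>The lines of \<open>Gam\<close> in the 3-space correspond to the points of an affine line, parametrized by \<open>u\<^sub>3\<close>,
  on which the equation is the cubic polynomial \<open>N\<close>.\<close>

lemma multidegree_2:
  assumes "d \<noteq> 0"
  shows "general (\<lambda>A :: complex^6^4.
       let N = {l \<in> lines_of (B_MA d a b c). l \<subseteq> vec.span (rows A)} in finite N \<and> card N = 3)"
proof -
  define del where "del = (\<lambda>A :: complex^6^4. det (columns_at sel4 A))"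
  define num where "num = (\<lambda>k j (A :: complex^6^4). det (\<chi> i l. if l = j then A $ i $ k else A $ i $ sel4 l))"
  define \<alpha> where "\<alpha> = (\<lambda>j A. gcoeff sel4 A 1 $ j)"
  define \<beta> where "\<beta> = (\<lambda>j A. gcoeff sel4 A 4 $ j)"
  define F where "F = (\<lambda>A. del A * del A - num 1 3 A * num 4 2 A)"
  define D where "D = (\<lambda>A. del A * F A)"
  define r where "r = (\<lambda>A. del A * del A / F A)"
  have del: "del \<in> mpoly_fun" unfolding del_def by (rule mpoly_det_columns)
  have F: "F \<in> mpoly_fun" unfolding F_def num_def
    by (intro mpoly_intros mpoly_gcoeff_numerator del)
  have D: "D \<in> mpoly_fun" unfolding D_def by (intro mpoly_intros del F)
  have \<alpha>: "ratf D (\<alpha> j)" and \<beta>: "ratf D (\<beta> j)" for j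
    unfolding D_def del_def \<alpha>_def \<beta>_def by (rule ratf_gcoeff[OF F])+
  have r: "ratf D r" unfolding r_def
    by (rule ratf_divide[OF ratf_mult[OF ratf_mpoly[OF del] ratf_mpoly[OF del]] del]) (simp add: D_def)
  have r1: "r A * (1 - \<alpha> 3 A * \<beta> 2 A) = 1" if "D A \<noteq> 0" for A
  proof -
    have nz: "del A \<noteq> 0" "F A \<noteq> 0" using that by (simp_all add: D_def)
    have ab: "\<alpha> 3 A = num 1 3 A / del A" "\<beta> 2 A = num 4 2 A / del A"
      by (simp_all add: \<alpha>_def \<beta>_def gcoeff_def num_def del_def)
    have "1 - \<alpha> 3 A * \<beta> 2 A = F A / (del A * del A)"
      unfolding ab F_def using nz(1) by (simp add: diff_divide_distrib)
    then show ?thesis using nz by (simp add: r_def)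
  qed
  define U2 where "U2 = (\<lambda>A. [: r A * (\<alpha> 3 A * \<beta> 1 A - \<alpha> 4 A), r A * (\<alpha> 2 A + \<alpha> 3 A * \<beta> 3 A) :])"
  define U4 where "U4 = (\<lambda>A. [: r A * (\<beta> 1 A - \<beta> 2 A * \<alpha> 4 A), r A * (\<beta> 3 A + \<beta> 2 A * \<alpha> 2 A) :])"
  define U1 where "U1 = (\<lambda>A. [: \<alpha> 1 A, \<alpha> 3 A :] + [: \<alpha> 2 A :] * U2 A)"
  define U5 where "U5 = (\<lambda>A. [: - \<beta> 4 A, \<beta> 2 A :] + [: \<beta> 3 A :] * U4 A)"
  define N where "N = (\<lambda>A. MAp d a b c (U1 A) (U2 A) [:0, 1:] (U4 A) (U5 A))"
  have U: "rpoly D U1" "rpoly D U2" "rpoly D U4" "rpoly D U5"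
    unfolding U1_def U2_def U4_def U5_def
    by (intro rpoly_intros rpoly_pCons ratf_intros D \<alpha> \<beta> r)+
  have N: "rpoly D N" unfolding N_def by (intro rpoly_MAp D U rpoly_const)
  have deg: "degree (N A) \<le> 3" for A
    unfolding N_def by (rule degree_MAp) (simp_all add: U1_def U2_def U4_def U5_def)
  define G where "G = (\<lambda>A. discr3 (coeff (N A) 0) (coeff (N A) 1) (coeff (N A) 2) (coeff (N A) 3))"
  \<comment> \<open>The 3-space meets \<open>L\<close> in a line. This line does not meet the twisted cubic if \<open>R1\<close> is
    not zero, and as a point of \<open>G1L\<close> it does not lie on the second quadric if \<open>R2\<close> is not zero.\<close>
  define R1 where "R1 = (\<lambda>A. (1 - \<alpha> 3 A * \<beta> 2 A) * (1 - \<alpha> 3 A * \<beta> 2 A)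
    - (\<alpha> 2 A + \<alpha> 3 A * \<beta> 3 A) * \<beta> 3 A * (1 - \<alpha> 3 A * \<beta> 2 A)
    - (\<alpha> 2 A + \<alpha> 3 A * \<beta> 3 A) * (\<alpha> 2 A + \<alpha> 3 A * \<beta> 3 A) * \<beta> 2 A)"
  define R2 where "R2 = (\<lambda>A. \<alpha> 3 A * (\<alpha> 2 A * \<beta> 3 A - \<alpha> 3 A * \<beta> 2 A + 1) + \<alpha> 2 A * \<alpha> 2 A)"
  have coeffN: "ratf D (\<lambda>A. coeff (N A) k)" for k using N by (simp add: rpoly_def)
  have ratf: "ratf D G" "ratf D R1" "ratf D R2"
    unfolding G_def discr3_def R1_def R2_def by (intro ratf_intros D \<alpha> \<beta> coeffN)+
  have g4: "\<alpha> j (graph4 p q) = p $ j" "\<beta> j (graph4 p q) = q $ j" for j p q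
    by (simp_all add: \<alpha>_def \<beta>_def graph4)
  have del4: "del (graph4 p q) = 1" for p q by (simp add: del_def graph4)
  have D4: "D (graph4 p q) = 1 - p $ 3 * q $ 2" for p q
  proof -
    have "num 1 3 (graph4 p q) = \<alpha> 3 (graph4 p q)" "num 4 2 (graph4 p q) = \<beta> 2 (graph4 p q)"
      using del4[of p q] by (simp_all add: \<alpha>_def \<beta>_def gcoeff_def num_def del_def)
    then show ?thesis by (simp add: D_def F_def del4 g4)
  qed
  have genR1: "general (\<lambda>A. D A \<noteq> 0 \<and> R1 A \<noteq> 0)"
    by (rule general_ratf[OF D ratf(2), of "graph4 0 0"]) (simp_all add: D4 R1_def g4)
  have genR2: "general (\<lambda>A. D A \<noteq> 0 \<and> R2 A \<noteq> 0)"
    by (rule general_ratf[OF D ratf(3), of "graph4 (axis 2 1) 0"]) (simp_all add: D4 R2_def g4 axis_def)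
  have ex: "D (graph4 (axis 1 k) (axis 4 (- k))) \<noteq> 0"
    "N (graph4 (axis 1 k) (axis 4 (- k))) = [: a 3 * (k * k) + (b 1 + b 5) * k + c, d * (k * k) + (a 1 + a 6) * k + b 3,
      - (a 3 + a 4), - d :]" for k
  proof -
    let ?A = "graph4 (axis 1 k) (axis 4 (- k))"
    have U: "U1 ?A = [:k:]" "U2 ?A = 0" "U4 ?A = 0" "U5 ?A = [:k:]"
      by (simp_all add: U1_def U2_def U4_def U5_def g4 axis_def)
    show "D ?A \<noteq> 0" by (simp add: D4 axis_def)
    show "N ?A = [: a 3 * (k * k) + (b 1 + b 5) * k + c, d * (k * k) + (a 1 + a 6) * k + b 3, - (a 3 + a 4), - d :]"
      unfolding N_def U MAf_def by (simp add: algebra_simps)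
  qed
  have gen3: "general (\<lambda>A. D A \<noteq> 0 \<and> coeff (N A) 3 \<noteq> 0)"
    by (rule general_ratf[OF D coeffN ex(1)], unfold ex(2)) (simp add: assms numeral_3_eq_3)
  have genG: "general (\<lambda>A. D A \<noteq> 0 \<and> G A \<noteq> 0)"
  proof -
    \<comment> \<open>For \<open>k = 1 / e\<close> the discriminant is \<open>H e / e\<^sup>6\<close>, and \<open>H 0\<close> depends on \<open>d\<close> only.\<close>
    define n0 n1 n2 where "n0 = (\<lambda>e. a 3 + (b 1 + b 5) * e + c * e * e)"
      and "n1 = (\<lambda>e. d + (a 1 + a 6) * e + b 3 * e * e)" and "n2 = - (a 3 + a 4)"
    define H where "H = (\<lambda>e. n1 e ^ 2 * n2 ^ 2 * e ^ 2 + 4 * d * n1 e ^ 3 - 4 * n2 ^ 3 * n0 e * e ^ 4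
      - 27 * d ^ 2 * n0 e ^ 2 * e ^ 2 - 18 * n0 e * n1 e * n2 * d * e ^ 2)"
    have "isCont H 0" unfolding H_def n0_def n1_def by (intro continuous_intros)
    moreover have "H 0 \<noteq> 0" using assms by (simp add: H_def n1_def)
    ultimately obtain e where e: "e \<noteq> 0" "H e \<noteq> 0" using nonzero_near_0 by blast
    let ?A = "graph4 (axis 1 (1 / e)) (axis 4 (- (1 / e)))"
    have n: "coeff (N ?A) 0 = n0 e / e ^ 2" "coeff (N ?A) 1 = n1 e / e ^ 2" "coeff (N ?A) 2 = n2"
      "coeff (N ?A) 3 = - d"
      unfolding ex(2) n0_def n1_def n2_def
      using e(1) by (simp_all add: numeral_2_eq_2 numeral_3_eq_3 field_simps)
    have "G ?A * e ^ 6 = H e"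
      unfolding G_def n discr3_def H_def using e(1) by (simp add: field_simps eval_nat_numeral)
    then have "G ?A \<noteq> 0" using e by auto
    then show ?thesis by (rule general_ratf[OF D ratf(1) ex(1)])
  qed
  show ?thesis
  proof (rule general_mono[OF general_conj[OF general_conj[OF genR1 genR2] general_conj[OF gen3 genG]]])
    fix A assume "((D A \<noteq> 0 \<and> R1 A \<noteq> 0) \<and> (D A \<noteq> 0 \<and> R2 A \<noteq> 0)) \<and>
      ((D A \<noteq> 0 \<and> coeff (N A) 3 \<noteq> 0) \<and> (D A \<noteq> 0 \<and> G A \<noteq> 0))"
    then have nz: "D A \<noteq> 0" "R1 A \<noteq> 0" "R2 A \<noteq> 0" "coeff (N A) 3 \<noteq> 0" "G A \<noteq> 0" by auto
    define V where "V = vec.span (rows A)"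
    have V: "y \<in> V \<longleftrightarrow> y$1 = \<alpha> 1 A * y$0 + \<alpha> 2 A * y$2 + \<alpha> 3 A * y$3 + \<alpha> 4 A * y$5 \<and>
      y$4 = \<beta> 1 A * y$0 + \<beta> 2 A * y$2 + \<beta> 3 A * y$3 + \<beta> 4 A * y$5" for y
      unfolding V_def \<alpha>_def \<beta>_def using nz(1) by (intro row_space_graph_4) (simp add: D_def del_def)
    have sub: "vec.span {x, y} \<subseteq> V \<longleftrightarrow> x \<in> V \<and> y \<in> V" for x y
      by (rule span_pair_subset) (simp add: V_def)
    define uu where "uu = (\<lambda>s. (\<chi> i. if i = 0 then 1 else if i = 1 then poly (U1 A) s
      else if i = 2 then poly (U2 A) s else if i = 3 then s else if i = 4 then poly (U4 A) s
      else poly (U5 A) s) :: complex^6)"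
    have uu: "uu s $ 0 = 1" "uu s $ 1 = poly (U1 A) s" "uu s $ 2 = poly (U2 A) s" "uu s $ 3 = s"
      "uu s $ 4 = poly (U4 A) s" "uu s $ 5 = poly (U5 A) s" for s by (simp_all add: uu_def)
    have MA: "MA_poly d a b c (uu s) = poly (N A) s" for s
      unfolding MA_poly_eq uu N_def poly_MAp by simp
    have rA: "r A * (1 - \<alpha> 3 A * \<beta> 2 A) = 1" by (rule r1[OF nz(1)])
    have pU2: "poly (U2 A) s = r A * (\<alpha> 3 A * \<beta> 1 A - \<alpha> 4 A) + s * (r A * (\<alpha> 2 A + \<alpha> 3 A * \<beta> 3 A))"
      and pU4: "poly (U4 A) s = r A * (\<beta> 1 A - \<beta> 2 A * \<alpha> 4 A) + s * (r A * (\<beta> 3 A + \<beta> 2 A * \<alpha> 2 A))"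
      and pU1: "poly (U1 A) s = \<alpha> 1 A + s * \<alpha> 3 A + \<alpha> 2 A * poly (U2 A) s"
      and pU5: "poly (U5 A) s = - \<beta> 4 A + s * \<beta> 2 A + \<beta> 3 A * poly (U4 A) s" for s
      by (simp_all add: U1_def U2_def U4_def U5_def) algebra+
    have lineV: "MA_line u \<subseteq> V \<longleftrightarrow> u = uu (u $ 3)" if u0: "u $ 0 = 1" for u
    proof -
      have "MA_line u \<subseteq> V \<longleftrightarrow>
        (u$1 = \<alpha> 1 A + \<alpha> 2 A * u$2 + \<alpha> 3 A * u$3 \<and> u$4 = \<beta> 1 A + \<beta> 2 A * u$2 + \<beta> 3 A * u$3) \<and>
        (- u$2 = - \<alpha> 2 A * u$3 - \<alpha> 3 A * u$4 + \<alpha> 4 A \<and> - u$5 = - \<beta> 2 A * u$3 - \<beta> 3 A * u$4 + \<beta> 4 A)"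
        unfolding MA_line_span[OF u0] sub V by simp
      also have "\<dots> \<longleftrightarrow> u$1 = poly (U1 A) (u$3) \<and> u$2 = poly (U2 A) (u$3) \<and> u$4 = poly (U4 A) (u$3)
          \<and> u$5 = poly (U5 A) (u$3)" (is "?l \<longleftrightarrow> ?r")
      proof
        assume l: ?l
        have 24: "u$2 = poly (U2 A) (u$3)" "u$4 = poly (U4 A) (u$3)"
          unfolding pU2 pU4 using l rA by algebra+
        have "u$1 = \<alpha> 1 A + u$3 * \<alpha> 3 A + \<alpha> 2 A * u$2" "u$5 = - \<beta> 4 A + u$3 * \<beta> 2 A + \<beta> 3 A * u$4"
          using l by algebra+
        then show ?r using 24 pU1[of "u$3"] pU5[of "u$3"] by simp
      next
        assume r: ?r
        have 2: "u$2 = r A * (\<alpha> 3 A * \<beta> 1 A - \<alpha> 4 A) + u$3 * (r A * (\<alpha> 2 A + \<alpha> 3 A * \<beta> 3 A))"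
          and 4: "u$4 = r A * (\<beta> 1 A - \<beta> 2 A * \<alpha> 4 A) + u$3 * (r A * (\<beta> 3 A + \<beta> 2 A * \<alpha> 2 A))"
          and 1: "u$1 = \<alpha> 1 A + u$3 * \<alpha> 3 A + \<alpha> 2 A * u$2"
          and 5: "u$5 = - \<beta> 4 A + u$3 * \<beta> 2 A + \<beta> 3 A * u$4"
          using r pU1 pU2 pU4 pU5 by simp_all
        have "u$4 = \<beta> 1 A + \<beta> 2 A * u$2 + \<beta> 3 A * u$3" "- u$2 = - \<alpha> 2 A * u$3 - \<alpha> 3 A * u$4 + \<alpha> 4 A"
          using 2 4 rA by algebra+
        then show ?l using 1 5 by (simp add: algebra_simps)
      qed
      also have "\<dots> \<longleftrightarrow> u = uu (u $ 3)" using u0 by (auto simp: vec_eq_iff forall_6 uu)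
      finally show ?thesis .
    qed
    have "{l \<in> lines_of (B_MA d a b c). l \<subseteq> V} = (\<lambda>s. MA_line (uu s)) ` {s. poly (N A) s = 0}"
    proof (intro equalityI subsetI)
      fix l assume "l \<in> {l \<in> lines_of (B_MA d a b c). l \<subseteq> V}"
      then have l: "l \<in> lines_of (B_MA d a b c)" "l \<subseteq> V" by auto
      from l(1) show "l \<in> (\<lambda>s. MA_line (uu s)) ` {s. poly (N A) s = 0}"
      proof (cases rule: congruence_line_cases)
        case (affine u)
        then have u: "u = uu (u $ 3)" using lineV l(2) by simp
        then have "poly (N A) (u $ 3) = 0" using MA[of "u $ 3"] affine(2) by simp
        moreover have "l = MA_line (uu (u $ 3))" using affine(3) u by simp
        ultimately show ?thesis by blast
      next
        case (inside x y)
        then have xy: "x \<in> V" "y \<in> V" using l(2) sub by auto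
        define k where "k = x$2 * y$3 - x$3 * y$2"
        have L: "x$0 = 0" "x$5 = 0" "y$0 = 0" "y$5 = 0" using inside(1,2) by (simp_all add: L_def)
        have x: "x$1 = \<alpha> 2 A * x$2 + \<alpha> 3 A * x$3" "x$4 = \<beta> 2 A * x$2 + \<beta> 3 A * x$3"
          and y: "y$1 = \<alpha> 2 A * y$2 + \<alpha> 3 A * y$3" "y$4 = \<beta> 2 A * y$2 + \<beta> 3 A * y$3"
          using xy V L by simp_all
        have p: "x$1 * y$2 - x$2 * y$1 = - k * \<alpha> 3 A" "x$1 * y$3 - x$3 * y$1 = k * \<alpha> 2 A"
          "x$1 * y$4 - x$4 * y$1 = k * (\<alpha> 2 A * \<beta> 3 A - \<alpha> 3 A * \<beta> 2 A)" "x$2 * y$3 - x$3 * y$2 = k"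
          unfolding x y k_def by (algebra, algebra, algebra, rule refl)
        have "MA_quadric2 d a b c (wedge x y) = - d * (k * k) * R2 A"
          unfolding MA_quadric2_def wedge_nth p L R2_def mult_zero_left mult_zero_right by algebra
        moreover have "k \<noteq> 0"
        proof
          assume "k = 0"
          have "\<forall>i j. x$i * y$j - x$j * y$i = 0"
            unfolding forall_6 using p \<open>k = 0\<close> L x y by (simp add: algebra_simps)
          then have "wedge x y = 0" by (simp add: vec_eq_iff)
          then show False using inside(4) by simp
        qed
        ultimately show ?thesis using inside(5) assms nz(3) by simp
      next
        case (pencil x)
        define s where "s = x $ 0 / x $ 5"
        have "tcubic (x $ 0) (x $ 5) \<in> V" using pencil(2) l(2) sub by auto
        then have t: "x$5^3 = \<alpha> 2 A * (x$0 * x$5^2) + \<alpha> 3 A * (x$0^2 * x$5)"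
          "x$0^3 = \<beta> 2 A * (x$0 * x$5^2) + \<beta> 3 A * (x$0^2 * x$5)"
          unfolding V by simp_all
        have x5: "x$5 \<noteq> 0"
        proof
          assume "x$5 = 0"
          then have "x$0 = 0" using t(2) by simp
          then show False using pencil(1) \<open>x$5 = 0\<close> by simp
        qed
        have x0: "x$0 = s * x$5" using x5 by (simp add: s_def)
        have "x$5^3 * (1 - (\<alpha> 2 A * s + \<alpha> 3 A * s^2)) = 0" "x$5^3 * (s * (s^2 - (\<beta> 2 A + \<beta> 3 A * s))) = 0"
          using t unfolding x0 by algebra+
        then have s: "\<alpha> 2 A * s + \<alpha> 3 A * s^2 = 1" "s * (s^2 - (\<beta> 2 A + \<beta> 3 A * s)) = 0" using x5 by simp_all
        have "s \<noteq> 0" using s(1) by auto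
        then have "s^2 = \<beta> 2 A + \<beta> 3 A * s" using s(2) by simp
        then have "R1 A = 0" unfolding R1_def using s(1) by algebra
        then show ?thesis using nz(2) by simp
      qed
    next
      fix l assume "l \<in> (\<lambda>s. MA_line (uu s)) ` {s. poly (N A) s = 0}"
      then obtain s where s: "l = MA_line (uu s)" "poly (N A) s = 0" by blast
      have "MA_line (uu s) \<in> lines_of (B_MA d a b c)"
        by (rule MA_line_in_congruence) (simp_all add: uu MA s)
      moreover have "MA_line (uu s) \<subseteq> V" using lineV[of "uu s"] by (simp add: uu)
      ultimately show "l \<in> {l \<in> lines_of (B_MA d a b c). l \<subseteq> V}" using s(1) by simp
    qed
    moreover have "inj_on (\<lambda>s. MA_line (uu s)) {s. poly (N A) s = 0}"
    proof (rule inj_onI)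
      fix s t assume "MA_line (uu s) = MA_line (uu t)"
      then have "uu s = uu t" by (rule MA_line_inj) (simp_all add: uu)
      then have "uu s $ 3 = uu t $ 3" by simp
      then show "s = t" by (simp only: uu)
    qed
    moreover note card_cubic_roots[OF deg nz(4) nz(5)[unfolded G_def]]
    ultimately show "let N = {l \<in> lines_of (B_MA d a b c). l \<subseteq> vec.span (rows A)} in finite N \<and> card N = 3"
      unfolding V_def by (simp add: card_image)
  qed
qed

section \<open>Lines in a general hyperplane meeting a general line of it\<close>

text \<open>The resultant of two cubic polynomials, as the determinant of the Bezout matrix. It is only used
  that a common zero \<open>s\<close> makes it vanish: the vector \<open>(1, s, s\<^sup>2)\<close> is then in the kernel of the matrix.\<close>

definition res3 :: "complex \<Rightarrow> complex \<Rightarrow> complex \<Rightarrow> complex \<Rightarrow> complex \<Rightarrow> complex \<Rightarrow> complex \<Rightarrow> complex \<Rightarrow> complex" where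
  "res3 f0 f1 f2 f3 n0 n1 n2 n3 =
    (let w10 = f1 * n0 - f0 * n1; w20 = f2 * n0 - f0 * n2; w30 = f3 * n0 - f0 * n3;
         w21 = f2 * n1 - f1 * n2; w31 = f3 * n1 - f1 * n3; w32 = f3 * n2 - f2 * n3
     in w10 * ((w30 + w21) * w32 - w31 * w31) - w20 * (w20 * w32 - w31 * w30)
       + w30 * (w20 * w31 - (w30 + w21) * w30))"

lemma res3_common_root:
  assumes "f0 + f1 * s + f2 * s^2 + f3 * s^3 = 0" "n0 + n1 * s + n2 * s^2 + n3 * s^3 = 0"
  shows "res3 f0 f1 f2 f3 n0 n1 n2 n3 = 0"
proof -
  define w10 w20 w30 where "w10 = f1 * n0 - f0 * n1" and "w20 = f2 * n0 - f0 * n2"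
    and "w30 = f3 * n0 - f0 * n3"
  define w21 w31 w32 where "w21 = f2 * n1 - f1 * n2" and "w31 = f3 * n1 - f1 * n3"
    and "w32 = f3 * n2 - f2 * n3"
  have "w10 + w20 * s + w30 * s^2 = 0" "w20 + (w30 + w21) * s + w31 * s^2 = 0"
    "w30 + w31 * s + w32 * s^2 = 0"
    using assms unfolding w10_def w20_def w30_def w21_def w31_def w32_def by algebra+
  then have "w10 * ((w30 + w21) * w32 - w31 * w31) - w20 * (w20 * w32 - w31 * w30)
       + w30 * (w20 * w31 - (w30 + w21) * w30) = 0" by algebra
  then show ?thesis
    by (simp add: res3_def Let_def w10_def w20_def w30_def w21_def w31_def w32_def)
qed

text \<open>Pull-back of the quadric of the equation to a family of lines of \<open>Gam\<close> with coordinates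
  \<open>p\<^sub>0\<^sub>5 = f\<close>, \<open>p\<^sub>i\<^sub>5 = U\<^sub>i\<close>, \<open>p\<^sub>0\<^sub>4 = - U\<^sub>5\<close>, \<open>p\<^sub>i\<^sub>j = - M\<^sub>i\<^sub>j\<close>; it is divisible by \<open>f\<close>.\<close>

lemma pullback_identity:
  fixes f s x1 :: "'a::idom"
  assumes w: "w1 = s * p1 + q1" "w2 = s * p2 + q2" "w3 = s * p3 + q3" "w4 = s * p4 + q4"
    and x: "x2 = s * x1 - (q1 + p2) * f" "x3 = s * x2 - (q2 + p3) * f" "x4 = s * x3 - (q3 + p4) * f"
  defines "U1 \<equiv> f * p1 + x1" and "U2 \<equiv> f * p2 + x2" and "U3 \<equiv> f * p3 + x3" and "U4 \<equiv> f * p4 + x4"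
    and "U5 \<equiv> s * x4 - f * q4"
    and "M12 \<equiv> w1 * x2 - w2 * x1 - f * (p1 * q2 - p2 * q1)"
    and "M13 \<equiv> w1 * x3 - w3 * x1 - f * (p1 * q3 - p3 * q1)"
    and "M14 \<equiv> w1 * x4 - w4 * x1 - f * (p1 * q4 - p4 * q1)"
    and "M23 \<equiv> w2 * x3 - w3 * x2 - f * (p2 * q3 - p3 * q2)"
    and "M24 \<equiv> w2 * x4 - w4 * x2 - f * (p2 * q4 - p4 * q2)"
    and "M34 \<equiv> w3 * x4 - w4 * x3 - f * (p3 * q4 - p4 * q3)"
  shows "f * (f * (MA_start d a b c s w1 w2 w3 w4 + p1 * MA_slope d a b s w1 w2 w3 w4)
      + x1 * MA_slope d a b s w1 w2 w3 w4) =
    d * (U1 * M34 - U2 * M24 + U3 * M23) + f * (a 1 * M12 + a 2 * M13 + a 3 * (M14 + M23) + a 4 * M23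
      + a 5 * M24 + a 6 * M34 + b 1 * U1 + b 2 * U2 + b 3 * U3 + b 4 * U4 + b 5 * U5 + c * f)"
  unfolding U1_def U2_def U3_def U4_def U5_def M12_def M13_def M14_def M23_def M24_def M34_def
    MA_start_def MA_slope_def MAf_def Let_def x w
  by algebra

text \<open>Let the hyperplane be \<open>y\<^sub>4 = g\<^sub>1 y\<^sub>0 + g\<^sub>2 y\<^sub>5 + g\<^sub>3 y\<^sub>1 + g\<^sub>4 y\<^sub>2 + g\<^sub>5 y\<^sub>3\<close> and let the line be
  spanned by \<open>(1, p, 0)\<close> and \<open>(0, q, 1)\<close>. The lines of \<open>Gam\<close> in the hyperplane that meet this line
  form a rational curve; for the line through \<open>(s, s p + q, 1)\<close> the first four coordinates of
  \<open>u\<close> are \<open>p + x / f\<close>, where \<open>f\<close> is the following cubic polynomial in \<open>s\<close> and the components of \<open>x\<close> are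
  quadratic polynomials, of which only the first one is needed.\<close>

definition fpol :: "complex^5 \<Rightarrow> complex poly" where
  "fpol g = [:g$3, g$4, g$5, -1:]"

definition xpol1 :: "(6 \<Rightarrow> complex) \<Rightarrow> (6 \<Rightarrow> complex) \<Rightarrow> complex^5 \<Rightarrow> complex poly" where
  "xpol1 p q g = [: g$4 * (q 1 + p 2) + g$5 * (q 2 + p 3) - (q 3 + p 4), g$5 * (q 1 + p 2) - (q 2 + p 3),
     - (q 1 + p 2) :]"

text \<open>The coordinates 1 to 4 of the point \<open>(s, s p + q, 1)\<close> as polynomials in \<open>s\<close>.\<close>

definition wpol :: "(6 \<Rightarrow> complex) \<Rightarrow> (6 \<Rightarrow> complex) \<Rightarrow> 6 \<Rightarrow> complex poly" where
  "wpol p q i = [:q i, p i:]"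

definition slope_pol :: "complex \<Rightarrow> (nat \<Rightarrow> complex) \<Rightarrow> (nat \<Rightarrow> complex) \<Rightarrow>
    (6 \<Rightarrow> complex) \<Rightarrow> (6 \<Rightarrow> complex) \<Rightarrow> complex poly" where
  "slope_pol d a b p q = MA_slope [:d:] (\<lambda>i. [:a i:]) (\<lambda>i. [:b i:]) [:0, 1:]
     (wpol p q 1) (wpol p q 2) (wpol p q 3) (wpol p q 4)"

definition start_pol :: "complex \<Rightarrow> (nat \<Rightarrow> complex) \<Rightarrow> (nat \<Rightarrow> complex) \<Rightarrow> complex \<Rightarrow>
    (6 \<Rightarrow> complex) \<Rightarrow> (6 \<Rightarrow> complex) \<Rightarrow> complex poly" where
  "start_pol d a b c p q = MA_start [:d:] (\<lambda>i. [:a i:]) (\<lambda>i. [:b i:]) [:c:] [:0, 1:]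
     (wpol p q 1) (wpol p q 2) (wpol p q 3) (wpol p q 4)"

text \<open>The numerator of the equation along this curve.\<close>

definition npol :: "complex \<Rightarrow> (nat \<Rightarrow> complex) \<Rightarrow> (nat \<Rightarrow> complex) \<Rightarrow> complex \<Rightarrow>
    (6 \<Rightarrow> complex) \<Rightarrow> (6 \<Rightarrow> complex) \<Rightarrow> complex^5 \<Rightarrow> complex poly" where
  "npol d a b c p q g = fpol g * (start_pol d a b c p q + [:p 1:] * slope_pol d a b p q)
     + xpol1 p q g * slope_pol d a b p q"

lemma poly_MA_slope:
  fixes d :: complex
  shows "poly (MA_slope [:d:] (\<lambda>i. [:a i:]) (\<lambda>i. [:b i:]) S w1 w2 w3 w4) s =
   MA_slope d a b (poly S s) (poly w1 s) (poly w2 s) (poly w3 s) (poly w4 s)"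
  by (simp add: MA_slope_def Let_def)

lemma poly_MA_start:
  fixes d :: complex
  shows "poly (MA_start [:d:] (\<lambda>i. [:a i:]) (\<lambda>i. [:b i:]) [:c:] S w1 w2 w3 w4) s =
   MA_start d a b c (poly S s) (poly w1 s) (poly w2 s) (poly w3 s) (poly w4 s)"
  unfolding MA_start_def poly_MAp by simp

lemma poly_slope_pol:
  "poly (slope_pol d a b p q) s = MA_slope d a b s (s * p 1 + q 1) (s * p 2 + q 2) (s * p 3 + q 3) (s * p 4 + q 4)"
  unfolding slope_pol_def poly_MA_slope by (simp add: wpol_def add.commute)

lemma poly_start_pol:
  "poly (start_pol d a b c p q) s = MA_start d a b c s (s * p 1 + q 1) (s * p 2 + q 2) (s * p 3 + q 3) (s * p 4 + q 4)"
  unfolding start_pol_def poly_MA_start by (simp add: wpol_def add.commute)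

lemma degree_quadric_combination:
  fixes f :: "complex poly"
  assumes "degree U1 \<le> 3" "degree U2 \<le> 3" "degree U3 \<le> 3" "degree U4 \<le> 3" "degree U5 \<le> 3"
    "degree M12 \<le> 3" "degree M13 \<le> 3" "degree M14 \<le> 3" "degree M23 \<le> 3" "degree M24 \<le> 3"
    "degree M34 \<le> 3" "degree f \<le> 3"
  shows "degree ([:d:] * (U1 * M34 - U2 * M24 + U3 * M23) + f * ([:a 1:] * M12 + [:a 2:] * M13
      + [:a 3:] * (M14 + M23) + [:a 4:] * M23 + [:a 5:] * M24 + [:a 6:] * M34 + [:b 1:] * U1
      + [:b 2:] * U2 + [:b 3:] * U3 + [:b 4:] * U4 + [:b 5:] * U5 + [:c:] * f)) \<le> 6"
proof -
  have sc: "degree ([:k:] * P) \<le> n" if "degree P \<le> n" for k P n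
    using that degree_smult_le[of k P] by simp
  have UM: "degree (P * Q) \<le> 6" if "degree P \<le> 3" "degree Q \<le> 3" for P Q :: "complex poly"
    using degree_mult_bound[OF that, of 6] by simp
  show ?thesis by (intro degree_add_le degree_diff_le sc UM assms)
qed

text \<open>The pull-back of the quadric to the curve has degree 6, and \<open>f\<close> divides it: at its
  zeros the curve meets the hyperplane \<open>p\<^sub>0\<^sub>5 = 0\<close>, in lines that lie on the quadric. Hence only three
  of the six points of intersection count.\<close>

lemma degree_npol: "degree (npol d a b c p q g) \<le> 3"
proof -
  define e1 e2 e3 where "e1 = q 1 + p 2" and "e2 = q 2 + p 3" and "e3 = q 3 + p 4"
  define x2 where "x2 = [: - e1 * g$3, g$5 * e2 - e3, - e2 :]"
  define x3 where "x3 = [: - e2 * g$3, - e1 * g$3 - e2 * g$4, - e3 :]"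
  define x4 where "x4 = [: - e3 * g$3, - e2 * g$3 - e3 * g$4, - e1 * g$3 - e2 * g$4 - e3 * g$5 :]"
  let ?f = "fpol g" and ?s = "[:0, 1:] :: complex poly" and ?x1 = "xpol1 p q g"
  have x2: "x2 = ?s * ?x1 - ([:q 1:] + [:p 2:]) * ?f"
    by (simp add: x2_def xpol1_def fpol_def e1_def e2_def e3_def algebra_simps)
  have x3: "x3 = ?s * x2 - ([:q 2:] + [:p 3:]) * ?f"
    by (simp add: x2_def x3_def fpol_def e1_def e2_def e3_def algebra_simps)
  have x4: "x4 = ?s * x3 - ([:q 3:] + [:p 4:]) * ?f"
    by (simp add: x3_def x4_def fpol_def e1_def e2_def e3_def algebra_simps)
  have w: "wpol p q i = ?s * [:p i:] + [:q i:]" for i by (simp add: wpol_def)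
  note id = pullback_identity[OF w w w w x2 x3 x4, where d = "[:d:]" and a = "\<lambda>i. [:a i:]" and b = "\<lambda>i. [:b i:]" and c = "[:c:]",
      folded slope_pol_def start_pol_def npol_def]
  have dx: "degree ?x1 \<le> 2" "degree x2 \<le> 2" "degree x3 \<le> 2" "degree x4 \<le> 2"
    by (simp_all add: xpol1_def x2_def x3_def x4_def)
  have df: "degree ?f = 3" by (simp add: fpol_def)
  have sc: "degree ([:k:] * P) \<le> n" if "degree P \<le> n" for k P n
    using that degree_smult_le[of k P] by simp
  have sc': "degree (P * [:k:]) \<le> n" if "degree P \<le> n" for k P n
    using sc[OF that, of k] by (simp add: mult.commute)
  have fk: "degree (?f * P) \<le> 3" if "degree P = 0" for P
    using degree_mult_bound[of ?f 3 P 0 3] df that by simp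
  have k0: "degree ([:k:] * [:l:] - [:m:] * [:n:]) = 0" for k l m n :: complex by simp
  have dx3: "degree ?x1 \<le> 3" "degree x2 \<le> 3" "degree x3 \<le> 3" "degree x4 \<le> 3" using dx by linarith+
  have dsx: "degree (?s * x4) \<le> 3" by (rule degree_mult_bound[of _ 1 _ 2]) (use dx in simp_all)
  have dw: "degree (wpol p q i) \<le> 1" for i by (simp add: wpol_def)
  have U: "degree (?f * [:k:] + P) \<le> 3" if "degree P \<le> 3" for k P
    using that df by (intro degree_add_le sc') simp_all
  have U5: "degree (?s * x4 - ?f * [:k:]) \<le> 3" for k
    using dsx df by (intro degree_diff_le sc') simp_all
  have M: "degree (wpol p q i * P - wpol p q j * Q - ?f * ([:k:] * [:l:] - [:m:] * [:n:])) \<le> 3"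
    if "degree P \<le> 2" "degree Q \<le> 2" for i j P Q k l m n
    using degree_mult_bound[OF dw[of i] that(1), of 3] degree_mult_bound[OF dw[of j] that(2), of 3]
    by (intro degree_diff_le fk k0) simp_all
  have "degree (?f * npol d a b c p q g) \<le> 6"
    unfolding id
    by (rule degree_quadric_combination)
      (rule U[OF dx3(1)] U[OF dx3(2)] U[OF dx3(3)] U[OF dx3(4)] U5 M[OF dx(2) dx(1)] M[OF dx(3) dx(1)]
        M[OF dx(4) dx(1)] M[OF dx(3) dx(2)] M[OF dx(4) dx(2)] M[OF dx(4) dx(3)] eq_refl[OF df])+
  show ?thesis
  proof (cases "npol d a b c p q g = 0")
    case False
    moreover have "?f \<noteq> 0" by (simp add: fpol_def)
    ultimately have "degree (?f * npol d a b c p q g) = 3 + degree (npol d a b c p q g)"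
      by (simp add: degree_mult_eq df)
    then show ?thesis using \<open>degree (?f * npol d a b c p q g) \<le> 6\<close> by simp
  qed simp
qed

lemma rpoly_npol:
  assumes "D \<in> mpoly_fun" "\<And>i. ratf D (\<lambda>A. p A i)" "\<And>i. ratf D (\<lambda>A. q A i)" "\<And>i. ratf D (\<lambda>A. g A $ i)"
  shows "rpoly D (\<lambda>A. npol d a b c (p A) (q A) (g A))" "rpoly D (\<lambda>A. fpol (g A))"
proof -
  have w: "rpoly D (\<lambda>A. wpol (p A) (q A) i)" for i
    unfolding wpol_def by (intro rpoly_pCons rpoly_0 assms)
  have f: "rpoly D (\<lambda>A. fpol (g A))"
    unfolding fpol_def by (intro rpoly_pCons rpoly_0 assms ratf_const)
  have x: "rpoly D (\<lambda>A. xpol1 (p A) (q A) (g A))"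
    unfolding xpol1_def by (intro rpoly_pCons rpoly_0 assms ratf_intros)
  have s: "rpoly D (\<lambda>A. slope_pol d a b (p A) (q A))"
    unfolding slope_pol_def MA_slope_def Let_def
    by (intro rpoly_add rpoly_diff rpoly_mult rpoly_const w assms)
  have t: "rpoly D (\<lambda>A. start_pol d a b c (p A) (q A))"
    unfolding start_pol_def MA_start_def
    by (intro rpoly_MAp rpoly_uminus rpoly_add rpoly_mult rpoly_const w assms)
  show "rpoly D (\<lambda>A. npol d a b c (p A) (q A) (g A))"
    unfolding npol_def by (intro rpoly_add rpoly_mult rpoly_pCons rpoly_0 f x s t assms)
  show "rpoly D (\<lambda>A. fpol (g A))" by (rule f)
qed

text \<open>A general hyperplane is the graph of a linear function giving \<open>y\<^sub>4\<close>.\<close>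

definition sel5 :: "5 \<Rightarrow> 6" where
  "sel5 j = (if j = 1 then 0 else if j = 2 then 5 else if j = 3 then 1 else if j = 4 then 2 else 3)"

lemma sel5_simps [simp]: "sel5 1 = 0" "sel5 2 = 5" "sel5 3 = 1" "sel5 4 = 2" "sel5 5 = 3"
  by (simp_all add: sel5_def)

lemma row_space_graph_5:
  assumes "det (columns_at sel5 A) \<noteq> 0"
  defines "g \<equiv> gcoeff sel5 A"
  shows "y \<in> vec.span (rows A) \<longleftrightarrow>
    y$4 = g 4 $ 1 * y$0 + g 4 $ 2 * y$5 + g 4 $ 3 * y$1 + g 4 $ 4 * y$2 + g 4 $ 5 * y$3"
proof -
  have "g 0 = axis 1 1" "g 5 = axis 2 1" "g 1 = axis 3 1" "g 2 = axis 4 1" "g 3 = axis 5 1"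
    using gcoeff_selected[OF assms(1), of 1] gcoeff_selected[OF assms(1), of 2]
      gcoeff_selected[OF assms(1), of 3] gcoeff_selected[OF assms(1), of 4]
      gcoeff_selected[OF assms(1), of 5] unfolding g_def sel5_simps by blast+
  then show ?thesis
    unfolding row_space_graph[OF assms(1)] g_def[symmetric] forall_6 sum_5 sel5_simps
    by (simp add: axis_def)
qed

text \<open>The hyperplane \<open>y\<^sub>4 = y\<^sub>1\<close> with the line where \<open>p\<close> and \<open>q\<close> are \<open>k\<close> times the second and the third unit
  vector. The determinant contributes \<open>d k\<^sup>3 (1 + s\<^sup>3)\<close> to the numerator of the equation, and
  \<open>f = 1 - s\<^sup>3\<close>; the remaining terms are of lower degree in \<open>k\<close>.\<close>

definition flag5 :: "complex \<Rightarrow> complex^6^5" where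
  "flag5 k = (\<chi> i j. if i = 1 then (if j = 0 then 1 else if j = 2 then k else 0)
     else if i = 2 then (if j = 5 then 1 else if j = 3 then k else 0)
     else if i = 3 then (if j = 1 \<or> j = 4 then 1 else 0)
     else if i = 4 then (if j = 2 then 1 else 0) else (if j = 3 then 1 else 0))"

lemma flag5:
  "det (columns_at sel5 (flag5 k)) \<noteq> 0" "gcoeff sel5 (flag5 k) 4 = axis 3 1"
proof -
  have mv: "columns_at sel5 (flag5 k) *v x = (\<chi> i. if i = 1 then x$1 + k * x$4 else if i = 2 then x$2 + k * x$5
    else if i = 3 then x$3 else if i = 4 then x$4 else x$5)" for x
    by (simp add: vec_eq_iff forall_5 matrix_vector_mult_def sum_5 columns_at_def flag5_def)
  have "\<forall>x. columns_at sel5 (flag5 k) *v x = 0 \<longrightarrow> x = 0"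
    unfolding mv by (auto simp: vec_eq_iff forall_5)
  then obtain B where "B ** columns_at sel5 (flag5 k) = mat 1"
    using matrix_left_invertible_ker by blast
  then have "invertible (columns_at sel5 (flag5 k))" by (metis invertible_left_inverse)
  then show d: "det (columns_at sel5 (flag5 k)) \<noteq> 0" by (simp add: invertible_det_nz)
  show "gcoeff sel5 (flag5 k) 4 = axis 3 1"
    by (rule gcoeff_iff[OF d, THEN iffD1, symmetric], unfold mv)
      (simp add: vec_eq_iff forall_5 flag5_def axis_def)
qed

lemma discr3_scale: "discr3 (t * n0) (t * n1) (t * n2) (t * n3) = t^4 * discr3 n0 n1 n2 n3"
  unfolding discr3_def by algebra

lemma res3_scale: "res3 f0 f1 f2 f3 (t * n0) (t * n1) (t * n2) (t * n3) = t^3 * res3 f0 f1 f2 f3 n0 n1 n2 n3"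
  unfolding res3_def Let_def by algebra

text \<open>The conditions on the hyperplane and the line that are used below: the equation along the curve
  has three simple zeros, none of them is a zero of \<open>f\<close> or at infinity, and the curve is
  parametrized injectively.\<close>

definition good_flag :: "complex \<Rightarrow> (nat \<Rightarrow> complex) \<Rightarrow> (nat \<Rightarrow> complex) \<Rightarrow> complex \<Rightarrow>
    (6 \<Rightarrow> complex) \<Rightarrow> (6 \<Rightarrow> complex) \<Rightarrow> complex^5 \<Rightarrow> bool" where
  "good_flag d a b c p q g \<longleftrightarrow> (let n = coeff (npol d a b c p q g); f = coeff (fpol g) in
     n 3 \<noteq> 0 \<and> discr3 (n 0) (n 1) (n 2) (n 3) \<noteq> 0 \<and> res3 (f 0) (f 1) (f 2) (f 3) (n 0) (n 1) (n 2) (n 3) \<noteq> 0 \<and>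
     q 1 + p 2 \<noteq> 0 \<and>
     MAf d a b c (p 1) (p 2) (p 3) (p 4)
       (g$3 * (q 1 + p 2) + g$4 * (q 2 + p 3) + g$5 * (q 3 + p 4) - q 4) \<noteq> 0)"

text \<open>The first two rows in terms of the basis of their span with first coordinates \<open>(1, 0)\<close> and last
  coordinates \<open>(0, 1)\<close>.\<close>

definition delta5 :: "complex^6^5 \<Rightarrow> complex" where
  "delta5 A = A$1$0 * A$2$5 - A$2$0 * A$1$5"

definition pvec :: "complex^6^5 \<Rightarrow> 6 \<Rightarrow> complex" where
  "pvec A i = (A$2$5 * A$1$i - A$1$5 * A$2$i) / delta5 A"

definition qvec :: "complex^6^5 \<Rightarrow> 6 \<Rightarrow> complex" where
  "qvec A i = (A$1$0 * A$2$i - A$2$0 * A$1$i) / delta5 A"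

lemma general_good_flag:
  assumes "d \<noteq> 0"
  shows "general (\<lambda>A. det (columns_at sel5 A) \<noteq> 0 \<and> delta5 A \<noteq> 0 \<and>
    good_flag d a b c (pvec A) (qvec A) (gcoeff sel5 A 4))"
proof -
  define D where "D = (\<lambda>A :: complex^6^5. det (columns_at sel5 A) * delta5 A)"
  define g where "g = (\<lambda>A. gcoeff sel5 A 4)"
  define n where "n = (\<lambda>i A. coeff (npol d a b c (pvec A) (qvec A) (g A)) i)"
  define f where "f = (\<lambda>i A. coeff (fpol (g A)) i)"
  have del: "delta5 \<in> mpoly_fun"
    unfolding delta5_def[abs_def] by (intro mpoly_intros)
  have D: "D \<in> mpoly_fun" unfolding D_def by (intro mpoly_intros mpoly_det_columns del)
  have pq: "ratf D (\<lambda>A. pvec A i)" "ratf D (\<lambda>A. qvec A i)" for i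
    unfolding pvec_def qvec_def
    by (rule ratf_divide[OF ratf_diff[OF D ratf_mult ratf_mult] mpoly_det_columns[of sel5]]; simp add: ratf_coord D_def)+
  have g: "ratf D (\<lambda>A. g A $ i)" for i
    unfolding D_def g_def by (rule ratf_gcoeff[OF del])
  have nf: "ratf D (n i)" "ratf D (f i)" for i
    using rpoly_npol[of D pvec qvec g, OF D pq g] by (simp_all add: rpoly_def n_def f_def)
  define G1 where "G1 = (\<lambda>A. discr3 (n 0 A) (n 1 A) (n 2 A) (n 3 A))"
  define G2 where "G2 = (\<lambda>A. res3 (f 0 A) (f 1 A) (f 2 A) (f 3 A) (n 0 A) (n 1 A) (n 2 A) (n 3 A))"
  define G3 where "G3 = (\<lambda>A. qvec A 1 + pvec A 2)"
  define G4 where "G4 = (\<lambda>A. MAf d a b c (pvec A 1) (pvec A 2) (pvec A 3) (pvec A 4)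
       (g A $ 3 * (qvec A 1 + pvec A 2) + g A $ 4 * (qvec A 2 + pvec A 3) + g A $ 5 * (qvec A 3 + pvec A 4) - qvec A 4))"
  have G: "ratf D G1" "ratf D G2" "ratf D G3" "ratf D G4"
    unfolding G1_def G2_def G3_def G4_def discr3_def res3_def MAf_def Let_def
    by (intro ratf_intros D pq g nf)+
  have exD: "D (flag5 k) \<noteq> 0" for k
    using flag5[of k] by (simp add: D_def delta5_def flag5_def)
  have expq: "pvec (flag5 k) 1 = 0" "pvec (flag5 k) 2 = k" "pvec (flag5 k) 3 = 0" "pvec (flag5 k) 4 = 0"
    "qvec (flag5 k) 1 = 0" "qvec (flag5 k) 2 = 0" "qvec (flag5 k) 3 = k" "qvec (flag5 k) 4 = 0" for k
    by (simp_all add: pvec_def qvec_def delta5_def flag5_def)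
  have exg: "g (flag5 k) = axis 3 1" for k by (simp add: g_def flag5)
  have exf: "fpol (g (flag5 k)) = [:1, 0, 0, -1:]" for k by (simp add: fpol_def exg axis_def)
  have exn: "npol d a b c (pvec (flag5 k)) (qvec (flag5 k)) (g (flag5 k)) =
    [: d * k^3 + (a 2 - a 6) * k^2 - (b 1 + b 4) * k + c,
       (a 1 + a 3 + a 4 - a 5) * k^2 - (b 2 + b 3 + b 5) * k,
       (a 2 - a 3 - a 4 - a 6) * k^2 - (b 1 + b 3 + b 4) * k,
       d * k^3 + (a 1 - a 5) * k^2 - (b 2 + b 5) * k - c :]" (is "?l = ?r") for k
  proof (rule poly_eq_poly_eq_iff[THEN iffD1], rule ext)
    fix s
    have "poly ?l s = (1 - s^3) * MA_start d a b c s 0 (s * k) k 0 - k * (1 + s^2) * MA_slope d a b s 0 (s * k) k 0"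
      unfolding npol_def exf
      unfolding poly_mult poly_add poly_slope_pol poly_start_pol expq xpol1_def exg
      by (simp add: axis_def power2_eq_square power3_eq_cube algebra_simps)
    also have "\<dots> = poly ?r s"
      unfolding MA_start_def MA_slope_def MAf_def Let_def poly_pCons poly_0 by algebra
    finally show "poly ?l s = poly ?r s" .
  qed
  \<comment> \<open>The coefficients for \<open>k = 1 / e\<close>, multiplied by \<open>e\<^sup>3\<close>.\<close>
  define v0 v1 v2 v3 where "v0 = (\<lambda>e. d + (a 2 - a 6) * e - (b 1 + b 4) * e^2 + c * e^3)"
    and "v1 = (\<lambda>e. (a 1 + a 3 + a 4 - a 5) * e - (b 2 + b 3 + b 5) * e^2)"
    and "v2 = (\<lambda>e. (a 2 - a 3 - a 4 - a 6) * e - (b 1 + b 3 + b 4) * e^2)"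
    and "v3 = (\<lambda>e. d + (a 1 - a 5) * e - (b 2 + b 5) * e^2 - c * e^3)"
  have exv: "n 0 (flag5 (1 / e)) = 1 / e^3 * v0 e" "n 1 (flag5 (1 / e)) = 1 / e^3 * v1 e"
    "n 2 (flag5 (1 / e)) = 1 / e^3 * v2 e" "n 3 (flag5 (1 / e)) = 1 / e^3 * v3 e" if "e \<noteq> 0" for e
    unfolding n_def exn v0_def v1_def v2_def v3_def
    using that by (simp_all add: numeral_2_eq_2 numeral_3_eq_3 field_simps)
  have fv: "f 0 (flag5 k) = 1" "f 1 (flag5 k) = 0" "f 2 (flag5 k) = 0" "f 3 (flag5 k) = -1" for k
    unfolding f_def exf by (simp_all add: numeral_2_eq_2 numeral_3_eq_3)
  have gen: "general (\<lambda>A. D A \<noteq> 0 \<and> G A \<noteq> 0)"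
    if G: "ratf D G" and H: "isCont H 0" "H 0 \<noteq> 0" and GH: "\<And>e. e \<noteq> 0 \<Longrightarrow> H e \<noteq> 0 \<Longrightarrow> G (flag5 (1 / e)) \<noteq> 0"
    for G and H :: "complex \<Rightarrow> complex"
  proof -
    obtain e where e: "e \<noteq> 0" "H e \<noteq> 0" using nonzero_near_0[OF H] by blast
    show ?thesis by (rule general_ratf[OF D G exD GH[OF e]])
  qed
  note cv = v0_def v1_def v2_def v3_def
  have c1: "general (\<lambda>A. D A \<noteq> 0 \<and> n 3 A \<noteq> 0)"
    by (rule gen[where H = v3, OF nf(1)]) (use assms in \<open>simp_all add: exv, simp_all add: cv\<close>)
  have c2: "general (\<lambda>A. D A \<noteq> 0 \<and> G1 A \<noteq> 0)"
  proof (rule gen[where H = "\<lambda>e. discr3 (v0 e) (v1 e) (v2 e) (v3 e)", OF G(1)])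
    show "isCont (\<lambda>e. discr3 (v0 e) (v1 e) (v2 e) (v3 e)) 0"
      unfolding discr3_def cv by (intro continuous_intros)
    show "discr3 (v0 0) (v1 0) (v2 0) (v3 0) \<noteq> 0" using assms by (simp add: discr3_def cv)
    show "G1 (flag5 (1 / e)) \<noteq> 0" if "e \<noteq> 0" "discr3 (v0 e) (v1 e) (v2 e) (v3 e) \<noteq> 0" for e
      unfolding G1_def exv[OF that(1)] discr3_scale using that by simp
  qed
  have c3: "general (\<lambda>A. D A \<noteq> 0 \<and> G2 A \<noteq> 0)"
  proof (rule gen[where H = "\<lambda>e. res3 1 0 0 (-1) (v0 e) (v1 e) (v2 e) (v3 e)", OF G(2)])
    show "isCont (\<lambda>e. res3 1 0 0 (-1) (v0 e) (v1 e) (v2 e) (v3 e)) 0"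
      unfolding res3_def Let_def cv by (intro continuous_intros)
    show "res3 1 0 0 (-1) (v0 0) (v1 0) (v2 0) (v3 0) \<noteq> 0" using assms by (simp add: res3_def cv)
    show "G2 (flag5 (1 / e)) \<noteq> 0" if "e \<noteq> 0" "res3 1 0 0 (-1) (v0 e) (v1 e) (v2 e) (v3 e) \<noteq> 0" for e
      unfolding G2_def fv exv[OF that(1)] res3_scale using that by simp
  qed
  have c4: "general (\<lambda>A. D A \<noteq> 0 \<and> G3 A \<noteq> 0)"
    by (rule gen[where H = "\<lambda>_. 1", OF G(3)]) (simp_all add: G3_def expq)
  have c5: "general (\<lambda>A. D A \<noteq> 0 \<and> G4 A \<noteq> 0)"
  proof (rule gen[where H = "\<lambda>e. - d + (a 5 - a 1) * e + (b 2 + b 5) * e^2 + c * e^3", OF G(4)])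
    show "isCont (\<lambda>e. - d + (a 5 - a 1) * e + (b 2 + b 5) * e^2 + c * e^3) 0" by (intro continuous_intros)
    show "- d + (a 5 - a 1) * 0 + (b 2 + b 5) * 0^2 + c * 0^3 \<noteq> 0" using assms by simp
    show "G4 (flag5 (1 / e)) \<noteq> 0"
      if "e \<noteq> 0" "- d + (a 5 - a 1) * e + (b 2 + b 5) * e^2 + c * e^3 \<noteq> 0" for e
    proof -
      have "G4 (flag5 (1 / e)) = 1 / e^3 * (- d + (a 5 - a 1) * e + (b 2 + b 5) * e^2 + c * e^3)"
        unfolding G4_def expq exg MAf_def using that(1)
        by (simp add: axis_def field_simps power2_eq_square power3_eq_cube)
      then show ?thesis using that by simp
    qed
  qed
  have "general (\<lambda>A. ((((D A \<noteq> 0 \<and> n 3 A \<noteq> 0) \<and> (D A \<noteq> 0 \<and> G1 A \<noteq> 0)) \<and> (D A \<noteq> 0 \<and> G2 A \<noteq> 0))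
      \<and> (D A \<noteq> 0 \<and> G3 A \<noteq> 0)) \<and> (D A \<noteq> 0 \<and> G4 A \<noteq> 0))"
    by (rule general_conj[OF general_conj[OF general_conj[OF general_conj[OF c1 c2] c3] c4] c5])
  then show ?thesis
  proof (rule general_mono)
    fix A assume h: "((((D A \<noteq> 0 \<and> n 3 A \<noteq> 0) \<and> (D A \<noteq> 0 \<and> G1 A \<noteq> 0)) \<and> (D A \<noteq> 0 \<and> G2 A \<noteq> 0))
      \<and> (D A \<noteq> 0 \<and> G3 A \<noteq> 0)) \<and> (D A \<noteq> 0 \<and> G4 A \<noteq> 0)"
    then have "det (columns_at sel5 A) \<noteq> 0" "delta5 A \<noteq> 0" unfolding D_def by auto
    moreover have "good_flag d a b c (pvec A) (qvec A) (gcoeff sel5 A 4)"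
      using h unfolding good_flag_def Let_def G1_def G2_def G3_def G4_def n_def f_def g_def by blast
    ultimately show "det (columns_at sel5 A) \<noteq> 0 \<and> delta5 A \<noteq> 0 \<and>
      good_flag d a b c (pvec A) (qvec A) (gcoeff sel5 A 4)" by blast
  qed
qed

text \<open>The lines of \<open>Gam\<close> in question are parametrized by the point \<open>(s, s p + q, 1)\<close> where they meet
  the given line; those of the system correspond to the zeros of \<open>npol\<close>.\<close>

lemma multidegree_1:
  assumes "d \<noteq> 0"
  shows "general (\<lambda>A :: complex^6^5.
       let N = {l \<in> lines_of (B_MA d a b c). l \<subseteq> vec.span (rows A) \<and>
                  l \<inter> vec.span {row 1 A, row 2 A} \<noteq> {0}} in finite N \<and> card N = 3)"
proof (rule general_mono[OF general_good_flag[OF assms, of a b c]])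
  fix A :: "complex^6^5"
  assume A: "det (columns_at sel5 A) \<noteq> 0 \<and> delta5 A \<noteq> 0 \<and>
    good_flag d a b c (pvec A) (qvec A) (gcoeff sel5 A 4)"
  define p q g where "p = pvec A" and "q = qvec A" and "g = gcoeff sel5 A 4"
  define V where "V = vec.span (rows A)"
  define pv qv :: "complex^6" where "pv = (\<chi> i. p i)" and "qv = (\<chi> i. q i)"
  have del: "delta5 A \<noteq> 0" using A by simp
  have V: "y \<in> V \<longleftrightarrow> y$4 = g$1 * y$0 + g$2 * y$5 + g$3 * y$1 + g$4 * y$2 + g$5 * y$3" for y
    unfolding V_def g_def using A by (intro row_space_graph_5) simp
  have subV: "vec.subspace V" by (simp add: V_def)
  have sub: "vec.span {x, y} \<subseteq> V \<longleftrightarrow> x \<in> V \<and> y \<in> V" for x y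
    using subV by (rule span_pair_subset)
  have pq05: "pv $ 0 = 1" "pv $ 5 = 0" "qv $ 0 = 0" "qv $ 5 = 1"
    using del by (simp_all add: pv_def qv_def p_def q_def pvec_def qvec_def delta5_def mult.commute)
  have r1: "row 1 A = (A$1$0) *s pv + (A$1$5) *s qv" and r2: "row 2 A = (A$2$0) *s pv + (A$2$5) *s qv"
    and pvr: "pv = (A$2$5 / delta5 A) *s row 1 A + (- A$1$5 / delta5 A) *s row 2 A"
    and qvr: "qv = (- A$2$0 / delta5 A) *s row 1 A + (A$1$0 / delta5 A) *s row 2 A"
  proof -
    have *: "x = (y * P + z * Q) / delta5 A" if "x * delta5 A = y * P + z * Q" for x y z P Q
      using that del by (simp add: field_simps)
    have "A$1$i = A$1$0 * (p i) + A$1$5 * q i" "A$2$i = A$2$0 * (p i) + A$2$5 * q i" for i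
    proof -
      have "A$1$i * delta5 A = A$1$0 * (A$2$5 * A$1$i - A$1$5 * A$2$i) + A$1$5 * (A$1$0 * A$2$i - A$2$0 * A$1$i)"
        "A$2$i * delta5 A = A$2$0 * (A$2$5 * A$1$i - A$1$5 * A$2$i) + A$2$5 * (A$1$0 * A$2$i - A$2$0 * A$1$i)"
        unfolding delta5_def by algebra+
      from this[THEN *] show "A$1$i = A$1$0 * (p i) + A$1$5 * q i" "A$2$i = A$2$0 * (p i) + A$2$5 * q i"
        unfolding p_def q_def pvec_def qvec_def times_divide_eq_right add_divide_distrib[symmetric] .
    qed
    then show "row 1 A = (A$1$0) *s pv + (A$1$5) *s qv" "row 2 A = (A$2$0) *s pv + (A$2$5) *s qv"
      unfolding vec_eq_iff row_def pv_def qv_def vector_add_component vector_smult_component vec_lambda_beta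
      by blast+
    show "pv = (A$2$5 / delta5 A) *s row 1 A + (- A$1$5 / delta5 A) *s row 2 A"
      "qv = (- A$2$0 / delta5 A) *s row 1 A + (A$1$0 / delta5 A) *s row 2 A"
      unfolding vec_eq_iff
      by (simp_all add: row_def pv_def qv_def p_def q_def pvec_def qvec_def diff_divide_distrib)
  qed
  have span: "vec.span {row 1 A, row 2 A} = {k *s pv + l *s qv | k l. True}"
  proof -
    have "pv \<in> vec.span {row 1 A, row 2 A}" "qv \<in> vec.span {row 1 A, row 2 A}"
      unfolding span_pair using pvr qvr by blast+
    then have "vec.span {pv, qv} \<subseteq> vec.span {row 1 A, row 2 A}"
      by (intro vec.span_minimal) auto
    moreover have "row 1 A \<in> vec.span {pv, qv}" "row 2 A \<in> vec.span {pv, qv}"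
      unfolding span_pair using r1 r2 by blast+
    then have "vec.span {row 1 A, row 2 A} \<subseteq> vec.span {pv, qv}"
      by (intro vec.span_minimal) auto
    ultimately show ?thesis unfolding span_pair[of pv qv, symmetric] by blast
  qed
  have "row 1 A \<in> rows A" "row 2 A \<in> rows A" unfolding rows_def by blast+
  then have "row 1 A \<in> V" "row 2 A \<in> V" by (simp_all add: V_def vec.span_base)
  then have pqV: "pv \<in> V" "qv \<in> V"
    unfolding pvr qvr using subV by (meson vec.subspace_add vec.subspace_scale)+
  have p4: "p 4 = g$1 + g$3 * p 1 + g$4 * p 2 + g$5 * p 3"
    and q4: "q 4 = g$2 + g$3 * q 1 + g$4 * q 2 + g$5 * q 3"
    using pqV unfolding V pq05 by (simp_all add: pv_def qv_def)
  define n f where "n = npol d a b c p q g" and "f = fpol g"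
  have good: "coeff n 3 \<noteq> 0" "discr3 (coeff n 0) (coeff n 1) (coeff n 2) (coeff n 3) \<noteq> 0"
    "res3 (coeff f 0) (coeff f 1) (coeff f 2) (coeff f 3) (coeff n 0) (coeff n 1) (coeff n 2) (coeff n 3) \<noteq> 0"
    "q 1 + p 2 \<noteq> 0"
    "MAf d a b c (p 1) (p 2) (p 3) (p 4)
       (g$3 * (q 1 + p 2) + g$4 * (q 2 + p 3) + g$5 * (q 3 + p 4) - q 4) \<noteq> 0"
    using A unfolding good_flag_def Let_def p_def q_def g_def n_def f_def by blast+
  have degn: "degree n \<le> 3" unfolding n_def by (rule degree_npol)
  have cubic: "poly P s = coeff P 0 + coeff P 1 * s + coeff P 2 * s^2 + coeff P 3 * s^3" if "degree P \<le> 3"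
    for P :: "complex poly" and s
  proof -
    have "P = [:coeff P 0, coeff P 1, coeff P 2, coeff P 3:]"
    proof (rule poly_eqI)
      fix k
      have "coeff P k = 0" if "k > 3" using that \<open>degree P \<le> 3\<close> by (intro coeff_eq_0) simp
      moreover have "k = 0 \<or> k = 1 \<or> k = 2 \<or> k = 3 \<or> k > 3" by linarith
      ultimately show "coeff P k = coeff [:coeff P 0, coeff P 1, coeff P 2, coeff P 3:] k"
        by (auto simp: numeral_2_eq_2 numeral_3_eq_3 coeff_pCons split: nat.splits)
    qed
    then have "poly P s = poly [:coeff P 0, coeff P 1, coeff P 2, coeff P 3:] s" by (rule arg_cong)
    then show ?thesis by (simp add: algebra_simps power2_eq_square power3_eq_cube)
  qed
  have coprime: "poly n s \<noteq> 0" if "poly f s = 0" for s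
  proof
    assume "poly n s = 0"
    moreover have "degree f \<le> 3" by (simp add: f_def fpol_def)
    ultimately show False
      using res3_common_root[of _ _ s] good(3) that cubic[OF degn, of s] cubic[of f s] by simp
  qed
  define w where "w = (\<lambda>i s. s * p i + q i)"
  define slope where "slope = (\<lambda>s. MA_slope d a b s (w 1 s) (w 2 s) (w 3 s) (w 4 s))"
  define start where "start = (\<lambda>s. MA_start d a b c s (w 1 s) (w 2 s) (w 3 s) (w 4 s))"
  define x1 where "x1 = xpol1 p q g"
  have n: "poly n s = poly f s * (start s + p 1 * slope s) + poly x1 s * slope s" for s
    unfolding n_def npol_def f_def x1_def start_def slope_def w_def
    by (simp only: poly_add poly_mult poly_start_pol poly_slope_pol poly_pCons poly_0 mult_zero_right add_0_right)
  have f: "poly f s = g$3 + g$4 * s + g$5 * s^2 - s^3" for s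
    by (simp add: f_def fpol_def algebra_simps power2_eq_square power3_eq_cube)
  have x1: "poly x1 s = g$4 * (q 1 + p 2) + g$5 * (q 2 + p 3) - (q 3 + p 4)
      + (g$5 * (q 1 + p 2) - (q 2 + p 3)) * s - (q 1 + p 2) * s^2" for s
    by (simp add: x1_def xpol1_def algebra_simps power2_eq_square)
  define u1 where "u1 = (\<lambda>s. p 1 + poly x1 s / poly f s)"
  define u2 where "u2 = (\<lambda>s. s * u1 s - w 1 s)"
  define u3 where "u3 = (\<lambda>s. s * u2 s - w 2 s)"
  define u4 where "u4 = (\<lambda>s. s * u3 s - w 3 s)"
  define u5 where "u5 = (\<lambda>s. s * u4 s - w 4 s)"
  define uu where "uu = (\<lambda>s. (\<chi> i. if i = 0 then 1 else if i = 1 then u1 s else if i = 2 then u2 s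
    else if i = 3 then u3 s else if i = 4 then u4 s else u5 s) :: complex^6)"
  have uu: "uu s $ 0 = 1" "uu s $ 1 = u1 s" "uu s $ 2 = u2 s" "uu s $ 3 = u3 s" "uu s $ 4 = u4 s" "uu s $ 5 = u5 s"
    for s by (simp_all add: uu_def)
  have eqn: "MA_poly d a b c u = start s + u$1 * slope s"
    if "u$2 = s * u$1 - w 1 s" "u$3 = s * u$2 - w 2 s" "u$4 = s * u$3 - w 3 s" "u$5 = s * u$4 - w 4 s" for u s
    unfolding MA_poly_eq start_def slope_def by (rule MAf_through_point[OF that])
  have xV: "xpt u \<in> V \<longleftrightarrow> poly f s * (u$1 - p 1) = poly x1 s"
    if "u$2 = s * u$1 - w 1 s" "u$3 = s * u$2 - w 2 s" "u$4 = s * u$3 - w 3 s" for u s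
  proof -
    have "u$4 - (g$1 + g$3 * u$1 + g$4 * u$2 + g$5 * u$3) = poly x1 s - poly f s * (u$1 - p 1)"
      unfolding that f x1 w_def using p4 by algebra
    then show ?thesis unfolding V xpt_nth by auto
  qed
  have mem: "s *s pv + qv \<in> MA_line u \<longleftrightarrow> u$2 = s * u$1 - w 1 s \<and> u$3 = s * u$2 - w 2 s \<and>
      u$4 = s * u$3 - w 3 s \<and> u$5 = s * u$4 - w 4 s" if "u $ 0 = 1" for u s
    unfolding MA_line_nth[OF that] vector_add_component vector_smult_component pq05
    by (auto simp: pv_def qv_def w_def algebra_simps)
  have uu_line: "s *s pv + qv \<in> MA_line (uu s)" for s
    unfolding mem[OF uu(1)] uu by (simp add: u2_def u3_def u4_def u5_def)
  have root: "poly f s \<noteq> 0" if "poly n s = 0" for s using coprime that by blast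
  have "{l \<in> lines_of (B_MA d a b c). l \<subseteq> V \<and> l \<inter> vec.span {row 1 A, row 2 A} \<noteq> {0}} =
      (\<lambda>s. MA_line (uu s)) ` {s. poly n s = 0}"
  proof (intro equalityI subsetI)
    fix l assume "l \<in> {l \<in> lines_of (B_MA d a b c). l \<subseteq> V \<and> l \<inter> vec.span {row 1 A, row 2 A} \<noteq> {0}}"
    then have l: "l \<in> lines_of (B_MA d a b c)" "l \<subseteq> V" "l \<inter> vec.span {row 1 A, row 2 A} \<noteq> {0}" by auto
    have lsub: "vec.subspace l" using l(1) by (simp add: lines_of_def proj_line_def)
    then have "0 \<in> l \<inter> vec.span {row 1 A, row 2 A}" by (simp add: vec.subspace_0 vec.span_zero)
    then obtain v where v: "v \<in> l" "v \<in> vec.span {row 1 A, row 2 A}" "v \<noteq> 0" using l(3) by blast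
    then obtain k m where km: "v = k *s pv + m *s qv" unfolding span by blast
    have v05: "v $ 0 = k" "v $ 5 = m" by (simp_all add: km pq05)
    have km0: "k \<noteq> 0 \<or> m \<noteq> 0" using v(3) unfolding km by (auto simp: vec_eq_iff)
    have vs: "(1 / m) *s v = (k / m) *s pv + qv" if "m \<noteq> 0"
      unfolding km using that by (simp add: vec_eq_iff field_simps)
    from l(1) show "l \<in> (\<lambda>s. MA_line (uu s)) ` {s. poly n s = 0}"
    proof (cases rule: congruence_line_cases)
      case (affine u)
      have "vec.span {xpt u, zpt u} \<subseteq> V"
        using l(2) unfolding affine(3) MA_line_span[OF affine(1)] .
      then have "xpt u \<in> V" "zpt u \<in> V" unfolding sub by blast+
      show ?thesis
      proof (cases "m = 0")
        case True
        then have "k \<noteq> 0" using km0 by simp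
        have "v \<in> MA_line u" using v(1) affine(3) by simp
        then have up: "u$1 = p 1" "u$2 = p 2" "u$3 = p 3" "u$4 = p 4"
          unfolding MA_line_nth[OF affine(1)] v05 True using \<open>k \<noteq> 0\<close>
          by (simp_all add: km True pv_def mult.commute)
        have "u$5 = g$3 * (q 1 + p 2) + g$4 * (q 2 + p 3) + g$5 * (q 3 + p 4) - q 4"
          using \<open>zpt u \<in> V\<close> unfolding V zpt_nth up q4 by algebra
        \<comment> \<open>The parameter value \<open>s = \<infinity>\<close>.\<close>
        then have False using affine(2) good(5) unfolding MA_poly_eq up by simp
        then show ?thesis ..
      next
        case False
        define s where "s = k / m"
        have "(1 / m) *s v \<in> l" using lsub v(1) by (simp add: vec.subspace_scale)
        then have "s *s pv + qv \<in> MA_line u" unfolding s_def vs[OF False, symmetric] affine(3) .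
        then have m: "u$2 = s * u$1 - w 1 s" "u$3 = s * u$2 - w 2 s" "u$4 = s * u$3 - w 3 s"
          "u$5 = s * u$4 - w 4 s" unfolding mem[OF affine(1)] by auto
        have fx: "poly f s * (u$1 - p 1) = poly x1 s" using xV[OF m(1-3)] \<open>xpt u \<in> V\<close> by simp
        have "poly n s = poly f s * (start s + u$1 * slope s)"
          unfolding n fx[symmetric] by (simp add: algebra_simps)
        then have n0: "poly n s = 0" using eqn[OF m] affine(2) by simp
        have "u$1 = u1 s" using fx root[OF n0] by (simp add: u1_def field_simps)
        then have "u = uu s"
          using m affine(1) by (simp add: vec_eq_iff forall_6 uu u2_def u3_def u4_def u5_def)
        then show ?thesis using affine(3) n0 by blast
      qed
    next
      case (inside x y)
      then have "v \<in> L" using v(1) unfolding span_pair by (auto simp: L_def)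
      then show ?thesis using km0 v05 by (simp add: L_def)
    next
      case (pencil x)
      have vx: "v \<in> vec.span {tcubic (x $ 0) (x $ 5), x}" using v(1) pencil(2) by simp
      have tV: "tcubic (x $ 0) (x $ 5) \<in> V" using l(2) unfolding pencil(2) sub by simp
      show ?thesis
      proof (cases "m = 0")
        case True
        then have "k \<noteq> 0" using km0 by simp
        obtain k' m' where "v = k' *s tcubic (x $ 0) (x $ 5) + m' *s x" using vx unfolding span_pair by blast
        then have "k = m' * x $ 0" "0 = m' * x $ 5" using v05 True by simp_all
        then have "x $ 5 = 0" "x $ 0 \<noteq> 0" using \<open>k \<noteq> 0\<close> by auto
        then show ?thesis using tV unfolding V by simp
      next
        case False
        define s where "s = k / m"
        have v5: "v $ 5 \<noteq> 0" using False v05 by simp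
        have vi: "v $ 1 / v $ 5 = w 1 s" "v $ 2 / v $ 5 = w 2 s" "v $ 3 / v $ 5 = w 3 s" "v $ 4 / v $ 5 = w 4 s"
          "v $ 0 / v $ 5 = s"
          unfolding v05 using False by (simp_all add: km pv_def qv_def w_def s_def field_simps)
        have "slope s = 0"
          using line_at_infinity_slope(1)[OF pencil(1,3) vx v5] unfolding vi slope_def .
        moreover have "poly f s = 0"
        proof -
          have "tcubic k m \<in> V"
            using line_at_infinity_slope(2)[OF pencil(1,3) vx v5] l(2) pencil(2) v05 by auto
          then have "k^3 = g$3 * m^3 + g$4 * (k * m^2) + g$5 * (k^2 * m)" unfolding V by simp
          moreover have "k = s * m" using False by (simp add: s_def)
          ultimately have "m^3 * poly f s = 0" unfolding f by algebra
          then show ?thesis using False by simp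
        qed
        ultimately have "poly n s = 0" unfolding n by simp
        then show ?thesis using root[of s] \<open>poly f s = 0\<close> by simp
      qed
    qed
  next
    fix l assume "l \<in> (\<lambda>s. MA_line (uu s)) ` {s. poly n s = 0}"
    then obtain s where s: "l = MA_line (uu s)" "poly n s = 0" by blast
    have f0: "poly f s \<noteq> 0" by (rule root[OF s(2)])
    have m: "uu s$2 = s * uu s$1 - w 1 s" "uu s$3 = s * uu s$2 - w 2 s" "uu s$4 = s * uu s$3 - w 3 s"
      "uu s$5 = s * uu s$4 - w 4 s" unfolding uu by (simp_all add: u2_def u3_def u4_def u5_def)
    have fx: "poly f s * (uu s $ 1 - p 1) = poly x1 s" using f0 by (simp add: uu u1_def)
    have "poly n s = poly f s * (start s + uu s $ 1 * slope s)"
      unfolding n fx[symmetric] by (simp add: algebra_simps)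
    then have "MA_poly d a b c (uu s) = 0" using eqn[OF m] s(2) f0 by simp
    then have "l \<in> lines_of (B_MA d a b c)" unfolding s(1) by (rule MA_line_in_congruence[OF uu(1)])
    moreover have "l \<subseteq> V"
    proof -
      have x: "xpt (uu s) \<in> V" using xV[OF m(1-3)] fx by simp
      have "zpt (uu s) = (s *s pv + qv) + (- s) *s xpt (uu s)"
        using m unfolding vec_eq_iff forall_6 vector_add_component vector_smult_component pq05 xpt_nth zpt_nth
        by (simp add: pv_def qv_def w_def)
      also have "\<dots> \<in> V" using x pqV subV by (intro vec.subspace_add vec.subspace_scale)
      finally show ?thesis unfolding s(1) MA_line_span[OF uu(1)] sub using x by blast
    qed
    moreover have "l \<inter> vec.span {row 1 A, row 2 A} \<noteq> {0}"
    proof -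
      have "s *s pv + 1 *s qv \<in> vec.span {row 1 A, row 2 A}" unfolding span by blast
      then have "s *s pv + qv \<in> l \<inter> vec.span {row 1 A, row 2 A}" using uu_line[of s] s(1) by simp
      moreover have "(s *s pv + qv) $ 5 \<noteq> 0" by (simp add: pq05)
      then have "s *s pv + qv \<noteq> 0" by (metis zero_index)
      ultimately show ?thesis by blast
    qed
    ultimately show "l \<in> {l \<in> lines_of (B_MA d a b c). l \<subseteq> V \<and> l \<inter> vec.span {row 1 A, row 2 A} \<noteq> {0}}" by simp
  qed
  moreover have "inj_on (\<lambda>s. MA_line (uu s)) {s. poly n s = 0}"
  proof (rule inj_onI, rule ccontr)
    fix s t assume "MA_line (uu s) = MA_line (uu t)" and st: "s \<noteq> t"
    then have e: "uu s = uu t" by (intro MA_line_inj) (simp_all add: uu)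
    then have "uu s $ 1 = uu t $ 1" "uu s $ 2 = uu t $ 2" "uu s $ 3 = uu t $ 3" by simp_all
    then have 1: "u1 s = u1 t" and 2: "u2 s = u2 t" and 3: "u3 s = u3 t" by (simp_all only: uu)
    have *: "X = P" if "s * X - (s * P + Q) = t * X - (t * P + Q)" for X P Q
    proof -
      have "(s - t) * (X - P) = 0" using that by (simp add: algebra_simps)
      then show ?thesis using st by simp
    qed
    have x: "u1 s = p 1" by (rule *[of _ _ "q 1"]) (use 1 2 in \<open>simp add: u2_def w_def\<close>)
    have "u2 s = p 2" by (rule *[of _ _ "q 2"]) (use 2 3 in \<open>simp add: u3_def w_def\<close>)
    then have "- q 1 = p 2" using x unfolding u2_def w_def by (simp add: algebra_simps)
    then have "q 1 + p 2 = 0" by (metis add.right_inverse)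
    then show False using good(4) by simp
  qed
  moreover note card_cubic_roots[OF degn good(1,2)]
  ultimately show "let N = {l \<in> lines_of (B_MA d a b c). l \<subseteq> vec.span (rows A) \<and>
      l \<inter> vec.span {row 1 A, row 2 A} \<noteq> {0}} in finite N \<and> card N = 3"
    unfolding V_def by (simp add: card_image)
qed

theorem theorem15:
  fixes a b :: "nat \<Rightarrow> complex" and c d :: complex
  assumes "d \<noteq> 0"
  shows "(\<exists>Q B. quadric Q \<and> G1L \<union> B'' \<subseteq> Q \<and> B = residual (G1L \<union> B'') (Gam \<inter> Q) \<and>
            congruence B \<and> B_MA d a b c = B)
         \<and> has_multidegree (B_MA d a b c) 1 3 3"
  using B_MA_residual_congruence[OF assms] multidegree_0[OF assms] multidegree_1[OF assms] multidegree_2[OF assms]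
  unfolding has_multidegree_def by (intro conjI)

end
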